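(* Let $B$ be a separable C*-algebra, let $D$ be a C*-algebra, $I\subseteq D$ a closed two-sided ideal and $q:D\to D/I$ the quotient map. Let $(\phi_\lambda)_{\lambda\in[1,\infty)}$ be an asymptotic homomorphism from $B$ to $D/I$ and let $\psi:B\to D/I$ be a $*$-homomorphism that is homotopic to $(\phi_\lambda)_{\lambda\in[1,\infty)}$. Suppose $\psi$ lifts to an asymptotic homomorphism from $B$ to $D$. Then $(\phi_\lambda)_{\lambda\in[1,\infty)}$ lifts to an asymptotic homomorphism from $B$ to $D$. Moreover the whole homotopy lifts: if $(\Phi_\lambda)_{\lambda\in[1,\infty)}$ is an asymptotic homomorphism from $B$ to $(D/I)\otimes C[0,1]$ which is a homotopy between $(\phi_\lambda)$ and $\psi$, then there is an asymptotic homomorphism $(\Psi_\lambda)_{\lambda\in[1,\infty)}$ from $B$ to $D\otimes C[0,1]$ with $(q\otimes\mathrm{id}_{C[0,1]})\circ\Psi_\lambda=\Phi_\lambda$ for every $\lambda\in[1,\infty)$.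
   Context: An asymptotic homomorphism from a C*-algebra $B$ to a C*-algebra $E$ is a family of maps $f_\lambda:B\to E$, $\lambda\in[1,\infty)$ (not assumed linear), such that $\lambda\mapsto f_\lambda(a)$ is continuous for each $a\in B$, and for all $a,b\in B$, $\mu_1,\mu_2\in\mathbb C$: $\lim_{\lambda\to\infty}\|f_\lambda(a^* )-f_\lambda(a)^*\|=0$, $\lim_{\lambda\to\infty}\|f_\lambda(\mu_1a+\mu_2b)-\mu_1f_\lambda(a)-\mu_2f_\lambda(b)\|=0$, $\lim_{\lambda\to\infty}\|f_\lambda(ab)-f_\lambda(a)f_\lambda(b)\|=0$. A $*$-homomorphism is regarded as a constant asymptotic homomorphism. Two asymptotic homomorphisms $(f_\lambda),(g_\lambda)$ from $B$ to $E$ are homotopic if there is an asymptotic homomorphism $(\Phi_\lambda)$ from $B$ to $E\otimes C[0,1]$ (a homotopy between them) with $\mathrm{ev}_1\circ\Phi_\lambda=f_\lambda$ and $\mathrm{ev}_0\circ\Phi_\lambda=g_\lambda$ for every $\lambda$. An asymptotic homomorphism $(f_\lambda)$ from $B$ to $D/I$ (in particular a $*$-homomorphism) lifts to an asymptotic homomorphism $(F_\lambda)$ from $B$ to $D$ if $q\circ F_\lambda=f_\lambda$ for every $\lambda$. *)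

theory Defs
  imports "HOL-Analysis.Analysis"
begin

text \<open>Algebras are not assumed to have a unit.\<close>

class cstar_algebra = real_normed_algebra + banach +
  fixes scaleC :: "complex \<Rightarrow> 'a \<Rightarrow> 'a"
    and star :: "'a \<Rightarrow> 'a"
  assumes scaleC_add_right: "scaleC c (x + y) = scaleC c x + scaleC c y"
    and scaleC_add_left: "scaleC (c + d) x = scaleC c x + scaleC d x"
    and scaleC_scaleC: "scaleC c (scaleC d x) = scaleC (c * d) x"
    and scaleC_of_real: "scaleC (complex_of_real r) x = scaleR r x"
    and scaleC_mult_left: "scaleC c x * y = scaleC c (x * y)"
    and scaleC_mult_right: "x * scaleC c y = scaleC c (x * y)"
    and norm_scaleC: "norm (scaleC c x) = cmod c * norm x"
    and star_star: "star (star x) = x"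
    and star_add: "star (x + y) = star x + star y"
    and star_scaleC: "star (scaleC c x) = scaleC (cnj c) (star x)"
    and star_mult: "star (x * y) = star y * star x"
    and cstar_identity: "norm (star x * x) = (norm x)\<^sup>2"

instantiation complex :: cstar_algebra
begin
definition scaleC_complex :: "complex \<Rightarrow> complex \<Rightarrow> complex" where "scaleC_complex = (*)"
definition star_complex :: "complex \<Rightarrow> complex" where "star_complex = cnj"
instance
  by standard
    (simp_all add: scaleC_complex_def star_complex_def algebra_simps scaleR_conv_of_real
      norm_mult power2_eq_square)
end

text \<open>
  The quotient by an ideal and the algebra of continuous functions on the unit interval depend
  on terms and live on proper subsets of a type, so they cannot be instances of the class. They
  are given as structures with an explicit carrier, of the following shape.
\<close>

record 'a cstar_structure =
  elems :: "'a set"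
  addS :: "'a \<Rightarrow> 'a \<Rightarrow> 'a"
  scaleS :: "complex \<Rightarrow> 'a \<Rightarrow> 'a"
  multS :: "'a \<Rightarrow> 'a \<Rightarrow> 'a"
  starS :: "'a \<Rightarrow> 'a"
  normS :: "'a \<Rightarrow> real"

definition distS :: "'a cstar_structure \<Rightarrow> 'a \<Rightarrow> 'a \<Rightarrow> real" where
  "distS E x y = normS E (addS E x (scaleS E (-1) y))"

definition continuousS_on :: "'a cstar_structure \<Rightarrow> real set \<Rightarrow> (real \<Rightarrow> 'a) \<Rightarrow> bool" where
  "continuousS_on E S g \<longleftrightarrow> (\<forall>s\<in>S. ((\<lambda>t. distS E (g t) (g s)) \<longlongrightarrow> 0) (at s within S))"

definition whole :: "'a::cstar_algebra cstar_structure" where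
  "whole = \<lparr> elems = UNIV, addS = (+), scaleS = scaleC, multS = (*), starS = star, normS = norm \<rparr>"


definition closed_ideal :: "'d::cstar_algebra set \<Rightarrow> bool" where
  "closed_ideal I \<longleftrightarrow> 0 \<in> I \<and> (\<forall>x\<in>I. \<forall>y\<in>I. x + y \<in> I) \<and> (\<forall>c. \<forall>x\<in>I. scaleC c x \<in> I) \<and>
     (\<forall>a. \<forall>x\<in>I. a * x \<in> I \<and> x * a \<in> I) \<and> closed I"

definition qmap :: "'d::cstar_algebra set \<Rightarrow> 'd \<Rightarrow> 'd set" where
  "qmap I d = (\<lambda>x. d + x) ` I"

text \<open>
  The operations collect the cosets obtained from all choices of representatives. When \<open>I\<close> is a
  closed two-sided ideal these cosets coincide (for the involution because such an ideal is
  self-adjoint), so that the union is a single coset.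
\<close>

definition quotient_alg :: "'d::cstar_algebra set \<Rightarrow> 'd set cstar_structure" where
  "quotient_alg I = \<lparr>
     elems = range (qmap I),
     addS = (\<lambda>X Y. \<Union>x\<in>X. \<Union>y\<in>Y. qmap I (x + y)),
     scaleS = (\<lambda>c X. \<Union>x\<in>X. qmap I (scaleC c x)),
     multS = (\<lambda>X Y. \<Union>x\<in>X. \<Union>y\<in>Y. qmap I (x * y)),
     starS = (\<lambda>X. \<Union>x\<in>X. qmap I (star x)),
     normS = (\<lambda>X. INF x\<in>X. norm x) \<rparr>"

lemma qmap_self: "closed_ideal I \<Longrightarrow> d \<in> qmap I d"
  by (auto simp: closed_ideal_def qmap_def image_iff)

lemma closed_ideal_diff: "closed_ideal I \<Longrightarrow> x \<in> I \<Longrightarrow> y \<in> I \<Longrightarrow> x - y \<in> I"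
proof -
  assume I: "closed_ideal I" "x \<in> I" "y \<in> I"
  have "scaleC (-1) y = - y" using scaleC_of_real[of "-1" y] by simp
  moreover have "scaleC (-1) y \<in> I" using I unfolding closed_ideal_def by blast
  ultimately have "x + - y \<in> I" using I unfolding closed_ideal_def by auto
  then show ?thesis by simp
qed

lemma mem_qmap_iff: "x \<in> qmap I d \<longleftrightarrow> x - d \<in> I"
  proof
  assume "x - d \<in> I"
  then have "d + (x - d) \<in> qmap I d" unfolding qmap_def by (rule imageI)
  then show "x \<in> qmap I d" by simp
qed (auto simp: qmap_def)

lemma qmap_eq_iff: assumes "closed_ideal I" shows "qmap I d = qmap I e \<longleftrightarrow> d - e \<in> I"
proof
  assume "qmap I d = qmap I e"
  then show "d - e \<in> I" using qmap_self[OF assms, of d] by (simp add: mem_qmap_iff)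
next
  assume de: "d - e \<in> I"
  have "x - d \<in> I \<longleftrightarrow> x - e \<in> I" for x
  proof
    assume "x - d \<in> I"
    then have "(x - d) + (d - e) \<in> I" using de assms unfolding closed_ideal_def by blast
    then show "x - e \<in> I" by simp
  next
    assume "x - e \<in> I"
    from closed_ideal_diff[OF assms this de] show "x - d \<in> I" by simp
  qed
  then show "qmap I d = qmap I e" by (auto simp: mem_qmap_iff)
qed

lemma quotient_addS:
  assumes "closed_ideal I"
  shows "addS (quotient_alg I) (qmap I d) (qmap I e) = qmap I (d + e)"
proof -
  have "qmap I (x + y) = qmap I (d + e)" if "x \<in> qmap I d" "y \<in> qmap I e" for x y
  proof -
    have "(x - d) + (y - e) \<in> I"
      using that assms unfolding mem_qmap_iff closed_ideal_def by blast
    then show ?thesis by (simp add: qmap_eq_iff[OF assms] algebra_simps)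
  qed
  then have "(\<Union>x\<in>qmap I d. \<Union>y\<in>qmap I e. qmap I (x + y)) = qmap I (d + e)"
    by (intro SUP_eq_const) (use qmap_self[OF assms] in blast)+
  then show ?thesis by (simp add: quotient_alg_def)
qed

lemma quotient_scaleS:
  assumes "closed_ideal I"
  shows "scaleS (quotient_alg I) c (qmap I d) = qmap I (scaleC c d)"
proof -
  have "qmap I (scaleC c x) = qmap I (scaleC c d)" if "x \<in> qmap I d" for x
  proof -
    have "scaleC c (x - d) \<in> I"
      using that assms unfolding mem_qmap_iff closed_ideal_def by blast
    moreover have "scaleC c (x - d) + scaleC c d = scaleC c x"
      by (metis scaleC_add_right diff_add_cancel)
    ultimately have "scaleC c x - scaleC c d \<in> I" by (metis add_diff_cancel_right')
    then show ?thesis by (simp add: qmap_eq_iff[OF assms])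
  qed
  then have "(\<Union>x\<in>qmap I d. qmap I (scaleC c x)) = qmap I (scaleC c d)"
    by (intro SUP_eq_const) (use qmap_self[OF assms] in blast)+
  then show ?thesis by (simp add: quotient_alg_def)
qed

lemma quotient_multS:
  assumes "closed_ideal I"
  shows "multS (quotient_alg I) (qmap I d) (qmap I e) = qmap I (d * e)"
proof -
  have "qmap I (x * y) = qmap I (d * e)" if "x \<in> qmap I d" "y \<in> qmap I e" for x y
  proof -
    have "(x - d) * y + d * (y - e) \<in> I"
      using that assms unfolding mem_qmap_iff closed_ideal_def by blast
    then show ?thesis by (simp add: qmap_eq_iff[OF assms] algebra_simps)
  qed
  then have "(\<Union>x\<in>qmap I d. \<Union>y\<in>qmap I e. qmap I (x * y)) = qmap I (d * e)"
    by (intro SUP_eq_const) (use qmap_self[OF assms] in blast)+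
  then show ?thesis by (simp add: quotient_alg_def)
qed


text \<open>
  \<open>E \<otimes> C[0,1]\<close> in its standard realisation as the algebra of norm-continuous functions
  \<open>[0,1] \<rightarrow> E\<close> with pointwise operations and supremum norm, where \<open>e \<otimes> h\<close> is the function
  \<open>t \<mapsto> h(t) e\<close>. Evaluation at \<open>t\<close> is then application to \<open>t\<close>. Functions take
  the value \<^const>\<open>undefined\<close> outside the unit interval.
\<close>

definition C01 :: "'a cstar_structure \<Rightarrow> (real \<Rightarrow> 'a) cstar_structure" where
  "C01 E = \<lparr>
     elems = {g \<in> {0..1} \<rightarrow>\<^sub>E elems E. continuousS_on E {0..1} g},
     addS = (\<lambda>g h. \<lambda>t\<in>{0..1}. addS E (g t) (h t)),
     scaleS = (\<lambda>c g. \<lambda>t\<in>{0..1}. scaleS E c (g t)),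
     multS = (\<lambda>g h. \<lambda>t\<in>{0..1}. multS E (g t) (h t)),
     starS = (\<lambda>g. \<lambda>t\<in>{0..1}. starS E (g t)),
     normS = (\<lambda>g. SUP t\<in>{0..1}. normS E (g t)) \<rparr>"

definition ev :: "real \<Rightarrow> (real \<Rightarrow> 'a) \<Rightarrow> 'a" where
  "ev t g = g t"

definition tensor_id :: "('a \<Rightarrow> 'b) \<Rightarrow> (real \<Rightarrow> 'a) \<Rightarrow> (real \<Rightarrow> 'b)" where
  "tensor_id p g = (\<lambda>t\<in>{0..1}. p (g t))"

definition star_homomorphism ::
    "'e cstar_structure \<Rightarrow> ('b::cstar_algebra \<Rightarrow> 'e) \<Rightarrow> bool" where
  "star_homomorphism E f \<longleftrightarrow>
     (\<forall>a. f a \<in> elems E) \<and>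
     (\<forall>a b. f (a + b) = addS E (f a) (f b)) \<and>
     (\<forall>c a. f (scaleC c a) = scaleS E c (f a)) \<and>
     (\<forall>a b. f (a * b) = multS E (f a) (f b)) \<and>
     (\<forall>a. f (star a) = starS E (f a))"

text \<open>
  Families indexed by \<open>[1,\<infinity>)\<close> are functions on \<^typ>\<open>real\<close> whose values at
  parameters below \<open>1\<close> are irrelevant.
\<close>

definition asymptotic_homomorphism ::
    "'e cstar_structure \<Rightarrow> (real \<Rightarrow> 'b::cstar_algebra \<Rightarrow> 'e) \<Rightarrow> bool" where
  "asymptotic_homomorphism E f \<longleftrightarrow>
     (\<forall>l\<ge>1. \<forall>a. f l a \<in> elems E) \<and>
     (\<forall>a. continuousS_on E {1..} (\<lambda>l. f l a)) \<and>
     (\<forall>a. ((\<lambda>l. distS E (f l (star a)) (starS E (f l a))) \<longlongrightarrow> 0) at_top) \<and>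
     (\<forall>a b \<mu> \<nu>. ((\<lambda>l. distS E (f l (scaleC \<mu> a + scaleC \<nu> b))
          (addS E (scaleS E \<mu> (f l a)) (scaleS E \<nu> (f l b)))) \<longlongrightarrow> 0) at_top) \<and>
     (\<forall>a b. ((\<lambda>l. distS E (f l (a * b)) (multS E (f l a) (f l b))) \<longlongrightarrow> 0) at_top)"

definition is_homotopy ::
    "'e cstar_structure \<Rightarrow> (real \<Rightarrow> 'b::cstar_algebra \<Rightarrow> real \<Rightarrow> 'e) \<Rightarrow>
     (real \<Rightarrow> 'b \<Rightarrow> 'e) \<Rightarrow> (real \<Rightarrow> 'b \<Rightarrow> 'e) \<Rightarrow> bool" where
  "is_homotopy E \<Phi> f g \<longleftrightarrow> asymptotic_homomorphism (C01 E) \<Phi> \<and>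
     (\<forall>l\<ge>1. \<forall>a. ev 1 (\<Phi> l a) = f l a \<and> ev 0 (\<Phi> l a) = g l a)"

definition asymptotically_homotopic ::
    "'e cstar_structure \<Rightarrow> (real \<Rightarrow> 'b::cstar_algebra \<Rightarrow> 'e) \<Rightarrow> (real \<Rightarrow> 'b \<Rightarrow> 'e) \<Rightarrow> bool" where
  "asymptotically_homotopic E f g \<longleftrightarrow> (\<exists>\<Phi>. is_homotopy E \<Phi> f g)"

definition lifts ::
    "'d::cstar_algebra set \<Rightarrow> (real \<Rightarrow> 'b::cstar_algebra \<Rightarrow> 'd set) \<Rightarrow> bool" where
  "lifts I f \<longleftrightarrow> (\<exists>F. asymptotic_homomorphism whole F \<and> (\<forall>l\<ge>1. \<forall>a. qmap I (F l a) = f l a))"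

end

theory Submission
  imports Defs
begin

text \<open>A homotopy \<open>\<Phi>\<close> from \<open>\<psi>\<close> to \<open>\<phi>\<close> is a function of two parameters \<open>(\<lambda>, t)\<close> that respects the
  algebraic relations modulo \<open>I\<close> up to errors that vanish as \<open>\<lambda> \<rightarrow> \<infinity>\<close>, uniformly in \<open>t\<close>. Each
  \<open>\<Phi>(a)\<close> has a continuous lift \<open>G a\<close> (\<open>continuous_lift\<close>), and \<open>G a\<close> may be chosen to agree at
  \<open>t = 0\<close> with the given lift \<open>F\<close> of \<open>\<psi>\<close>. The relations for \<open>G\<close> then hold
  asymptotically in \<open>D\<close> at \<open>t = 0\<close>, and only modulo \<open>I\<close> elsewhere. It remains to correct \<open>G\<close> by elements of \<open>I\<close>.

  The correction moves along the homotopy in small steps. If \<open>y\<close> is a good lift at one point and \<open>g\<close>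
  any lift at a nearby point, replace \<open>y\<close> by \<open>e y + (1 - e) g\<close>, where \<open>e \<in> I\<close> is almost central
  and acts almost as a unit on the finitely many elements of \<open>I\<close> that matter. This lifts the class of \<open>g\<close>
  (\<open>blend_step\<close>). How many steps are needed depends on \<open>\<lambda>\<close>, without any bound, so errors must
  not add up from step to step. This is why \<open>e\<close> is chosen with the estimate
  \<open>\<parallel>e y + (1 - e) x + e (1 - e) v\<parallel> \<le> max \<parallel>y\<parallel> (\<parallel>x\<parallel> + \<parallel>v\<parallel>)\<close>
  up to an arbitrarily small amount, with the norms of \<open>x\<close> and \<open>v\<close> taken modulo \<open>I\<close>. It gives
  the new failure of each relation as the \<^emph>\<open>maximum\<close> of the old failure and of the failure modulo
  \<open>I\<close> plus the square of the step size. The arbitrarily small amounts are \<open>2\<^sup>-\<^sup>k\<close> at step \<open>k\<close>, and at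
  parameter \<open>\<lambda>\<close> the motion only starts at step \<open>\<lambda>\<close>; their sum therefore vanishes as
  \<open>\<lambda> \<rightarrow> \<infinity>\<close> (\<open>lift_on_sequence\<close>).

  The estimate comes from functional calculus on the circle, in an elementary form. Averages over powers of
  Cayley transforms give approximate units, and averages over fast increasing approximate units give
  quasi-central ones (\<open>quasicentral_approximate_unit\<close>). Their Cayley transforms give unitaries
  \<open>U\<close> in the unitisation of \<open>I\<close> that asymptotically commute with a given finite set and act as \<open>-1\<close>
  on finitely many elements of \<open>I\<close> (\<open>central_unitary\<close>). A trigonometric polynomial with coefficients in
  \<open>D\<close>, evaluated at such a \<open>U\<close>, has asymptotically at most its supremum norm
  (\<open>unitary_poly_bound\<close>). With \<open>e = (2 - U - U\<^sup>*) / 4\<close> the expression above is such a polynomial,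
  and on the circle it is a convex combination.

  Each step controls finitely many elements, so the construction yields lifts for a dense sequence in \<open>B\<close>.
  Maps that satisfy the relations asymptotically are asymptotically bounded by a constant multiple of the
  norm (\<open>asymptotic_bound\<close>). Therefore an arbitrary \<open>a\<close> has a continuous lift that stays close to
  those of nearby members of the sequence (\<open>lift_near_sequence\<close>), and these lifts again satisfy all
  relations asymptotically.\<close>

section \<open>Quasi-unitary elements and the Cayley transform\<close>

interpretation scaleC: bounded_bilinear "scaleC :: complex \<Rightarrow> 'a::cstar_algebra \<Rightarrow> 'a"
proof
  fix a a' :: complex and b b' :: 'a and r :: real
  show "scaleC (a + a') b = scaleC a b + scaleC a' b" by (rule scaleC_add_left)
  show "scaleC a (b + b') = scaleC a b + scaleC a b'" by (rule scaleC_add_right)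
  show "scaleC (r *\<^sub>R a) b = r *\<^sub>R scaleC a b"
    by (simp add: scaleR_conv_of_real scaleC_scaleC[symmetric] scaleC_of_real)
  show "scaleC a (r *\<^sub>R b) = r *\<^sub>R scaleC a b"
    by (simp add: scaleC_of_real[symmetric] scaleC_scaleC mult.commute)
  show "\<exists>K. \<forall>a (b::'a). norm (scaleC a b) \<le> norm a * norm b * K"
    by (rule exI[of _ 1]) (simp add: norm_scaleC)
qed

lemma scaleC_1 [simp]: "scaleC 1 (x::'a::cstar_algebra) = x"
  using scaleC_of_real[of 1 x] by simp

lemma norm_le_norm_star: "norm (x::'a::cstar_algebra) \<le> norm (star x)"
proof (cases "x = 0")
  case False
  have "(norm x)\<^sup>2 \<le> norm (star x) * norm x"
    unfolding cstar_identity[symmetric] by (rule norm_mult_ineq)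
  with False show ?thesis by (simp add: power2_eq_square)
qed simp

lemma norm_star [simp]: "norm (star (x::'a::cstar_algebra)) = norm x"
  using norm_le_norm_star[of x] norm_le_norm_star[of "star x"] by (simp add: star_star)

lemma bounded_linear_star: "bounded_linear (star :: 'a::cstar_algebra \<Rightarrow> 'a)"
proof
  fix a b :: 'a and r :: real
  show "star (a + b) = star a + star b" by (rule star_add)
  show "star (r *\<^sub>R b) = r *\<^sub>R star b"
    by (simp add: scaleC_of_real[symmetric] star_scaleC)
  show "\<exists>K. \<forall>a::'a. norm (star a) \<le> norm a * K"
    by (rule exI[of _ 1]) simp
qed

lemmas linear_star = bounded_linear.linear[OF bounded_linear_star]
lemmas star_diff = linear_diff[OF linear_star]
lemmas star_minus = linear_neg[OF linear_star]
lemmas star_0 = linear_0[OF linear_star]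
lemmas star_scaleR = linear_scale[OF linear_star]
lemmas star_sum = linear_sum[OF linear_star]

lemmas star_simps = star_star star_add star_mult star_scaleC star_diff star_minus star_0 star_scaleR

lemma cstar_identity': "norm (x * star x) = (norm (x::'a::cstar_algebra))\<^sup>2"
  using cstar_identity[of "star x"] by (simp add: star_star)

lemma closed_idealD:
  assumes "closed_ideal I"
  shows "0 \<in> I" "x \<in> I \<Longrightarrow> y \<in> I \<Longrightarrow> x + y \<in> I" "x \<in> I \<Longrightarrow> scaleC c x \<in> I"
    "x \<in> I \<Longrightarrow> a * x \<in> I" "x \<in> I \<Longrightarrow> x * a \<in> I" "closed I"
  using assms unfolding closed_ideal_def by auto

lemma closed_ideal_minus: "closed_ideal I \<Longrightarrow> x \<in> I \<Longrightarrow> - x \<in> I"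
  using closed_ideal_diff[of I 0 x] closed_idealD(1) by force

lemma closed_ideal_scaleR: "closed_ideal I \<Longrightarrow> x \<in> I \<Longrightarrow> r *\<^sub>R x \<in> I"
  by (metis closed_idealD(3) scaleC_of_real)

lemma closed_ideal_sum: "closed_ideal I \<Longrightarrow> (\<And>k. k \<in> K \<Longrightarrow> f k \<in> I) \<Longrightarrow> sum f K \<in> I"
  by (induction K rule: infinite_finite_induct) (auto simp: closed_idealD)

lemma closed_ideal_zero: "closed_ideal {0}"
  by (simp add: closed_ideal_def scaleC.zero_right)

text \<open>Algebras need not have a unit, so a unitary \<open>1 + w\<close> of the unitisation is represented by
  \<open>w\<close>.\<close>

definition quasi_unitary :: "'a::cstar_algebra \<Rightarrow> bool" where
  "quasi_unitary w \<longleftrightarrow> w + star w + star w * w = 0 \<and> w + star w + w * star w = 0"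

lemma quasi_unitary_star: "quasi_unitary w \<Longrightarrow> quasi_unitary (star w)"
  by (simp add: quasi_unitary_def star_star add.commute)

lemma quasi_unitary_inner:
  assumes "quasi_unitary w"
  shows "star (x + w * x) * (y + w * y) = star x * y"
proof -
  have "star (x + w * x) * (y + w * y) = star x * y + star x * (w + star w + star w * w) * y"
    by (simp add: star_simps algebra_simps)
  then show ?thesis using assms by (simp add: quasi_unitary_def)
qed

lemma quasi_unitary_norm:
  assumes "quasi_unitary w"
  shows "norm (x + w * x) = norm x" "norm (x + x * w) = norm x"
proof -
  have *: "norm (x + w * x) = norm x" if "quasi_unitary w" for x w :: 'a
    using cstar_identity[of "x + w * x"] quasi_unitary_inner[OF that, of x x] cstar_identity[of x]
    by simp
  show "norm (x + w * x) = norm x" by (rule *[OF assms])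
  show "norm (x + x * w) = norm x"
    using *[OF quasi_unitary_star[OF assms], of "star x"] norm_star[of "x + x * w"]
    by (simp add: star_simps)
qed

lemma quasi_unitary_norm_le: "quasi_unitary w \<Longrightarrow> norm w \<le> 2"
proof -
  assume w: "quasi_unitary w"
  have "(norm w)\<^sup>2 = norm (w * star w)" by (simp add: cstar_identity')
  also have "\<dots> = norm ((star w + w * star w) - star w)" by simp
  also have "\<dots> \<le> norm (star w + w * star w) + norm (star w)" by (rule norm_triangle_ineq4)
  also have "\<dots> = 2 * norm w" by (simp add: quasi_unitary_norm[OF w])
  finally have "norm w * norm w \<le> 2 * norm w" by (simp add: power2_eq_square)
  then show ?thesis by (cases "w = 0") auto
qed

text \<open>The product \<open>(1 + w) (1 + v)\<close> of two unitaries.\<close>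

lemma quasi_unitary_circ:
  assumes "quasi_unitary w" "quasi_unitary v"
  shows "quasi_unitary (w + v + w * v)"
proof -
  have "star (w + v + w * v) = star w + star v + star v * star w" by (simp add: star_simps add.assoc)
  moreover have "(w + v + w * v) + (star w + star v + star v * star w)
        + (star w + star v + star v * star w) * (w + v + w * v)
      = (w + star w + star w * w) + star v * (w + star w + star w * w)
        + (w + star w + star w * w) * v + star v * (w + star w + star w * w) * v
        + (v + star v + star v * v)" by (simp add: algebra_simps)
  moreover have "(w + v + w * v) + (star w + star v + star v * star w)
        + (w + v + w * v) * (star w + star v + star v * star w)
      = (v + star v + v * star v) + w * (v + star v + v * star v)
        + (v + star v + v * star v) * star w + w * (v + star v + v * star v) * star w
        + (w + star w + w * star w)" by (simp add: algebra_simps)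
  ultimately show ?thesis using assms unfolding quasi_unitary_def by simp
qed

text \<open>The Cayley transform \<open>(1 + ih) / (1 - ih) = 1 + 2r\<close> with \<open>r = (1 - ih)\<^sup>-\<^sup>1 - 1\<close>. The
  element \<open>r\<close> is the fixed point of a contraction of the ideal, so it lies in the ideal.\<close>

lemma cayley_transform:
  fixes h :: "'a::cstar_algebra"
  assumes I: "closed_ideal I" and h: "h \<in> I" "star h = h" "norm h < 1"
  obtains r where "r \<in> I" "r = scaleC \<i> h + scaleC \<i> h * r" "r = scaleC \<i> h + r * scaleC \<i> h"
    "quasi_unitary (2 *\<^sub>R r)"
proof -
  define A where "A = scaleC \<i> h"
  have nA: "norm A < 1" using h by (simp add: A_def norm_scaleC)
  have AI: "A \<in> I" using I h by (simp add: A_def closed_idealD)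
  have sA: "star A = - A" using h by (simp add: A_def star_simps scaleC.minus_left)
  have cI: "complete I" "I \<noteq> {}" using closed_idealD(1,6)[OF I] by (auto simp: complete_eq_closed)
  have "\<exists>!r\<in>I. A + A * r = r"
    by (rule Banach_fix[OF cI, of "norm A"])
      (use nA AI I in \<open>auto simp: dist_norm closed_idealD right_diff_distrib[symmetric] norm_mult_ineq\<close>)
  then obtain r where r: "r \<in> I" "r = A + A * r" by metis
  have "\<exists>!s\<in>I. A + s * A = s"
    by (rule Banach_fix[OF cI, of "norm A"])
      (use nA AI I in \<open>auto simp: dist_norm closed_idealD left_diff_distrib[symmetric] mult.commute[of "norm A"] norm_mult_ineq\<close>)
  then obtain s where s: "s \<in> I" "s = A + s * A" by metis
  \<comment> \<open>\<open>1 + r\<close> and \<open>1 + s\<close> are a right and a left inverse of \<open>1 - A\<close>, hence equal.\<close>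
  have "s * r = s * A + s * A * r" by (subst r(2)) (simp add: algebra_simps)
  moreover have "s * r = A * r + s * A * r" by (subst s(2)) (simp add: algebra_simps)
  ultimately have "s * A = A * r" by simp
  then have sr: "s = r" using r(2) s(2) by simp
  have r': "r = A + r * A" using s(2) sr by simp
  have t: "star r = - A - star r * A"
    using arg_cong[OF r(2), of star] by (simp add: star_simps sA)
  have t': "star r = - A - A * star r"
    using arg_cong[OF r', of star] by (simp add: star_simps sA)
  have "star r * r = star r * A + star r * A * r" by (subst r(2)) (simp add: algebra_simps)
  also have "star r * A = - A - star r" using t by (simp add: algebra_simps)
  finally have 1: "star r * r = - A - star r - A * r - star r * r" by (simp add: algebra_simps)
  have "star r * r + star r * r + (A + A * r) + star r
      = star r * r - (- A - star r - A * r - star r * r)" by (simp add: algebra_simps)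
  then have 1: "star r * r + star r * r + r + star r = 0"
    using 1 r(2)[symmetric] by simp
  have "r * star r = r * (- A) + (r * (- A)) * star r" by (subst t') (simp add: algebra_simps)
  also have "r * (- A) = A - r" using r' by (simp add: algebra_simps)
  finally have 2: "r * star r = A - r + A * star r - r * star r" by (simp add: algebra_simps)
  have "r * star r + r * star r + r - (- A - A * star r) + (star r + star r)
      = r * star r - (A - r + A * star r - r * star r) + (star r + star r) + 2 *\<^sub>R (A + A * star r)"
    by (simp add: algebra_simps scaleR_2)
  also have "\<dots> = 2 *\<^sub>R (star r - (- A - A * star r))" using 2 by (simp add: scaleR_2 algebra_simps)
  finally have 2: "r * star r + r * star r + r + star r = 0"
    using t'[symmetric] by (simp add: algebra_simps)
  have "2 *\<^sub>R r + star (2 *\<^sub>R r) + star (2 *\<^sub>R r) * (2 *\<^sub>R r)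
      = 2 *\<^sub>R (star r * r + star r * r + r + star r)"
    by (simp add: star_simps scaleR_2 algebra_simps)
  moreover have "2 *\<^sub>R r + star (2 *\<^sub>R r) + (2 *\<^sub>R r) * star (2 *\<^sub>R r)
      = 2 *\<^sub>R (r * star r + r * star r + r + star r)"
    by (simp add: star_simps scaleR_2 algebra_simps)
  ultimately have "quasi_unitary (2 *\<^sub>R r)"
    unfolding quasi_unitary_def using 1 2 by simp
  then show thesis using that r r' unfolding A_def by blast
qed

section \<open>Quasi-central approximate units\<close>

text \<open>This bound on multiplication by \<open>1 - e\<close> is what is needed of the condition
  \<open>0 \<le> e \<le> 1\<close>. It is stable under products of the \<open>1 - e\<close> and under averages.\<close>

definition contracting :: "'a::cstar_algebra \<Rightarrow> bool" where
  "contracting e \<longleftrightarrow> (\<forall>y. norm (y - e * y) \<le> norm y \<and> norm (y - y * e) \<le> norm y)"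

lemma contracting_0: "contracting 0"
  by (simp add: contracting_def)

lemma contractingD:
  assumes "contracting e"
  shows "norm (y - e * y) \<le> norm y" "norm (y - y * e) \<le> norm y"
  using assms by (auto simp: contracting_def)

lemma contracting_star: "contracting e \<Longrightarrow> contracting (star e)"
proof (unfold contracting_def, intro allI conjI)
  fix y assume e: "\<forall>y. norm (y - e * y) \<le> norm y \<and> norm (y - y * e) \<le> norm y"
  show "norm (y - star e * y) \<le> norm y"
    using e[rule_format, of "star y"] norm_star[of "y - star e * y"] by (simp add: star_simps)
  show "norm (y - y * star e) \<le> norm y"
    using e[rule_format, of "star y"] norm_star[of "y - y * star e"] by (simp add: star_simps)
qed

text \<open>The product of \<open>1 - e\<close> and \<open>1 - f\<close> is \<open>1 - (e + f - e f)\<close>.\<close>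

lemma contracting_circ:
  assumes "contracting e" "contracting f"
  shows "contracting (e + f - e * f)"
proof (unfold contracting_def, intro allI conjI)
  fix y
  have "y - (e + f - e * f) * y = (y - f * y) - e * (y - f * y)" by (simp add: algebra_simps)
  then show "norm (y - (e + f - e * f) * y) \<le> norm y"
    using order_trans[OF contractingD(1)[OF assms(1), of "y - f * y"] contractingD(1)[OF assms(2), of y]]
    by (simp only:)
  have "y - y * (e + f - e * f) = (y - y * e) - (y - y * e) * f" by (simp add: algebra_simps)
  then show "norm (y - y * (e + f - e * f)) \<le> norm y"
    using order_trans[OF contractingD(2)[OF assms(2), of "y - y * e"] contractingD(2)[OF assms(1), of y]]
    by (simp only:)
qed

lemma contracting_mult_norm:
  assumes "contracting e" shows "norm (e * y) \<le> 2 * norm y" "norm (y * e) \<le> 2 * norm y"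
proof -
  have "norm (e * y) = norm (y - (y - e * y))" by simp
  also have "\<dots> \<le> norm y + norm (y - e * y)" by (rule norm_triangle_ineq4)
  finally show "norm (e * y) \<le> 2 * norm y" using contractingD(1)[OF assms, of y] by simp
  have "norm (y * e) = norm (y - (y - y * e))" by simp
  also have "\<dots> \<le> norm y + norm (y - y * e)" by (rule norm_triangle_ineq4)
  finally show "norm (y * e) \<le> 2 * norm y" using contractingD(2)[OF assms, of y] by simp
qed

lemma contracting_norm_le: "contracting e \<Longrightarrow> norm e \<le> 2"
proof -
  assume e: "contracting e"
  have "norm e * norm e \<le> 2 * norm e"
    using contracting_mult_norm(1)[OF contracting_star[OF e], of e] cstar_identity[of e]
    by (simp add: power2_eq_square)
  then show ?thesis by (cases "e = 0") auto
qed

lemma contracting_average: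
  assumes "\<And>k. k < N \<Longrightarrow> contracting (u k)" "N > 0"
  shows "contracting ((1 / real N) *\<^sub>R (\<Sum>k<N. u k))"
proof -
  have avg: "norm ((1 / real N) *\<^sub>R (\<Sum>k<N. g k)) \<le> b" if "\<And>k. k < N \<Longrightarrow> norm (g k) \<le> b"
    for b and g :: "nat \<Rightarrow> 'a"
  proof -
    have "norm (\<Sum>k<N. g k) \<le> real N * b"
      using sum_norm_bound[of "{..<N}" g b] that by simp
    then show ?thesis using assms(2) by (simp add: divide_simps mult.commute)
  qed
  have y: "y = (1 / real N) *\<^sub>R (\<Sum>k<N. y)" for y :: 'a
    using assms(2) by (simp add: sum_constant_scaleR)
  show ?thesis
  proof (unfold contracting_def, intro allI conjI)
    fix y
    have "y - ((1 / real N) *\<^sub>R (\<Sum>k<N. u k)) * y = (1 / real N) *\<^sub>R (\<Sum>k<N. y - u k * y)"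
      by (subst y[of y]) (simp add: sum_subtractf scaleR_diff_right sum_distrib_right sum_distrib_left
          mult_scaleR_left mult_scaleR_right sum_constant_scaleR assms(2)[THEN less_imp_neq, symmetric])
    then show "norm (y - (1 / real N) *\<^sub>R (\<Sum>k<N. u k) * y) \<le> norm y"
      using avg[of "\<lambda>k. y - u k * y" "norm y"] contractingD(1)[OF assms(1)] by simp
    have "y - y * ((1 / real N) *\<^sub>R (\<Sum>k<N. u k)) = (1 / real N) *\<^sub>R (\<Sum>k<N. y - y * u k)"
      by (subst y[of y]) (simp add: sum_subtractf scaleR_diff_right sum_distrib_right sum_distrib_left
          mult_scaleR_left mult_scaleR_right sum_constant_scaleR assms(2)[THEN less_imp_neq, symmetric])
    then show "norm (y - y * ((1 / real N) *\<^sub>R (\<Sum>k<N. u k))) \<le> norm y"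
      using avg[of "\<lambda>k. y - y * u k" "norm y"] contractingD(2)[OF assms(1)] by simp
  qed
qed

text \<open>For a unitary \<open>U\<close> the averages \<open>k = (1 + U + \<dots> + U\<^sup>N\<^sup>-\<^sup>1) / N\<close> are contractions with
  \<open>(U - 1) k = (U\<^sup>N - 1) / N\<close>. Taking for \<open>U\<close> the Cayley transform of a small multiple of \<open>h\<close>, this
  makes \<open>h k\<close> small, while \<open>1 - k\<close> lies in the ideal.\<close>

lemma approximate_unit_selfadjoint_small:
  fixes h :: "'a::cstar_algebra"
  assumes I: "closed_ideal I" and h: "h \<in> I" "star h = h" "norm h < 1" and N: "N > 0"
  obtains e where "e \<in> I" "contracting e" "norm (h - h * e) \<le> 2 / real N"
proof -
  obtain r where r: "r \<in> I" "r = scaleC \<i> h + scaleC \<i> h * r" "quasi_unitary (2 *\<^sub>R r)"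
    using cayley_transform[OF I h] by metis
  \<comment> \<open>\<open>1 + w j\<close> is the \<open>j\<close>-th power of the Cayley transform.\<close>
  define w where "w = rec_nat 0 (\<lambda>_ w. 2 *\<^sub>R r + w + 2 *\<^sub>R r * w)"
  have w0: "w 0 = 0" and wS: "w (Suc j) = 2 *\<^sub>R r + w j + 2 *\<^sub>R r * w j" for j
    by (simp_all add: w_def)
  have wU: "quasi_unitary (w j)" for j
  proof (induction j)
    case 0
    show ?case by (simp add: w0 quasi_unitary_def star_0)
  next
    case (Suc j)
    show ?case unfolding wS by (rule quasi_unitary_circ[OF r(3) Suc])
  qed
  have wI: "w j \<in> I" for j
    by (induction j) (auto simp: w0 wS closed_idealD[OF I] closed_ideal_scaleR[OF I] r(1))
  define e where "e = (1 / real N) *\<^sub>R (\<Sum>j<N. - w j)"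
  have "contracting (- w j)" for j
    using quasi_unitary_norm[OF wU[of j]] by (simp add: contracting_def)
  then have ce: "contracting e"
    unfolding e_def by (intro contracting_average N)
  have eI: "e \<in> I"
    unfolding e_def by (intro closed_ideal_scaleR closed_ideal_sum closed_ideal_minus I wI)
  \<comment> \<open>The geometric sum \<open>U\<^sup>m - 1 = (U - 1) (1 + \<dots> + U\<^sup>m\<^sup>-\<^sup>1)\<close> with \<open>U = 1 + 2 r\<close>.\<close>
  have "w m = 2 *\<^sub>R (\<Sum>j<m. r + r * w j)" for m
    by (induction m) (auto simp: w0 wS algebra_simps scaleR_2)
  from this[of N] have "(\<Sum>j<N. r + r * w j) = (1 / 2) *\<^sub>R w N" by (simp only:) simp
  moreover have "r - r * e = (1 / real N) *\<^sub>R (\<Sum>j<N. r + r * w j)"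
    using N by (simp add: e_def sum.distrib sum_distrib_left sum_negf scaleR_add_right
        mult_scaleR_right sum_constant_scaleR)
  ultimately have "r - r * e = (1 / (2 * real N)) *\<^sub>R w N" by simp
  then have re: "norm (r - r * e) \<le> 1 / real N"
    using quasi_unitary_norm_le[OF wU[of N]] N by (simp add: divide_simps)
  define A where "A = scaleC \<i> h"
  have nA: "norm A \<le> 1" using h by (simp add: A_def norm_scaleC)
  have A: "A = r - A * r" using r(2) unfolding A_def by (simp add: algebra_simps)
  have "A - A * e = (r - r * e) - A * (r - r * e)"
    by (subst (1 2) A) (simp add: algebra_simps)
  then have "norm (A - A * e) \<le> norm (r - r * e) + norm A * norm (r - r * e)"
    using norm_triangle_ineq4[of "r - r * e" "A * (r - r * e)"] norm_mult_ineq[of A "r - r * e"] by simp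
  also have "\<dots> \<le> 1 / real N + 1 * (1 / real N)"
    using re nA by (intro add_mono mult_mono) auto
  finally have "norm (A - A * e) \<le> 2 / real N" by simp
  moreover have "A - A * e = scaleC \<i> (h - h * e)"
    by (simp add: A_def scaleC.diff_right scaleC_mult_left)
  ultimately have "norm (h - h * e) \<le> 2 / real N" by (simp add: norm_scaleC)
  with eI ce show thesis using that by blast
qed

lemma approximate_unit_selfadjoint:
  fixes h :: "'a::cstar_algebra"
  assumes I: "closed_ideal I" and h: "h \<in> I" "star h = h" and "\<epsilon> > 0"
  obtains e where "e \<in> I" "contracting e" "norm (h - h * e) \<le> \<epsilon>"
proof -
  define c where "c = 1 / (norm h + 1)"
  have c: "c > 0" "norm (c *\<^sub>R h) < 1"
    by (auto simp: c_def add_nonneg_pos divide_simps)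
  obtain N :: nat where N: "real N > 2 / (c * \<epsilon>)" using reals_Archimedean2 by blast
  have "2 / (c * \<epsilon>) > 0" using c assms by simp
  then have N0: "N > 0" using N by (intro gr0I) auto
  obtain e where e: "e \<in> I" "contracting e" "norm (c *\<^sub>R h - c *\<^sub>R h * e) \<le> 2 / real N"
    using approximate_unit_selfadjoint_small[OF I closed_ideal_scaleR[OF I h(1)] _ c(2) N0] h
    by (metis star_scaleR)
  have "c * norm (h - h * e) \<le> 2 / real N"
    using e(3) c by (simp add: scaleR_diff_right[symmetric] mult_scaleR_left)
  also have "\<dots> \<le> c * \<epsilon>" using N N0 c assms by (simp add: divide_simps mult.commute)
  finally have "norm (h - h * e) \<le> \<epsilon>" using c by simp
  with e show thesis using that by blast
qed

text \<open>By the C*-identity \<open>\<parallel>x (1 - e)\<parallel>\<^sup>2 = \<parallel>(1 - e)\<^sup>* h (1 - e)\<parallel> \<le> \<parallel>h (1 - e)\<parallel>\<close> with the self-adjoint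
  element \<open>h = x\<^sup>* x\<close>. Either assumption on \<open>x\<close> puts \<open>h\<close> into the ideal; the second one yields
  that closed ideals are self-adjoint.\<close>

lemma approximate_unit_right:
  fixes x :: "'a::cstar_algebra"
  assumes I: "closed_ideal I" and x: "x \<in> I \<or> star x \<in> I" and e: "\<epsilon> > 0"
  obtains e where "e \<in> I" "contracting e" "norm (x - x * e) \<le> \<epsilon>"
proof -
  have "star x * x \<in> I" using x closed_idealD[OF I] by auto
  moreover have "star (star x * x) = star x * x" by (simp add: star_simps)
  ultimately obtain e where e: "e \<in> I" "contracting e"
      "norm (star x * x - star x * x * e) \<le> \<epsilon>\<^sup>2"
    using approximate_unit_selfadjoint[OF I, of "star x * x" "\<epsilon>\<^sup>2"] e by (metis zero_less_power)
  let ?h = "star x * x - star x * x * e"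
  have "(norm (x - x * e))\<^sup>2 = norm (star (x - x * e) * (x - x * e))"
    by (simp add: cstar_identity)
  also have "star (x - x * e) * (x - x * e) = ?h - star e * ?h"
    by (simp add: star_simps algebra_simps)
  also have "norm \<dots> \<le> norm ?h" by (rule contractingD[OF contracting_star[OF e(2)]])
  also have "\<dots> \<le> \<epsilon>\<^sup>2" by (rule e)
  finally have "norm (x - x * e) \<le> \<epsilon>" using assms(3) by (simp add: power2_le_iff_abs_le)
  with e show thesis using that by blast
qed

lemma closed_ideal_star:
  assumes I: "closed_ideal I" and x: "x \<in> I"
  shows "star x \<in> I"
proof -
  have "star x \<in> closure I"
  proof (rule closure_approachable[THEN iffD2], intro allI impI)
    fix \<epsilon> :: real assume "\<epsilon> > 0"
    then obtain e where e: "e \<in> I" "norm (star x - star x * e) \<le> \<epsilon> / 2"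
      using approximate_unit_right[OF I, of "star x" "\<epsilon> / 2"] x by (metis star_star half_gt_zero)
    then have "star x * e \<in> I" "dist (star x * e) (star x) < \<epsilon>"
      using closed_idealD[OF I] \<open>\<epsilon> > 0\<close> by (auto simp: dist_norm norm_minus_commute)
    then show "\<exists>y\<in>I. dist y (star x) < \<epsilon>" by blast
  qed
  then show ?thesis using closed_idealD(6)[OF I] by simp
qed

text \<open>Later factors \<open>1 - f\<close> do not spoil what earlier ones achieve, since they are contractions.\<close>

lemma approximate_unit_right_finite:
  fixes F :: "'a::cstar_algebra set"
  assumes I: "closed_ideal I" and F: "finite F" "F \<subseteq> I" and e: "\<epsilon> > 0"
  shows "\<exists>e. e \<in> I \<and> contracting e \<and> (\<forall>x\<in>F. norm (x - x * e) \<le> \<epsilon>)"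
  using F
proof (induction F)
  case empty
  show ?case using closed_idealD(1)[OF I] contracting_0 by blast
next
  case (insert x F)
  then obtain e where e: "e \<in> I" "contracting e" "\<forall>x\<in>F. norm (x - x * e) \<le> \<epsilon>" by auto
  have "x - x * e \<in> I" using insert closed_idealD[OF I] closed_ideal_diff[OF I] by auto
  then obtain f where f: "f \<in> I" "contracting f" "norm ((x - x * e) - (x - x * e) * f) \<le> \<epsilon>"
    using approximate_unit_right[OF I _ assms(4)] by metis
  have eq: "y - y * (e + f - e * f) = (y - y * e) - (y - y * e) * f" for y
    by (simp add: algebra_simps)
  have "norm (y - y * (e + f - e * f)) \<le> \<epsilon>" if "y \<in> F" for y
    using contractingD(2)[OF f(2), of "y - y * e"] e(3) that by (auto simp: eq intro: order_trans)
  moreover have "e + f - e * f \<in> I" using e f closed_idealD[OF I] closed_ideal_diff[OF I] by auto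
  ultimately show ?case
    using f(3) contracting_circ[OF e(2) f(2)] by (intro exI[of _ "e + f - e * f"]) (auto simp: eq)
qed

lemma approximate_unit_finite:
  fixes F :: "'a::cstar_algebra set"
  assumes I: "closed_ideal I" and F: "finite F" "F \<subseteq> I" and e: "\<epsilon> > 0"
  obtains u where "u \<in> I" "star u = u" "contracting u"
    "\<And>x. x \<in> F \<Longrightarrow> norm (x - u * x) \<le> \<epsilon> \<and> norm (x - x * u) \<le> \<epsilon>"
proof -
  have "finite (F \<union> star ` F)" "F \<union> star ` F \<subseteq> I" using F closed_ideal_star[OF I] by auto
  then obtain e where e: "e \<in> I" "contracting e" "\<forall>x\<in>F \<union> star ` F. norm (x - x * e) \<le> \<epsilon>"
    using approximate_unit_right_finite[OF I _ _ assms(4)] by metis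
  \<comment> \<open>\<open>1 - u = (1 - e) (1 - e)\<^sup>*\<close> is self-adjoint and still kills \<open>x\<close> from the right.\<close>
  define u where "u = e + star e - e * star e"
  have uI: "u \<in> I" unfolding u_def
    using e closed_idealD[OF I] closed_ideal_diff[OF I] closed_ideal_star[OF I] by auto
  have su: "star u = u" by (simp add: u_def star_simps add.commute)
  have cu: "contracting u"
    unfolding u_def by (intro contracting_circ contracting_star e)
  have k: "norm (x - x * u) \<le> \<epsilon>" if "x \<in> F \<union> star ` F" for x
  proof -
    have "x - x * u = (x - x * e) - (x - x * e) * star e" by (simp add: u_def algebra_simps)
    then have "norm (x - x * u) \<le> norm (x - x * e)"
      using contractingD(2)[OF contracting_star[OF e(2)], of "x - x * e"] by (simp only:)
    also have "\<dots> \<le> \<epsilon>" using e(3) that by blast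
    finally show ?thesis .
  qed
  have "norm (x - u * x) \<le> \<epsilon>" if "x \<in> F" for x
    using k[of "star x"] that norm_star[of "x - u * x"] by (simp add: star_simps su)
  with k uI su cu show thesis using that by blast
qed

definition commutator :: "'a::cstar_algebra \<Rightarrow> 'a \<Rightarrow> 'a" where
  "commutator x y = x * y - y * x"

lemma norm_commutator_le: "norm (commutator x y) \<le> 2 * norm x * norm y"
  using norm_triangle_ineq4[of "x * y" "y * x"] norm_mult_ineq[of x y] norm_mult_ineq[of y x]
  by (simp add: commutator_def mult.commute[of "norm y"])

text \<open>Successive members of a fast increasing approximate unit have almost orthogonal
  commutators: if \<open>v\<close> is a unit for \<open>[u\<^sub>j, b]\<close> and \<open>u\<^sub>k\<close> is a unit for \<open>v\<close> and \<open>a v\<close>, then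
  \<open>[u\<^sub>k, a] [u\<^sub>j, b] = [u\<^sub>k, a] v [u\<^sub>j, b]\<close> and \<open>[u\<^sub>k, a] v = 0\<close>, up to small errors.\<close>

lemma orthogonal_commutators:
  fixes C F :: "'a::cstar_algebra set" and N :: nat
  assumes I: "closed_ideal I" and F: "finite F" "F \<subseteq> I" and C: "finite C" and e: "\<eta> > 0"
  shows "\<exists>u. (\<forall>k<N. u k \<in> I \<and> star (u k) = u k \<and> contracting (u k)
        \<and> (\<forall>x\<in>F. norm (x - u k * x) \<le> \<eta>))
      \<and> (\<forall>k<N. \<forall>j<k. \<forall>a\<in>C. \<forall>b\<in>C. norm (commutator (u k) a * commutator (u j) b) \<le> \<eta>)"
proof (induction N)
  case 0
  show ?case by simp
next
  case (Suc N)
  then obtain u where u0: "\<forall>k<N. u k \<in> I \<and> star (u k) = u k \<and> contracting (u k)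
        \<and> (\<forall>x\<in>F. norm (x - u k * x) \<le> \<eta>)"
      "\<forall>k<N. \<forall>j<k. \<forall>a\<in>C. \<forall>b\<in>C. norm (commutator (u k) a * commutator (u j) b) \<le> \<eta>"
    by (elim exE conjE)
  have u: "\<And>k. k < N \<Longrightarrow> u k \<in> I \<and> star (u k) = u k \<and> contracting (u k)
        \<and> (\<forall>x\<in>F. norm (x - u k * x) \<le> \<eta>)"
      "\<And>k j a b. k < N \<Longrightarrow> j < k \<Longrightarrow> a \<in> C \<Longrightarrow> b \<in> C \<Longrightarrow> norm (commutator (u k) a * commutator (u j) b) \<le> \<eta>"
    using u0 by simp_all
  define R where "R = Max (insert 0 (norm ` C))"
  have R: "norm a \<le> R" if "a \<in> C" for a using C that by (auto simp: R_def)
  have R0: "R \<ge> 0" using C by (simp add: R_def)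
  define \<eta>' where "\<eta>' = \<eta> / (4 * R + (1 + R) * (4 * R) + 1)"
  have den: "4 * R + (1 + R) * (4 * R) + 1 > 0" using R0 by (intro add_nonneg_pos) auto
  have \<eta>': "\<eta>' > 0" using den e by (simp add: \<eta>'_def)
  have \<eta>'': "\<eta>' * (4 * R + (1 + R) * (4 * R)) \<le> \<eta>"
  proof -
    have "\<eta>' * (4 * R + (1 + R) * (4 * R)) \<le> \<eta>' * (4 * R + (1 + R) * (4 * R) + 1)"
      using \<eta>' by (intro mult_left_mono) auto
    also have "\<dots> = \<eta>" using den by (simp add: \<eta>'_def)
    finally show ?thesis .
  qed
  have comm_I: "commutator x a \<in> I" if "x \<in> I" for x a
    using that closed_idealD[OF I] closed_ideal_diff[OF I] by (auto simp: commutator_def)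
  define S where "S = (\<Union>j<N. commutator (u j) ` C)"
  have "finite S" "S \<subseteq> I" using C u(1) comm_I by (auto simp: S_def)
  then obtain v where v: "v \<in> I" "contracting v"
      "\<And>x. x \<in> S \<Longrightarrow> norm (x - v * x) \<le> \<eta>'"
    using approximate_unit_finite[OF I _ _ \<eta>', of S] by metis
  define G where "G = F \<union> {v} \<union> (\<lambda>a. a * v) ` C"
  have "finite G" "G \<subseteq> I" using F C v closed_idealD[OF I] by (auto simp: G_def)
  then obtain y where y: "y \<in> I" "star y = y" "contracting y"
      "\<And>x. x \<in> G \<Longrightarrow> norm (x - y * x) \<le> min \<eta> \<eta>'"
    using approximate_unit_finite[OF I, of G "min \<eta> \<eta>'"] e \<eta>' by (metis min_less_iff_conj)
  have new: "norm (commutator y a * commutator (u j) b) \<le> \<eta>" if "j < N" "a \<in> C" "b \<in> C" for j a b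
  proof -
    define c where "c = commutator (u j) b"
    have cS: "c \<in> S" using that by (auto simp: S_def c_def)
    have "norm c \<le> 2 * norm (u j) * norm b" unfolding c_def by (rule norm_commutator_le)
    also have "\<dots> \<le> 2 * 2 * R"
      using u(1)[OF that(1)] contracting_norm_le[of "u j"] R[OF that(3)] R0 by (intro mult_mono) auto
    finally have nc: "norm c \<le> 4 * R" by simp
    have "norm (commutator y a) \<le> 2 * norm y * norm a" by (rule norm_commutator_le)
    also have "\<dots> \<le> 2 * 2 * R"
      using contracting_norm_le[OF y(3)] R[OF that(2)] R0 by (intro mult_mono) auto
    finally have ny: "norm (commutator y a) \<le> 4 * R" by simp
    have "commutator y a * v = a * (v - y * v) - (a * v - y * (a * v))"
      by (simp add: commutator_def algebra_simps)
    also have "norm \<dots> \<le> norm a * norm (v - y * v) + norm (a * v - y * (a * v))"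
      by (rule order_trans[OF norm_triangle_ineq4]) (simp add: norm_mult_ineq)
    also have "\<dots> \<le> R * \<eta>' + \<eta>'"
      using y(4)[of v] y(4)[of "a * v"] that R R0 \<eta>' by (intro add_mono mult_mono) (auto simp: G_def)
    finally have yv: "norm (commutator y a * v) \<le> (1 + R) * \<eta>'" by (simp add: algebra_simps)
    have "commutator y a * c = commutator y a * (c - v * c) + (commutator y a * v) * c"
      by (simp add: algebra_simps)
    also have "norm \<dots> \<le> norm (commutator y a) * norm (c - v * c) + norm (commutator y a * v) * norm c"
      by (intro norm_triangle_le add_mono norm_mult_ineq)
    also have "\<dots> \<le> (4 * R) * \<eta>' + ((1 + R) * \<eta>') * (4 * R)"
      using ny v(3)[OF cS] yv nc R0 \<eta>' by (intro add_mono mult_mono) auto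
    also have "\<dots> \<le> \<eta>" using \<eta>'' by (simp add: algebra_simps)
    finally show ?thesis unfolding c_def .
  qed
  show ?case
  proof (intro exI[of _ "u(N := y)"] conjI allI impI ballI)
    fix k assume k: "k < Suc N"
    show "(u(N := y)) k \<in> I" "star ((u(N := y)) k) = (u(N := y)) k" "contracting ((u(N := y)) k)"
      using k u(1)[of k] y by auto
    show "norm (x - (u(N := y)) k * x) \<le> \<eta>" if "x \<in> F" for x
      using k u(1)[of k] y(4)[of x] that by (auto simp: G_def)
    fix j a b assume "j < k" "a \<in> C" "b \<in> C"
    then show "norm (commutator ((u(N := y)) k) a * commutator ((u(N := y)) j) b) \<le> \<eta>"
      using k u(2)[of k j a b] new[of j a b] by auto
  qed
qed

text \<open>Averaging such a family of length \<open>N\<close> makes commutators of order \<open>1 / sqrt N\<close>, because a sum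
  of \<open>N\<close> almost orthogonal elements of bounded norm has norm of order \<open>sqrt N\<close>.\<close>

proposition quasicentral_approximate_unit:
  fixes C F :: "'a::cstar_algebra set"
  assumes I: "closed_ideal I" and F: "finite F" "F \<subseteq> I" and C: "finite C" and e: "\<epsilon> > 0"
  obtains u where "u \<in> I" "star u = u" "contracting u"
    "\<And>x. x \<in> F \<Longrightarrow> norm (x - u * x) \<le> \<epsilon>" "\<And>a. a \<in> C \<Longrightarrow> norm (commutator u a) \<le> \<epsilon>"
proof -
  define C' where "C' = C \<union> star ` C"
  have C': "finite C'" "a \<in> C' \<Longrightarrow> star a \<in> C'" for a using C by (auto simp: C'_def star_star)
  define R where "R = Max (insert 0 (norm ` C))"
  have R: "norm a \<le> R" if "a \<in> C" for a using C that by (auto simp: R_def)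
  have R0: "R \<ge> 0" using C by (simp add: R_def)
  obtain N :: nat where N: "real N > (16 * R\<^sup>2 + 1) / \<epsilon>\<^sup>2" using reals_Archimedean2 by blast
  have "(16 * R\<^sup>2 + 1) / \<epsilon>\<^sup>2 > 0" using e by (simp add: add_nonneg_pos)
  then have N0: "N > 0" using N by (intro gr0I) auto
  define \<eta> where "\<eta> = min \<epsilon> (1 / real N)"
  have \<eta>: "\<eta> > 0" "\<eta> \<le> \<epsilon>" "\<eta> \<le> 1 / real N" using e N0 by (auto simp: \<eta>_def)
  obtain u where u0: "\<forall>k<N. u k \<in> I \<and> star (u k) = u k \<and> contracting (u k)
        \<and> (\<forall>x\<in>F. norm (x - u k * x) \<le> \<eta>)"
      "\<forall>k<N. \<forall>j<k. \<forall>a\<in>C'. \<forall>b\<in>C'. norm (commutator (u k) a * commutator (u j) b) \<le> \<eta>"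
    using orthogonal_commutators[OF I F C'(1) \<eta>(1), of N] by (elim exE conjE)
  have u: "\<And>k. k < N \<Longrightarrow> u k \<in> I \<and> star (u k) = u k \<and> contracting (u k)
        \<and> (\<forall>x\<in>F. norm (x - u k * x) \<le> \<eta>)"
      "\<And>k j a b. k < N \<Longrightarrow> j < k \<Longrightarrow> a \<in> C' \<Longrightarrow> b \<in> C' \<Longrightarrow> norm (commutator (u k) a * commutator (u j) b) \<le> \<eta>"
    using u0 by simp_all
  define y where "y = (1 / real N) *\<^sub>R (\<Sum>k<N. u k)"
  have yI: "y \<in> I" unfolding y_def using u(1) by (intro closed_ideal_scaleR closed_ideal_sum I) auto
  have sy: "star y = y" using u(1) by (simp add: y_def star_scaleR star_sum)
  have cy: "contracting y" unfolding y_def using u(1) N0 by (intro contracting_average) auto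
  have ky: "norm (x - y * x) \<le> \<epsilon>" if "x \<in> F" for x
  proof -
    have "x - y * x = (1 / real N) *\<^sub>R (\<Sum>k<N. x - u k * x)"
      using N0 by (simp add: y_def sum_subtractf scaleR_diff_right sum_distrib_right
          mult_scaleR_left sum_constant_scaleR)
    moreover have "norm (\<Sum>k<N. x - u k * x) \<le> real N * \<eta>"
      using sum_norm_bound[of "{..<N}" "\<lambda>k. x - u k * x" \<eta>] u(1) that by auto
    ultimately have "norm (x - y * x) \<le> \<eta>" using N0 by (simp add: divide_simps mult.commute)
    then show ?thesis using \<eta> by simp
  qed
  have "norm (commutator y a) \<le> \<epsilon>" if a: "a \<in> C" for a
  proof -
    have aC: "a \<in> C'" "star a \<in> C'" using a by (auto simp: C'_def)
    define X where "X = (\<Sum>k<N. commutator (u k) a)"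
    have yX: "commutator y a = (1 / real N) *\<^sub>R X"
      by (simp add: y_def X_def commutator_def sum_subtractf scaleR_diff_right
          sum_distrib_right sum_distrib_left mult_scaleR_left mult_scaleR_right)
    have sc: "star (commutator (u k) b) = - commutator (u k) (star b)" if "k < N" for k b
      using u(1)[OF that] by (simp add: commutator_def star_simps)
    have entry: "norm (star (commutator (u k) a) * commutator (u j) a) \<le> (if k = j then 16 * R\<^sup>2 else \<eta>)"
      if kj: "k < N" "j < N" for k j
    proof -
      consider "k = j" | "j < k" | "k < j" by linarith
      then show ?thesis
      proof cases
        case 1
        have "norm (commutator (u j) a) \<le> 2 * norm (u j) * norm a" by (rule norm_commutator_le)
        also have "\<dots> \<le> 2 * 2 * R"
          using u(1)[OF kj(2)] contracting_norm_le[of "u j"] R[OF a] R0 by (intro mult_mono) auto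
        finally have "(norm (commutator (u j) a))\<^sup>2 \<le> (4 * R)\<^sup>2" by (intro power_mono) auto
        then show ?thesis using 1 by (simp add: cstar_identity power_mult_distrib)
      next
        case 2
        then show ?thesis using u(2)[OF kj(1) 2 aC(2,1)] sc[OF kj(1)] by simp
      next
        case 3
        have "star (star (commutator (u k) a) * commutator (u j) a)
            = - (commutator (u j) (star a) * commutator (u k) a)"
          using sc[OF kj(2)] by (simp add: star_mult star_star)
        then have "norm (star (commutator (u k) a) * commutator (u j) a)
            = norm (commutator (u j) (star a) * commutator (u k) a)"
          by (metis norm_star norm_minus_cancel)
        then show ?thesis using u(2)[OF kj(2) 3 aC(2,1)] 3 by simp
      qed
    qed
    have "(norm X)\<^sup>2 = norm (\<Sum>k<N. \<Sum>j<N. star (commutator (u k) a) * commutator (u j) a)"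
      unfolding cstar_identity[symmetric] X_def by (simp add: star_sum sum_product)
    also have "\<dots> \<le> (\<Sum>k<N. \<Sum>j<N. if k = j then 16 * R\<^sup>2 else \<eta>)"
      by (rule sum_norm_le, rule sum_norm_le) (use entry in auto)
    also have "\<dots> \<le> (\<Sum>k<N. \<Sum>j<N. (if k = j then 16 * R\<^sup>2 else 0) + \<eta>)"
      using \<eta> by (intro sum_mono) auto
    also have "\<dots> = real N * (16 * R\<^sup>2) + real N * (real N * \<eta>)" by (simp add: sum.distrib distrib_left)
    also have "\<dots> \<le> real N * (16 * R\<^sup>2) + real N * 1"
      using \<eta>(3) N0 by (intro add_mono mult_left_mono) (auto simp: divide_simps mult.commute)
    finally have "(norm X)\<^sup>2 \<le> real N * (16 * R\<^sup>2 + 1)" by (simp add: algebra_simps)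
    also have "\<dots> \<le> real N * (\<epsilon>\<^sup>2 * real N)"
      using N e by (intro mult_left_mono) (auto simp: divide_simps mult.commute)
    finally have "(norm X)\<^sup>2 \<le> (\<epsilon> * real N)\<^sup>2" by (simp add: power2_eq_square algebra_simps)
    then have "norm X \<le> \<epsilon> * real N" using e by (simp add: power2_le_iff_abs_le)
    then show ?thesis using N0 by (simp add: yX divide_simps)
  qed
  with yI sy cy ky show thesis using that by blast
qed

section \<open>Asymptotically central unitaries equal to \<open>-1\<close> on the ideal\<close>

lemma commutator_square:
  assumes "quasi_unitary w"
  shows "norm (commutator (w + w + w * w) a) \<le> 6 * norm (commutator w a)"
proof -
  let ?c = "commutator w a"
  have "commutator (w + w + w * w) a = (?c + ?c) + (?c * w + w * ?c)"
    by (simp add: commutator_def algebra_simps)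
  also have "norm \<dots> \<le> (norm ?c + norm ?c) + (norm ?c * norm w + norm w * norm ?c)"
    by (intro norm_triangle_le add_mono norm_mult_ineq order_refl)
  also have "\<dots> \<le> (norm ?c + norm ?c) + (norm ?c * 2 + 2 * norm ?c)"
    using quasi_unitary_norm_le[OF assms] by (intro add_mono mult_mono order_refl) auto
  finally show ?thesis by simp
qed

lemma eigenvector_square:
  assumes w: "quasi_unitary w" and z: "cmod \<zeta> = 1" and d: "norm (x + w * x - scaleC \<zeta> x) \<le> d"
  shows "norm (x + (w + w + w * w) * x - scaleC (\<zeta>\<^sup>2) x) \<le> 2 * d"
proof -
  let ?d = "x + w * x - scaleC \<zeta> x"
  have "x + (w + w + w * w) * x - scaleC (\<zeta>\<^sup>2) x = (?d + w * ?d) + scaleC \<zeta> ?d"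
    by (simp add: algebra_simps scaleC.diff_right scaleC.add_right scaleC_mult_right scaleC_scaleC power2_eq_square)
  also have "norm \<dots> \<le> norm (?d + w * ?d) + norm (scaleC \<zeta> ?d)" by (rule norm_triangle_ineq)
  also have "\<dots> = 2 * norm ?d" by (simp only: quasi_unitary_norm[OF w] norm_scaleC z)
  finally show ?thesis using d by simp
qed

text \<open>The Cayley transform of \<open>\<tau>u\<close> with \<open>\<tau> = tan (\<pi>/8) = sqrt 2 - 1\<close> is an eighth root of unity where
  \<open>u = 1\<close>; its fourth power is then \<open>-1\<close>. This small value of \<open>\<tau>\<close> keeps \<open>\<tau>u\<close> of norm below
  one, although only \<open>norm u \<le> 2\<close> is known.\<close>

lemma central_unitary:
  fixes C F :: "'a::cstar_algebra set"
  assumes I: "closed_ideal I" and F: "finite F" "F \<subseteq> I" and C: "finite C" and e: "\<epsilon> > 0"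
  obtains w where "w \<in> I" "quasi_unitary w" "\<And>x. x \<in> F \<Longrightarrow> norm (2 *\<^sub>R x + w * x) \<le> \<epsilon>"
    "\<And>a. a \<in> C \<Longrightarrow> norm (commutator w a) \<le> \<epsilon>"
proof -
  define \<tau> where "\<tau> = sqrt 2 - 1"
  have s2: "1 < sqrt 2" "sqrt 2 < 3 / 2"
    by simp (rule real_less_lsqrt, auto simp: power2_eq_square)
  have \<tau>: "0 < \<tau>" "\<tau> < 1 / 2" "\<tau>\<^sup>2 = 1 - 2 * \<tau>"
    using s2 by (auto simp: \<tau>_def power2_diff)
  define \<delta> where "\<delta> = min (\<epsilon> / 16) (\<epsilon> * \<tau> / 144)"
  have \<delta>: "\<delta> > 0" "16 * \<delta> \<le> \<epsilon>" "144 * \<delta> \<le> \<epsilon> * \<tau>"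
    using e \<tau> by (auto simp: \<delta>_def min_def)
  obtain u where u: "u \<in> I" "star u = u" "contracting u"
      "\<And>x. x \<in> F \<Longrightarrow> norm (x - u * x) \<le> \<delta>" "\<And>a. a \<in> C \<Longrightarrow> norm (commutator u a) \<le> \<delta>"
    using quasicentral_approximate_unit[OF I F C \<delta>(1)] by blast
  define h where "h = \<tau> *\<^sub>R u"
  have nh: "norm h \<le> 2 * \<tau>" using contracting_norm_le[OF u(3)] \<tau> by (simp add: h_def)
  have "norm h < 1" using nh \<tau>(2) by linarith
  moreover have "h \<in> I" "star h = h"
    using closed_ideal_scaleR[OF I u(1)] u(2) by (auto simp: h_def star_scaleR)
  ultimately obtain r where r: "r \<in> I" "r = scaleC \<i> h + scaleC \<i> h * r"
      "r = scaleC \<i> h + r * scaleC \<i> h" "quasi_unitary (2 *\<^sub>R r)"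
    using cayley_transform[OF I] by metis
  define A where "A = scaleC \<i> h"
  have nA: "norm A \<le> 2 * \<tau>" using nh by (simp add: A_def norm_scaleC)
  have nr: "norm r \<le> 1" using quasi_unitary_norm_le[OF r(4)] by simp
  have rc: "norm (commutator r a) \<le> 2 * \<delta> / \<tau>" if "a \<in> C" for a
  proof -
    have "commutator A a = scaleC (\<i> * of_real \<tau>) (commutator u a)"
      by (simp add: A_def h_def commutator_def scaleC_mult_left scaleC_mult_right scaleC_scaleC[symmetric]
          scaleC_of_real scaleC.diff_right scaleR_diff_right)
    then have Aa: "norm (commutator A a) \<le> \<tau> * \<delta>"
      using u(5)[OF that] \<tau> by (simp add: norm_scaleC norm_mult)
    have "r = A + A * r" using r(2) by (simp add: A_def)
    then have "commutator r a = commutator (A + A * r) a" by simp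
    also have "\<dots> = (commutator A a + commutator A a * r) + A * commutator r a"
      by (simp add: commutator_def algebra_simps)
    finally have "norm (commutator r a) \<le>
        (norm (commutator A a) + norm (commutator A a) * norm r) + norm A * norm (commutator r a)"
      using norm_triangle_le[OF add_mono[OF norm_triangle_le[OF add_mono[OF order_refl norm_mult_ineq]] norm_mult_ineq]]
      by metis
    also have "\<dots> \<le> (\<tau> * \<delta> + \<tau> * \<delta> * 1) + (2 * \<tau>) * norm (commutator r a)"
      using Aa nr nA \<tau> \<delta> by (intro add_mono mult_mono) auto
    finally have "(1 - 2 * \<tau>) * norm (commutator r a) \<le> 2 * \<tau> * \<delta>" by (simp add: algebra_simps)
    then have "\<tau> * (\<tau> * norm (commutator r a)) \<le> \<tau> * (2 * \<delta>)"
      unfolding \<tau>(3)[symmetric] by (simp add: power2_eq_square mult.assoc mult.left_commute)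
    then have "\<tau> * norm (commutator r a) \<le> 2 * \<delta>" using \<tau> by (simp only: mult_le_cancel_left_pos)
    then show ?thesis using \<tau> by (simp add: divide_simps mult.commute)
  qed
  define \<alpha> where "\<alpha> = 1 - \<i> * of_real \<tau>"
  define \<beta> where "\<beta> = 1 + \<i> * of_real \<tau>"
  define \<zeta> where "\<zeta> = \<beta> / \<alpha>"
  have nz: "\<alpha> \<noteq> 0" by (simp add: \<alpha>_def complex_eq_iff)
  have \<alpha>1: "cmod \<alpha> \<ge> 1" by (simp add: \<alpha>_def cmod_def)
  have "cmod \<beta> = cmod \<alpha>" by (simp add: \<alpha>_def \<beta>_def cmod_def)
  then have z1: "cmod \<zeta> = 1" using nz by (simp add: \<zeta>_def norm_divide)
  have t2: "(of_real \<tau> :: complex)\<^sup>2 = 1 - 2 * of_real \<tau>"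
    using arg_cong[OF \<tau>(3), of complex_of_real] by simp
  have sq: "\<alpha>\<^sup>2 = 2 * of_real \<tau> * (1 - \<i>)" "\<beta>\<^sup>2 = 2 * of_real \<tau> * (1 + \<i>)"
    using t2 by (auto simp: \<alpha>_def \<beta>_def power2_eq_square algebra_simps)
  have "(\<beta>\<^sup>2)\<^sup>2 = - (\<alpha>\<^sup>2)\<^sup>2" unfolding sq by (simp add: power2_eq_square algebra_simps)
  then have z4: "(\<zeta>\<^sup>2)\<^sup>2 = - 1" using nz by (simp add: \<zeta>_def power_divide)
  have kill: "norm (x + (2 *\<^sub>R r) * x - scaleC \<zeta> x) \<le> 4 * \<delta>" if x: "x \<in> F" for x
  proof -
    let ?d = "x - u * x"
    have Ax: "A * x = scaleC (\<i> * of_real \<tau>) (x - ?d)"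
      by (simp add: A_def h_def scaleC_mult_left scaleC_scaleC[symmetric] scaleC_of_real)
    have "r = A + r * A" using r(3) by (simp add: A_def)
    then have "r * x = (A + r * A) * x" by simp
    also have "\<dots> = A * x + r * (A * x)" by (simp add: algebra_simps)
    also have "\<dots> = scaleC (\<i> * of_real \<tau>) (x + r * x - (?d + r * ?d))"
      unfolding Ax by (simp add: scaleC_mult_right scaleC_add_right[symmetric] algebra_simps)
    finally have rx: "r * x = scaleC (\<i> * of_real \<tau>) x + scaleC (\<i> * of_real \<tau>) (r * x)
        - scaleC (\<i> * of_real \<tau>) (?d + r * ?d)"
      by (simp only: scaleC.diff_right scaleC.add_right)
    have "scaleC \<alpha> (x + (2 *\<^sub>R r) * x - scaleC \<zeta> x) = scaleC \<alpha> x + 2 *\<^sub>R scaleC \<alpha> (r * x) - scaleC \<beta> x"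
      using nz by (simp add: scaleC.diff_right scaleC.add_right scaleC.scaleR_right mult_scaleR_left
          scaleC_scaleC \<zeta>_def)
    also have "scaleC \<alpha> (r * x) = scaleC (\<i> * of_real \<tau>) x - scaleC (\<i> * of_real \<tau>) (?d + r * ?d)"
      unfolding \<alpha>_def scaleC.diff_left scaleC_1 by (subst rx) simp
    also have "scaleC \<alpha> x + 2 *\<^sub>R (scaleC (\<i> * of_real \<tau>) x - scaleC (\<i> * of_real \<tau>) (?d + r * ?d))
        - scaleC \<beta> x = - (2 *\<^sub>R scaleC (\<i> * of_real \<tau>) (?d + r * ?d))"
      by (simp add: \<alpha>_def \<beta>_def scaleC.diff_left scaleC.add_left scaleR_diff_right scaleR_2)
    finally have "norm (scaleC \<alpha> (x + (2 *\<^sub>R r) * x - scaleC \<zeta> x)) = 2 * (\<tau> * norm (?d + r * ?d))"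
      using \<tau> by (simp add: norm_scaleC norm_mult)
    also have "norm (?d + r * ?d) \<le> norm ?d + norm r * norm ?d"
      by (intro norm_triangle_le add_mono norm_mult_ineq order_refl)
    also have "\<dots> \<le> \<delta> + 1 * \<delta>" using u(4)[OF x] nr by (intro add_mono mult_mono) auto
    finally have "cmod \<alpha> * norm (x + (2 *\<^sub>R r) * x - scaleC \<zeta> x) \<le> 2 * (\<tau> * (\<delta> + 1 * \<delta>))"
      using \<tau> by (simp add: norm_scaleC)
    also have "\<dots> \<le> 4 * \<delta>" using \<tau> \<delta> by simp
    finally show ?thesis
      using mult_right_mono[OF \<alpha>1 norm_ge_zero[of "x + (2 *\<^sub>R r) * x - scaleC \<zeta> x"]] by simp
  qed
  define v where "v = 2 *\<^sub>R r"
  define w2 where "w2 = v + v + v * v"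
  define w where "w = w2 + w2 + w2 * w2"
  have q: "quasi_unitary v" using r(4) by (simp add: v_def)
  have q2: "quasi_unitary w2" unfolding w2_def by (intro quasi_unitary_circ q)
  have q4: "quasi_unitary w" unfolding w_def by (intro quasi_unitary_circ q2)
  have "w \<in> I"
    using r(1) closed_idealD[OF I] closed_ideal_scaleR[OF I] by (simp add: v_def w2_def w_def)
  moreover have "norm (2 *\<^sub>R x + w * x) \<le> \<epsilon>" if "x \<in> F" for x
  proof -
    have "norm (x + w2 * x - scaleC (\<zeta>\<^sup>2) x) \<le> 2 * (4 * \<delta>)"
      unfolding w2_def using kill[OF that] by (intro eigenvector_square q z1) (simp add: v_def)
    then have "norm (x + w * x - scaleC ((\<zeta>\<^sup>2)\<^sup>2) x) \<le> 2 * (2 * (4 * \<delta>))"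
      unfolding w_def by (intro eigenvector_square q2) (auto simp: norm_power z1)
    moreover have "x + w * x - scaleC ((\<zeta>\<^sup>2)\<^sup>2) x = 2 *\<^sub>R x + w * x"
      unfolding z4 by (simp add: scaleC.minus_left scaleR_2)
    ultimately have "norm (2 *\<^sub>R x + w * x) \<le> 2 * (2 * (4 * \<delta>))" by (simp only:)
    then show ?thesis using \<delta>(2) by simp
  qed
  moreover have "norm (commutator w a) \<le> \<epsilon>" if "a \<in> C" for a
  proof -
    have "commutator v a = 2 *\<^sub>R commutator r a"
      by (simp add: v_def commutator_def scaleR_diff_right)
    then have "norm (commutator v a) \<le> 4 * \<delta> / \<tau>" using rc[OF that] by simp
    moreover have "norm (commutator w2 a) \<le> 6 * norm (commutator v a)"
      unfolding w2_def by (rule commutator_square[OF q])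
    moreover have "norm (commutator w a) \<le> 6 * norm (commutator w2 a)"
      unfolding w_def by (rule commutator_square[OF q2])
    ultimately have "norm (commutator w a) \<le> 144 * \<delta> / \<tau>" by simp
    also have "\<dots> \<le> \<epsilon>" using \<delta>(3) \<tau> by (simp add: divide_simps)
    finally show ?thesis .
  qed
  ultimately show thesis using q4 that by blast
qed

lemma central_unitary_sequence:
  fixes C F :: "'a::cstar_algebra set"
  assumes I: "closed_ideal I" and F: "finite F" "F \<subseteq> I" and C: "finite C"
  obtains w where "\<And>k::nat. w k \<in> I" "\<And>k. quasi_unitary (w k)"
    "\<And>x. x \<in> F \<Longrightarrow> (\<lambda>k. 2 *\<^sub>R x + w k * x) \<longlonglongrightarrow> 0"
    "\<And>a. a \<in> C \<Longrightarrow> (\<lambda>k. commutator (w k) a) \<longlonglongrightarrow> 0"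
proof -
  have "\<exists>w. w \<in> I \<and> quasi_unitary w \<and> (\<forall>x\<in>F. norm (2 *\<^sub>R x + w * x) \<le> 1 / real (Suc k))
      \<and> (\<forall>a\<in>C. norm (commutator w a) \<le> 1 / real (Suc k))" for k
    using central_unitary[OF I F C, of "1 / real (Suc k)"] by (metis of_nat_0_less_iff zero_less_Suc zero_less_divide_1_iff)
  then obtain w where w: "\<And>k. w k \<in> I \<and> quasi_unitary (w k) \<and> (\<forall>x\<in>F. norm (2 *\<^sub>R x + w k * x) \<le> 1 / real (Suc k))
      \<and> (\<forall>a\<in>C. norm (commutator (w k) a) \<le> 1 / real (Suc k))"
    by metis
  have lim: "(\<lambda>k. 1 / real (Suc k)) \<longlonglongrightarrow> 0" using LIMSEQ_inverse_real_of_nat by (simp add: inverse_eq_divide)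
  show thesis
  proof (rule that)
    show "(\<lambda>k. 2 *\<^sub>R x + w k * x) \<longlonglongrightarrow> 0" if "x \<in> F" for x
      by (rule Lim_null_comparison[OF _ lim]) (use w that in \<open>auto intro!: always_eventually\<close>)
    show "(\<lambda>k. commutator (w k) a) \<longlonglongrightarrow> 0" if "a \<in> C" for a
      by (rule Lim_null_comparison[OF _ lim]) (use w that in \<open>auto intro!: always_eventually\<close>)
  qed (use w in auto)
qed

section \<open>Trigonometric polynomials in an asymptotically central unitary\<close>

text \<open>The element \<open>(1 + w)\<^sup>n x\<close>. Powers of \<open>1 + w\<close> are represented by their action, as they lie in
  the unitisation only.\<close>

definition upow :: "'a::cstar_algebra \<Rightarrow> nat \<Rightarrow> 'a \<Rightarrow> 'a" where
  "upow w n x = ((\<lambda>y. y + w * y) ^^ n) x"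

lemma upow_0 [simp]: "upow w 0 x = x"
  by (simp add: upow_def)

lemma upow_Suc: "upow w (Suc n) x = upow w n x + w * upow w n x"
  by (simp add: upow_def)

lemma upow_upow: "upow w m (upow w n x) = upow w (m + n) x"
  by (simp add: upow_def funpow_add)

lemma upow_add: "upow w n (x + y) = upow w n x + upow w n y"
  by (induction n) (simp_all add: upow_Suc algebra_simps)

lemma upow_zero [simp]: "upow w n 0 = 0"
  by (induction n) (simp_all add: upow_Suc)

lemma upow_sum: "upow w n (\<Sum>i\<in>A. f i) = (\<Sum>i\<in>A. upow w n (f i))"
  by (induction A rule: infinite_finite_induct) (simp_all add: upow_add)

lemma upow_diff: "upow w n (x - y) = upow w n x - upow w n y"
  by (metis upow_add add_diff_cancel_right' diff_add_cancel)

lemma upow_scaleR: "upow w n (r *\<^sub>R x) = r *\<^sub>R upow w n x"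
  by (induction n) (simp_all add: upow_Suc algebra_simps)

lemma upow_minus: "upow w n (- x) = - upow w n x"
  using upow_diff[of w n 0 x] by simp

lemma upow_norm: "quasi_unitary w \<Longrightarrow> norm (upow w n x) = norm x"
  by (induction n) (simp_all add: upow_Suc quasi_unitary_norm)

lemma upow_inner: "quasi_unitary w \<Longrightarrow> star (upow w n x) * upow w n y = star x * y"
  by (induction n) (simp_all add: upow_Suc quasi_unitary_inner)

lemma upow_star_inverse:
  assumes "quasi_unitary w"
  shows "upow w n (upow (star w) n x) = x"
proof (induction n arbitrary: x)
  case (Suc n)
  have "upow (star w) (Suc n) x = upow (star w) n (x + star w * x)"
    by (simp add: upow_def funpow_Suc_right del: funpow.simps)
  moreover have "x + star w * x + w * (x + star w * x) = x + (w + star w + w * star w) * x"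
    by (simp add: algebra_simps)
  ultimately show ?case
    using assms Suc[of "x + star w * x"] by (simp add: upow_Suc quasi_unitary_def)
qed simp

lemma upow_commute:
  assumes "quasi_unitary w"
  shows "norm (upow w n (a * x) - a * upow w n x) \<le> real n * (norm (commutator w a) * norm x)"
proof (induction n)
  case (Suc n)
  let ?d = "upow w n (a * x) - a * upow w n x"
  have "upow w (Suc n) (a * x) - a * upow w (Suc n) x = (?d + w * ?d) + commutator w a * upow w n x"
    by (simp add: upow_Suc commutator_def algebra_simps)
  also have "norm \<dots> \<le> norm (?d + w * ?d) + norm (commutator w a) * norm (upow w n x)"
    by (intro norm_triangle_le add_mono norm_mult_ineq order_refl)
  finally have "norm (upow w (Suc n) (a * x) - a * upow w (Suc n) x) \<le> norm ?d + norm (commutator w a) * norm x"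
    by (simp only: quasi_unitary_norm[OF assms] upow_norm[OF assms])
  with Suc show ?case by (simp add: algebra_simps)
qed simp

lemma commutator_star:
  assumes w: "quasi_unitary w"
  shows "norm (commutator w (star a)) = norm (commutator w a)"
proof -
  let ?c = "commutator w a" let ?d = "?c + star w * ?c"
  have 1: "star w * w = - w - star w" and 2: "w * star w = - w - star w"
    using w by (auto simp: quasi_unitary_def eq_neg_iff_add_eq_0 algebra_simps)
  have 3: "star w * (w * y) = - w * y - star w * y" for y
    using arg_cong[OF 1, of "\<lambda>x. x * y"] by (simp add: algebra_simps)
  have "?d + ?d * star w = - commutator (star w) a"
    by (simp add: commutator_def algebra_simps 1 2 3)
  moreover have "star (commutator w (star a)) = - commutator (star w) a"
    by (simp add: commutator_def star_simps)
  ultimately have "norm (star (commutator w (star a))) = norm (?d + ?d * star w)" by simp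
  then show ?thesis
    by (simp only: norm_star quasi_unitary_norm[OF quasi_unitary_star[OF w]])
qed

text \<open>\<open>(U\<^sup>i a)\<^sup>* U\<^sup>j b\<close> is \<open>U\<^sup>j\<^sup>-\<^sup>i a\<^sup>* b\<close> up to commutators; multiplication by \<open>U\<^sup>N\<close> makes all exponents
  nonnegative.\<close>

lemma upow_sesquilinear:
  assumes w: "quasi_unitary w" and i: "i \<le> N"
  shows "norm (upow w N (star (upow w i a) * upow w j b) - upow w (N - i + j) (star a * b))
    \<le> real (i + j) * (norm (commutator w a) * norm b)"
proof -
  let ?k = "norm (commutator w a)"
  \<comment> \<open>The element \<open>U\<^sup>-\<^sup>i U\<^sup>j b\<close>, which cancels the power in \<open>(U\<^sup>i a)\<^sup>*\<close> exactly.\<close>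
  let ?q = "upow (star w) i (upow w j b)"
  have q: "upow w i ?q = upow w j b" by (rule upow_star_inverse[OF w])
  have nq: "norm ?q = norm b" by (simp add: upow_norm w quasi_unitary_star)
  have "star (upow w i a) * upow w j b = star a * ?q"
    using upow_inner[OF w, of i a ?q] q by (simp only:)
  then have "upow w N (star (upow w i a) * upow w j b) = upow w (N - i) (upow w i (star a * ?q))"
    using i by (simp add: upow_upow)
  moreover have "upow w (N - i + j) (star a * b) = upow w (N - i) (upow w j (star a * b))"
    by (simp add: upow_upow)
  ultimately have "norm (upow w N (star (upow w i a) * upow w j b) - upow w (N - i + j) (star a * b))
      = norm (upow w i (star a * ?q) - upow w j (star a * b))"
    by (simp only: upow_diff[symmetric] upow_norm[OF w])
  also have "\<dots> = norm ((upow w i (star a * ?q) - star a * upow w i ?q)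
      - (upow w j (star a * b) - star a * upow w j b))"
    by (simp add: q)
  also have "\<dots> \<le> real i * (?k * norm b) + real j * (?k * norm b)"
    using upow_commute[OF w, of i "star a" ?q] upow_commute[OF w, of j "star a" b]
    unfolding commutator_star[OF w] nq
    by (intro order_trans[OF norm_triangle_ineq4]) (rule add_mono)
  finally show ?thesis by (simp add: algebra_simps)
qed

definition trig_poly :: "(nat \<Rightarrow> 'a::cstar_algebra) \<Rightarrow> nat \<Rightarrow> real \<Rightarrow> 'a" where
  "trig_poly z N \<theta> = (\<Sum>n\<le>N. scaleC (cis (real n * \<theta>)) (z n))"

definition unitary_poly :: "(nat \<Rightarrow> 'a::cstar_algebra) \<Rightarrow> nat \<Rightarrow> 'a \<Rightarrow> 'a" where
  "unitary_poly z N w = (\<Sum>n\<le>N. upow w n (z n))"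

text \<open>Fourier coefficients are bounded by the supremum norm: average against a character over
  the roots of unity of order \<open>N + 1\<close>.\<close>

lemma sum_roots_of_unity:
  assumes "m \<le> N" "n \<le> N"
  shows "(\<Sum>j<Suc N. cis ((real m - real n) * (2 * pi * real j / real (Suc N))))
    = (if m = n then of_nat (Suc N) else 0)"
proof (cases "m = n")
  case False
  define t where "t = (real m - real n) * (2 * pi / real (Suc N))"
  have terms: "cis ((real m - real n) * (2 * pi * real j / real (Suc N))) = cis t ^ j" for j
    unfolding t_def Complex.DeMoivre by (rule arg_cong[where f = cis]) (simp only: times_divide_eq_right mult_ac)
  have "cis t ^ Suc N = cis (2 * pi * (real m - real n))"
    unfolding t_def Complex.DeMoivre by (simp add: mult_ac)
  also have "\<dots> = 1" by (rule cis_multiple_2pi) simp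
  finally have 1: "cis t ^ Suc N = 1" .
  have "cis t \<noteq> 1"
  proof
    assume "cis t = 1"
    then have "cos t = 1" by (simp add: complex_eq_iff)
    then obtain k :: int where "t = of_int k * 2 * pi" by (auto simp: cos_one_2pi_int)
    then have "(2 * pi) * (real m - real n) = (2 * pi) * (of_int k * real (Suc N))"
      by (simp add: t_def field_simps del: of_nat_Suc)
    then have "real m - real n = of_int k * real (Suc N)"
      by (simp only: mult_cancel_left) simp
    then have "of_int (int m - int n) = (of_int (k * int (Suc N)) :: real)" by simp
    then have k: "int m - int n = k * int (Suc N)" by (simp only: of_int_eq_iff)
    have "\<bar>int m - int n\<bar> < int (Suc N)" using assms by linarith
    moreover have "k \<noteq> 0" using k False by auto
    then have "int (Suc N) \<le> \<bar>k\<bar> * int (Suc N)" by simp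
    ultimately show False using k by (simp add: abs_mult)
  qed
  then have "(\<Sum>j<Suc N. cis t ^ j) = 0" by (rule trans[OF geometric_sum]) (simp only: 1, simp)
  with False show ?thesis by (simp only: terms) simp
qed simp

lemma fourier_coefficient_bound:
  assumes z: "\<And>\<theta>. norm (trig_poly z N \<theta>) \<le> M" and n: "n \<le> N"
  shows "norm (z n) \<le> M"
proof -
  define \<theta> where "\<theta> j = 2 * pi * real j / real (Suc N)" for j :: nat
  have "(\<Sum>j<Suc N. scaleC (cis (- (real n * \<theta> j))) (trig_poly z N (\<theta> j)))
      = (\<Sum>j<Suc N. \<Sum>m\<le>N. scaleC (cis ((real m - real n) * \<theta> j)) (z m))"
    by (intro sum.cong refl)
      (simp add: trig_poly_def scaleC.sum_right scaleC_scaleC cis_mult algebra_simps)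
  also have "\<dots> = (\<Sum>m\<le>N. scaleC (\<Sum>j<Suc N. cis ((real m - real n) * \<theta> j)) (z m))"
    by (subst sum.swap) (simp only: scaleC.sum_left)
  also have "\<dots> = (\<Sum>m\<le>N. if m = n then scaleC (of_nat (Suc N)) (z m) else 0)"
    unfolding \<theta>_def using n by (intro sum.cong refl) (simp only: sum_roots_of_unity atMost_iff, simp add: scaleC.zero_left)
  also have "\<dots> = scaleC (of_nat (Suc N)) (z n)" using n by simp
  finally have "real (Suc N) * norm (z n)
      = norm (\<Sum>j<Suc N. scaleC (cis (- (real n * \<theta> j))) (trig_poly z N (\<theta> j)))"
    by (simp only: norm_scaleC norm_of_nat)
  also have "\<dots> \<le> (\<Sum>j<Suc N. M)"
    by (rule sum_norm_le) (simp add: norm_scaleC z)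
  finally show ?thesis by simp
qed

text \<open>The coefficients of \<open>e\<^sup>i\<^sup>N\<^sup>\<theta> z(\<theta>)\<^sup>* z(\<theta>)\<close>; the factor avoids negative powers.\<close>

definition star_square :: "(nat \<Rightarrow> 'a::cstar_algebra) \<Rightarrow> nat \<Rightarrow> nat \<Rightarrow> 'a" where
  "star_square z N n = (\<Sum>i\<le>N. \<Sum>j\<le>N. if N - i + j = n then star (z i) * z j else 0)"

lemma sum_star_square:
  fixes f :: "nat \<Rightarrow> 'a::cstar_algebra \<Rightarrow> 'a"
  assumes add: "\<And>n x y. f n (x + y) = f n x + f n y"
  shows "(\<Sum>n\<le>2 * N. f n (star_square z N n)) = (\<Sum>i\<le>N. \<Sum>j\<le>N. f (N - i + j) (star (z i) * z j))"
proof -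
  have f0: "f n 0 = 0" for n using add[of n 0 0] by (metis add_0 add_cancel_right_right)
  have fs: "f n (sum g A) = (\<Sum>i\<in>A. f n (g i))" for n g and A :: "nat set"
    by (induction A rule: infinite_finite_induct) (simp_all add: add f0)
  have "(\<Sum>n\<le>2 * N. f n (star_square z N n))
      = (\<Sum>n\<le>2 * N. \<Sum>i\<le>N. \<Sum>j\<le>N. if N - i + j = n then f n (star (z i) * z j) else 0)"
    unfolding star_square_def fs by (intro sum.cong refl) (auto simp: f0)
  also have "\<dots> = (\<Sum>i\<le>N. \<Sum>j\<le>N. \<Sum>n\<le>2 * N. if N - i + j = n then f n (star (z i) * z j) else 0)"
    by (subst sum.swap) (rule sum.cong[OF refl], rule sum.swap)
  also have "\<dots> = (\<Sum>i\<le>N. \<Sum>j\<le>N. f (N - i + j) (star (z i) * z j))"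
    by (intro sum.cong refl) (auto simp: sum.delta')
  finally show ?thesis .
qed

lemma trig_poly_star_square:
  "norm (trig_poly (star_square z N) (2 * N) \<theta>) = (norm (trig_poly z N \<theta>))\<^sup>2"
proof -
  have "trig_poly (star_square z N) (2 * N) \<theta>
      = (\<Sum>i\<le>N. \<Sum>j\<le>N. scaleC (cis (real (N - i + j) * \<theta>)) (star (z i) * z j))"
    unfolding trig_poly_def by (rule sum_star_square) (rule scaleC_add_right)
  also have "\<dots> = (\<Sum>i\<le>N. \<Sum>j\<le>N. scaleC (cis (real N * \<theta>))
      (star (scaleC (cis (real i * \<theta>)) (z i)) * scaleC (cis (real j * \<theta>)) (z j)))"
    by (intro sum.cong refl)
      (simp add: star_simps scaleC_mult_left scaleC_mult_right scaleC_scaleC cis_cnj cis_mult of_nat_diff algebra_simps)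
  also have "\<dots> = scaleC (cis (real N * \<theta>)) (star (trig_poly z N \<theta>) * trig_poly z N \<theta>)"
    by (simp add: trig_poly_def star_sum sum_product scaleC.sum_right)
  finally show ?thesis by (simp add: norm_scaleC cstar_identity)
qed

lemma unitary_poly_star_square:
  assumes w: "\<And>k::nat. quasi_unitary (w k)"
    and z: "\<And>n. n \<le> N \<Longrightarrow> (\<lambda>k. commutator (w k) (z n)) \<longlonglongrightarrow> 0"
  shows "(\<lambda>k. upow (w k) N (star (unitary_poly z N (w k)) * unitary_poly z N (w k))
      - unitary_poly (star_square z N) (2 * N) (w k)) \<longlonglongrightarrow> 0"
proof -
  have eq: "upow (w k) N (star (unitary_poly z N (w k)) * unitary_poly z N (w k))
      - unitary_poly (star_square z N) (2 * N) (w k)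
    = (\<Sum>i\<le>N. \<Sum>j\<le>N. upow (w k) N (star (upow (w k) i (z i)) * upow (w k) j (z j))
        - upow (w k) (N - i + j) (star (z i) * z j))" for k
  proof -
    have "unitary_poly (star_square z N) (2 * N) (w k)
        = (\<Sum>i\<le>N. \<Sum>j\<le>N. upow (w k) (N - i + j) (star (z i) * z j))"
      unfolding unitary_poly_def by (rule sum_star_square) (rule upow_add)
    then show ?thesis
      by (simp add: unitary_poly_def star_sum sum_product upow_sum sum_subtractf)
  qed
  show ?thesis unfolding eq
  proof (intro tendsto_null_sum)
    fix i j assume ij: "i \<in> {..N}" "j \<in> {..N}"
    have "(\<lambda>k. real (i + j) * (norm (commutator (w k) (z i)) * norm (z j))) \<longlonglongrightarrow> 0"
      using z[of i] ij by (intro tendsto_mult_right_zero tendsto_mult_left_zero tendsto_norm_zero) auto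
    then show "(\<lambda>k. upow (w k) N (star (upow (w k) i (z i)) * upow (w k) j (z j))
        - upow (w k) (N - i + j) (star (z i) * z j)) \<longlonglongrightarrow> 0"
      by (rule Lim_null_comparison[rotated])
        (use upow_sesquilinear[OF w] ij in \<open>auto intro!: always_eventually\<close>)
  qed
qed

lemma commutator_star_square:
  assumes w: "\<And>k::nat. quasi_unitary (w k)"
    and z: "\<And>n. n \<le> N \<Longrightarrow> (\<lambda>k. commutator (w k) (z n)) \<longlonglongrightarrow> 0"
  shows "(\<lambda>k. commutator (w k) (star_square z N n)) \<longlonglongrightarrow> 0"
proof -
  have prod: "(\<lambda>k. commutator (w k) (star (z i) * z j)) \<longlonglongrightarrow> 0" if "i \<le> N" "j \<le> N" for i j
  proof -
    have "commutator (w k) (star (z i) * z j)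
        = commutator (w k) (star (z i)) * z j + star (z i) * commutator (w k) (z j)" for k
      by (simp add: commutator_def algebra_simps)
    moreover have "(\<lambda>k. commutator (w k) (star (z i))) \<longlonglongrightarrow> 0"
      using z[OF that(1)] by (subst tendsto_norm_zero_iff[symmetric])
        (simp add: commutator_star[OF w] tendsto_norm_zero_iff)
    ultimately show ?thesis
      using z[OF that(2)] by (auto intro!: tendsto_add_zero tendsto_mult_left_zero tendsto_mult_right_zero)
  qed
  have "commutator (w k) (star_square z N n)
      = (\<Sum>i\<le>N. \<Sum>j\<le>N. if N - i + j = n then commutator (w k) (star (z i) * z j) else 0)" for k
    unfolding commutator_def star_square_def sum_distrib_left sum_distrib_right sum_subtractf[symmetric]
    by (intro sum.cong refl) auto
  moreover have "(\<lambda>k. if N - i + j = n then commutator (w k) (star (z i) * z j) else 0) \<longlonglongrightarrow> 0"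
    if "i \<le> N" "j \<le> N" for i j
    using prod[OF that] by (cases "N - i + j = n") simp_all
  ultimately show ?thesis by (simp only:) (intro tendsto_null_sum, simp)
qed

text \<open>By repeated use of the C*-identity the \<open>2\<^sup>m\<close>-th power of the norm of \<open>z(U)\<close> is asymptotically the
  norm of a polynomial of degree \<open>2\<^sup>m N\<close> with supremum norm at most \<open>M\<close> to the power \<open>2\<^sup>m\<close>. That norm is at most the sum of
  the norms of the coefficients, each of which is bounded by the supremum norm. As the number of coefficients
  grows only linearly with the degree, the \<open>2\<^sup>m\<close>-th root of this bound tends to \<open>M\<close>.\<close>

lemma unitary_poly_power_bound:
  assumes w: "\<And>k::nat. quasi_unitary (w k)"
    and z: "\<And>n. n \<le> N \<Longrightarrow> (\<lambda>k. commutator (w k) (z n)) \<longlonglongrightarrow> 0"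
    and M: "\<And>\<theta>. norm (trig_poly z N \<theta>) \<le> M" and r: "r > 0"
    and b: "real (2 ^ m * N + 1) * M ^ (2 ^ m) < r ^ (2 ^ m)"
  shows "eventually (\<lambda>k. norm (unitary_poly z N (w k)) < r) sequentially"
  using z M r b
proof (induction m arbitrary: N z M r)
  case 0
  have "norm (unitary_poly z N (w k)) \<le> (\<Sum>n\<le>N. M)" for k
    unfolding unitary_poly_def
    by (rule sum_norm_le) (use fourier_coefficient_bound[OF 0(2)] in \<open>simp add: upow_norm[OF w]\<close>)
  also have "(\<Sum>n\<le>N. M) < r" using 0(4) by simp
  finally show ?case by simp
next
  case (Suc m)
  let ?c = "star_square z N" and ?Z = "\<lambda>k. unitary_poly z N (w k)"
  have M0: "M \<ge> 0" using Suc.prems(2)[of 0] norm_ge_zero order_trans by blast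
  \<comment> \<open>The hypothesis for \<open>Suc m\<close> and \<open>z\<close> is that for \<open>m\<close> and the square of \<open>z\<close>; the bound \<open>s\<close> leaves
    room for the error of passing from \<open>z(U)\<^sup>* z(U)\<close> to that square at \<open>U\<close>.\<close>
  define B where "B = real (2 ^ m * (2 * N) + 1) * (M\<^sup>2) ^ (2 ^ m)"
  have B: "0 \<le> B" "B < (r\<^sup>2) ^ (2 ^ m)"
    using Suc.prems(4) M0 by (auto simp: B_def power_mult[symmetric] mult_ac)
  obtain t where t: "B < t" "t < (r\<^sup>2) ^ (2 ^ m)" using B dense by blast
  define s where "s = root (2 ^ m) t"
  have s: "s > 0" "s ^ (2 ^ m) = t" using t B by (auto simp: s_def)
  have "s < r\<^sup>2" using t s by (intro power_less_imp_less_base[of s "2 ^ m"]) auto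
  have bound: "eventually (\<lambda>k. norm (unitary_poly ?c (2 * N) (w k)) < s) sequentially"
  proof (rule Suc.IH)
    show "(\<lambda>k. commutator (w k) (?c n)) \<longlonglongrightarrow> 0" for n
      by (rule commutator_star_square[OF w Suc.prems(1)])
    show "norm (trig_poly ?c (2 * N) \<theta>) \<le> M\<^sup>2" for \<theta>
      unfolding trig_poly_star_square using Suc.prems(2) by (intro power_mono) auto
    show "real (2 ^ m * (2 * N) + 1) * (M\<^sup>2) ^ 2 ^ m < s ^ 2 ^ m"
      using t s unfolding B_def by simp
  qed (rule s)
  have lim: "(\<lambda>k. upow (w k) N (star (?Z k) * ?Z k) - unitary_poly ?c (2 * N) (w k)) \<longlonglongrightarrow> 0"
    by (rule unitary_poly_star_square[OF w]) (rule Suc.prems(1))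
  have "eventually (\<lambda>k. norm (upow (w k) N (star (?Z k) * ?Z k)
      - unitary_poly ?c (2 * N) (w k)) < r\<^sup>2 - s) sequentially"
    by (rule order_tendstoD(2)[OF tendsto_norm_zero[OF lim]]) (use \<open>s < r\<^sup>2\<close> in simp)
  with bound show ?case
  proof eventually_elim
    case (elim k)
    have "(norm (?Z k))\<^sup>2 = norm (upow (w k) N (star (?Z k) * ?Z k))"
      by (simp add: upow_norm[OF w] cstar_identity)
    also have "\<dots> \<le> norm (upow (w k) N (star (?Z k) * ?Z k) - unitary_poly ?c (2 * N) (w k))
        + norm (unitary_poly ?c (2 * N) (w k))"
      using norm_triangle_ineq[of "upow (w k) N (star (?Z k) * ?Z k) - unitary_poly ?c (2 * N) (w k)"
          "unitary_poly ?c (2 * N) (w k)"] by simp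
    also have "\<dots> < r\<^sup>2" using elim by linarith
    finally show "norm (?Z k) < r" using Suc.prems(3) by (simp add: power_less_imp_less_base)
  qed
qed

proposition unitary_poly_bound:
  assumes w: "\<And>k::nat. quasi_unitary (w k)"
    and z: "\<And>n. n \<le> N \<Longrightarrow> (\<lambda>k. commutator (w k) (z n)) \<longlonglongrightarrow> 0"
    and M: "\<And>\<theta>. norm (trig_poly z N \<theta>) \<le> M" and r: "M < r"
  shows "eventually (\<lambda>k. norm (unitary_poly z N (w k)) < r) sequentially"
proof -
  have M0: "M \<ge> 0" using M[of 0] norm_ge_zero order_trans by blast
  have "\<exists>m. real (2 ^ m * N + 1) * M ^ (2 ^ m) < r ^ (2 ^ m)"
  proof (cases "M = 0")
    case True
    then show ?thesis using r by (intro exI[of _ 0]) simp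
  next
    case False
    define x where "x = M / r"
    have x: "0 < x" "x < 1" using M0 False r by (auto simp: x_def)
    have "(\<lambda>n. real N * (real n * x ^ n) + x ^ n) \<longlonglongrightarrow> real N * 0 + 0"
      using x by (intro tendsto_intros powser_times_n_limit_0 LIMSEQ_power_zero) auto
    then have "eventually (\<lambda>n. real N * (real n * x ^ n) + x ^ n < 1) sequentially"
      by (intro order_tendstoD(2)) auto
    then obtain n0 where n0: "\<And>n. n \<ge> n0 \<Longrightarrow> real N * (real n * x ^ n) + x ^ n < 1"
      unfolding eventually_sequentially by blast
    have "(2::nat) ^ n0 \<ge> n0" using less_exp[of n0] by simp
    then have "real N * (real (2 ^ n0) * x ^ (2 ^ n0)) + x ^ (2 ^ n0) < 1" by (rule n0)
    then have "real (2 ^ n0 * N + 1) * x ^ (2 ^ n0) < 1" by (simp add: algebra_simps)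
    then have "real (2 ^ n0 * N + 1) * M ^ (2 ^ n0) < r ^ (2 ^ n0)"
      using r M0 by (simp add: x_def power_divide divide_simps)
    then show ?thesis ..
  qed
  then obtain m where "real (2 ^ m * N + 1) * M ^ (2 ^ m) < r ^ (2 ^ m)" ..
  with unitary_poly_power_bound[OF w z M] M0 r show ?thesis by simp
qed

section \<open>The norm modulo an ideal\<close>

lemma infdist_less_witness:
  assumes "closed_ideal I" "infdist x I < r"
  obtains i where "i \<in> I" "norm (x - i) < r"
proof -
  have ne: "I \<noteq> {}" using closed_idealD(1)[OF assms(1)] by auto
  have "(INF a\<in>I. dist x a) < r" using assms(2) ne by (simp add: infdist_notempty)
  then obtain i where "i \<in> I" "dist x i < r"
    using ne by (subst (asm) cINF_less_iff) auto
  then show thesis using that by (auto simp: dist_norm)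
qed

lemma infdist_ideal_le: "i \<in> I \<Longrightarrow> infdist x I \<le> norm (x - i)"
  using infdist_le[of i I x] by (simp add: dist_norm)

lemma infdist_ideal_le_norm: "closed_ideal I \<Longrightarrow> infdist x I \<le> norm x"
  using infdist_ideal_le[of 0 I x] closed_idealD(1) by auto

lemma infdist_ideal_triangle:
  assumes "closed_ideal I" shows "infdist (x + y) I \<le> infdist x I + infdist y I"
proof (rule field_le_epsilon)
  fix e :: real assume "e > 0"
  then have "infdist x I < infdist x I + e / 2" "infdist y I < infdist y I + e / 2" by auto
  then obtain i j where "i \<in> I" "norm (x - i) < infdist x I + e / 2" "j \<in> I" "norm (y - j) < infdist y I + e / 2"
    using infdist_less_witness[OF assms] by metis
  moreover have "norm (x + y - (i + j)) \<le> norm (x - i) + norm (y - j)"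
    using norm_triangle_ineq[of "x - i" "y - j"] by (simp add: algebra_simps)
  ultimately show "infdist (x + y) I \<le> infdist x I + infdist y I + e"
    using infdist_ideal_le[of "i + j" I "x + y"] closed_idealD(2)[OF assms, of i j] by linarith
qed

lemma infdist_ideal_cong:
  assumes "closed_ideal I" "x - y \<in> I" shows "infdist x I = infdist y I"
proof -
  have "infdist x I \<le> infdist y I" if "x - y \<in> I" for x y
    using infdist_ideal_triangle[OF assms(1), of y "x - y"] infdist_zero[OF that] by simp
  moreover have "y - x \<in> I" using closed_ideal_minus[OF assms] by simp
  ultimately show ?thesis using assms(2) by (intro antisym)
qed

lemma infdist_ideal_scaleC_le: "closed_ideal I \<Longrightarrow> infdist (scaleC c x) I \<le> cmod c * infdist x I"
proof (rule field_le_epsilon)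
  fix e :: real assume I: "closed_ideal I" and "e > 0"
  then have "e / (cmod c + 1) > 0" by (simp add: add_nonneg_pos)
  then obtain i where i: "i \<in> I" "norm (x - i) < infdist x I + e / (cmod c + 1)"
    using infdist_less_witness[OF I, of x "infdist x I + e / (cmod c + 1)"] by auto
  have "infdist (scaleC c x) I \<le> norm (scaleC c x - scaleC c i)"
    using closed_idealD(3)[OF I i(1)] by (intro infdist_ideal_le)
  also have "\<dots> = cmod c * norm (x - i)" by (simp add: scaleC.diff_right[symmetric] norm_scaleC)
  also have "\<dots> \<le> cmod c * (infdist x I + e / (cmod c + 1))"
    using i by (intro mult_left_mono) auto
  also have "\<dots> \<le> cmod c * infdist x I + e"
  proof -
    have "cmod c + 1 > 0" by (simp add: add_nonneg_pos)
    then have "cmod c * (e / (cmod c + 1)) \<le> (cmod c + 1) * (e / (cmod c + 1))"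
      using \<open>e > 0\<close> by (intro mult_right_mono) auto
    also have "\<dots> = e" using \<open>cmod c + 1 > 0\<close> by simp
    finally have "cmod c * (e / (cmod c + 1)) \<le> e" .
    then show ?thesis by (simp add: distrib_left)
  qed
  finally show "infdist (scaleC c x) I \<le> cmod c * infdist x I + e" .
qed

lemma infdist_ideal_minus: "closed_ideal I \<Longrightarrow> infdist (- x) I = infdist x I"
  using infdist_ideal_scaleC_le[of I "-1" x] infdist_ideal_scaleC_le[of I "-1" "- x"]
  by (simp add: scaleC.minus_left)

lemma infdist_ideal_star_le: "closed_ideal I \<Longrightarrow> infdist (star x) I \<le> infdist x I"
proof (rule field_le_epsilon)
  fix e :: real assume I: "closed_ideal I" and "e > 0"
  then obtain i where i: "i \<in> I" "norm (x - i) < infdist x I + e"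
    using infdist_less_witness[OF I, of x "infdist x I + e"] by auto
  have "infdist (star x) I \<le> norm (star x - star i)"
    using closed_ideal_star[OF I i(1)] by (intro infdist_ideal_le)
  also have "\<dots> = norm (x - i)" by (simp add: star_diff[symmetric])
  finally show "infdist (star x) I \<le> infdist x I + e" using i by simp
qed

lemma infdist_ideal_star: "closed_ideal I \<Longrightarrow> infdist (star x) I = infdist x I"
  using infdist_ideal_star_le[of I x] infdist_ideal_star_le[of I "star x"] by (simp add: star_star)

lemma infdist_ideal_mult: "closed_ideal I \<Longrightarrow> infdist (x * y) I \<le> infdist x I * infdist y I"
proof (rule ccontr)
  assume I: "closed_ideal I" and "\<not> infdist (x * y) I \<le> infdist x I * infdist y I"
  then have less: "infdist x I * infdist y I < infdist (x * y) I" by simp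
  have "((\<lambda>e. (infdist x I + e) * (infdist y I + e)) \<longlongrightarrow> (infdist x I + 0) * (infdist y I + 0)) (at_right 0)"
    by (intro tendsto_intros)
  then have "eventually (\<lambda>e. (infdist x I + e) * (infdist y I + e) < infdist (x * y) I) (at_right 0)"
    using less by (intro order_tendstoD(2)) auto
  then have "eventually (\<lambda>e. e > 0 \<and> (infdist x I + e) * (infdist y I + e) < infdist (x * y) I) (at_right 0)"
    by (intro eventually_conj eventually_at_right_less)
  from eventually_happens'[OF _ this]
  obtain e where e: "e > 0" "(infdist x I + e) * (infdist y I + e) < infdist (x * y) I" by auto
  obtain i where i: "i \<in> I" "norm (x - i) < infdist x I + e"
    using infdist_less_witness[OF I, of x "infdist x I + e"] e by auto
  obtain j where j: "j \<in> I" "norm (y - j) < infdist y I + e"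
    using infdist_less_witness[OF I, of y "infdist y I + e"] e by auto
  have "x * j + i * (y - j) \<in> I"
    using i j closed_idealD[OF I] by auto
  then have "infdist (x * y) I \<le> norm (x * y - (x * j + i * (y - j)))" by (rule infdist_ideal_le)
  also have "x * y - (x * j + i * (y - j)) = (x - i) * (y - j)" by (simp add: algebra_simps)
  also have "norm \<dots> \<le> norm (x - i) * norm (y - j)" by (rule norm_mult_ineq)
  also have "\<dots> \<le> (infdist x I + e) * (infdist y I + e)"
    using i j e infdist_nonneg[of x I] by (intro mult_mono) auto
  finally show False using e by simp
qed

text \<open>If \<open>i\<close> in the ideal nearly attains the norm of \<open>x\<^sup>* x\<close> modulo the ideal, and \<open>f\<close> is an
  approximate unit for \<open>i\<close>, then \<open>\<parallel>x (1 - f)\<parallel>\<^sup>2 \<le> \<parallel>x\<^sup>* x (1 - f)\<parallel>\<close> is close to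
  \<open>\<parallel>(x\<^sup>* x - i) (1 - f)\<parallel>\<close>.\<close>

lemma infdist_ideal_cstar: "closed_ideal I \<Longrightarrow> infdist (star x * x) I = (infdist x I)\<^sup>2"
proof (rule antisym)
  assume I: "closed_ideal I"
  show "infdist (star x * x) I \<le> (infdist x I)\<^sup>2"
    using infdist_ideal_mult[OF I, of "star x" x] infdist_ideal_star[OF I, of x]
    by (simp add: power2_eq_square)
  show "(infdist x I)\<^sup>2 \<le> infdist (star x * x) I"
  proof (rule field_le_epsilon)
    fix e :: real assume e: "e > 0"
    obtain i where i: "i \<in> I" "norm (star x * x - i) < infdist (star x * x) I + e / 2"
      using infdist_less_witness[OF I, of "star x * x" "infdist (star x * x) I + e / 2"] e by auto
    obtain f where f: "f \<in> I" "contracting f" "norm (i - i * f) \<le> e / 2"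
      using approximate_unit_right[OF I _ half_gt_zero[OF e], of i] i by auto
    let ?h = "star x * x"
    have "infdist x I \<le> norm (x - x * f)"
      using closed_idealD(4)[OF I f(1)] by (intro infdist_ideal_le)
    then have "(infdist x I)\<^sup>2 \<le> (norm (x - x * f))\<^sup>2" by (intro power_mono infdist_nonneg)
    also have "\<dots> = norm ((?h - ?h * f) - star f * (?h - ?h * f))"
      unfolding cstar_identity[symmetric] by (simp add: star_simps algebra_simps)
    also have "\<dots> \<le> norm (?h - ?h * f)" by (rule contractingD[OF contracting_star[OF f(2)]])
    also have "\<dots> = norm (((?h - i) - (?h - i) * f) + (i - i * f))" by (simp add: algebra_simps)
    also have "\<dots> \<le> norm ((?h - i) - (?h - i) * f) + norm (i - i * f)" by (rule norm_triangle_ineq)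
    also have "\<dots> \<le> norm (?h - i) + e / 2" by (intro add_mono contractingD f)
    also have "\<dots> \<le> infdist ?h I + e" using i by simp
    finally show "(infdist x I)\<^sup>2 \<le> infdist ?h I + e" .
  qed
qed

section \<open>Quasi-central elements that interpolate contractively\<close>

text \<open>With \<open>U = 1 + w\<close> the element \<open>e = (2 - U - U\<^sup>*) / 4\<close> corresponds to the function
  \<open>s = (1 - cos \<theta>) / 2\<close> on the circle. It vanishes at \<open>U = 1\<close>, the value modulo the ideal, and is
  one at \<open>U = -1\<close>, the value on the ideal.\<close>

definition cut_off :: "'a::cstar_algebra \<Rightarrow> 'a" where
  "cut_off w = - ((1 / 4) *\<^sub>R (w + star w))"

lemma cut_off_norm:
  assumes w: "quasi_unitary w"
  shows "norm (cut_off w * x) \<le> norm x" "norm (x - cut_off w * x) \<le> norm x" "norm (x * cut_off w) \<le> norm x"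
proof -
  have sw: "quasi_unitary (star w)" by (rule quasi_unitary_star[OF w])
  have four: "4 *\<^sub>R x = x + x + x + x" for x :: 'a
    by (metis scaleR_2 scaleR_scaleR mult_2 numeral_Bit0 add.assoc scaleR_left_distrib)
  have "4 *\<^sub>R (cut_off w * x) = (x - (x + w * x)) + (x - (x + star w * x))"
    by (simp add: cut_off_def algebra_simps)
  then have "4 * norm (cut_off w * x) = norm ((x - (x + w * x)) + (x - (x + star w * x)))"
    by (metis norm_scaleR abs_numeral)
  also have "\<dots> \<le> (norm x + norm (x + w * x)) + (norm x + norm (x + star w * x))"
    by (intro norm_triangle_le add_mono norm_triangle_ineq4)
  finally show "norm (cut_off w * x) \<le> norm x" by (simp add: quasi_unitary_norm w sw)
  have "4 *\<^sub>R (x * cut_off w) = (x - (x + x * w)) + (x - (x + x * star w))"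
    by (simp add: cut_off_def algebra_simps)
  then have "4 * norm (x * cut_off w) = norm ((x - (x + x * w)) + (x - (x + x * star w)))"
    by (metis norm_scaleR abs_numeral)
  also have "\<dots> \<le> (norm x + norm (x + x * w)) + (norm x + norm (x + x * star w))"
    by (intro norm_triangle_le add_mono norm_triangle_ineq4)
  finally show "norm (x * cut_off w) \<le> norm x" by (simp add: quasi_unitary_norm w sw)
  have "4 *\<^sub>R (x - cut_off w * x) = (x + (x + w * x)) + (x + (x + star w * x))"
    by (simp add: cut_off_def four scaleR_diff_right algebra_simps)
  then have "4 * norm (x - cut_off w * x) = norm ((x + (x + w * x)) + (x + (x + star w * x)))"
    by (metis norm_scaleR abs_numeral)
  also have "\<dots> \<le> (norm x + norm (x + w * x)) + (norm x + norm (x + star w * x))"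
    by (intro norm_triangle_le add_mono norm_triangle_ineq order_refl)
  finally show "norm (x - cut_off w * x) \<le> norm x" by (simp add: quasi_unitary_norm w sw)
qed

lemma cut_off_commutator: 
  assumes w: "quasi_unitary w" shows "norm (commutator (cut_off w) a) \<le> norm (commutator w a)"
proof -
  have "norm (commutator (star w) a) = norm (commutator w a)"
    using commutator_star[OF quasi_unitary_star[OF w], of "star a"]
      norm_star[of "commutator w a"]
    by (simp add: star_star commutator_def star_simps norm_minus_commute)
  moreover have "commutator (cut_off w) a = - ((1 / 4) *\<^sub>R (commutator w a + commutator (star w) a))"
    by (simp add: commutator_def cut_off_def algebra_simps)
  ultimately have "norm (commutator (cut_off w) a) \<le> (1 / 4) * (norm (commutator w a) + norm (commutator w a))"
    using norm_triangle_ineq[of "commutator w a" "commutator (star w) a"] by simp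
  also have "\<dots> = (1 / 2) * norm (commutator w a)" by simp
  also have "\<dots> \<le> 1 * norm (commutator w a)" by (intro mult_right_mono) auto
  finally show ?thesis by simp
qed

text \<open>\<open>1 - e = (2 + U + U\<^sup>*) / 4\<close> is small on \<open>x\<close> where \<open>U x\<close> is close to \<open>- x\<close>.\<close>

lemma cut_off_annihilates:
  assumes w: "quasi_unitary w"
  shows "norm (x - cut_off w * x) \<le> norm (2 *\<^sub>R x + w * x)"
proof -
  let ?d = "2 *\<^sub>R x + w * x"
  have "star w * w = - w - star w"
    using w by (auto simp: quasi_unitary_def eq_neg_iff_add_eq_0 algebra_simps)
  from arg_cong[OF this, of "\<lambda>y. y * x"] have "star w * (w * x) = - w * x - star w * x"
    by (simp add: algebra_simps)
  then have "?d + star w * ?d = 2 *\<^sub>R x + star w * x"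
    by (simp add: algebra_simps scaleR_2)
  then have n: "norm (2 *\<^sub>R x + star w * x) = norm ?d"
    by (metis quasi_unitary_norm(1)[OF quasi_unitary_star[OF w]])
  have "x = (1 / 4) *\<^sub>R (2 *\<^sub>R x + 2 *\<^sub>R x)" by (simp flip: scaleR_left_distrib)
  then have "x - cut_off w * x = (1 / 4) *\<^sub>R (2 *\<^sub>R x + 2 *\<^sub>R x) - cut_off w * x" by (simp only:)
  also have "\<dots> = (1 / 4) *\<^sub>R (?d + (2 *\<^sub>R x + star w * x))"
    by (simp add: cut_off_def algebra_simps)
  finally have "norm (x - cut_off w * x) \<le> (1 / 4) * (norm ?d + norm ?d)"
    using norm_triangle_ineq[of ?d "2 *\<^sub>R x + star w * x"] n by simp
  also have "\<dots> = (1 / 2) * norm ?d" by simp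
  also have "\<dots> \<le> 1 * norm ?d" by (intro mult_right_mono) auto
  finally show ?thesis by simp
qed

text \<open>The coefficients of \<open>e\<^sup>2\<^sup>i\<^sup>\<theta> (s y + (1 - s) x + s (1 - s) v)\<close>.\<close>

definition interpolation_coeff :: "'a::cstar_algebra \<Rightarrow> 'a \<Rightarrow> 'a \<Rightarrow> nat \<Rightarrow> 'a" where
  "interpolation_coeff y x v n =
    (if n = 0 \<or> n = 4 then - ((1 / 16) *\<^sub>R v)
     else if n = 1 \<or> n = 3 then (1 / 4) *\<^sub>R (x - y)
     else (1 / 2) *\<^sub>R (x + y) + (1 / 8) *\<^sub>R v)"

lemma sum_atMost_4: "(\<Sum>n\<le>4. f n) = f 0 + f 1 + f 2 + f 3 + f (4::nat)"
  by (simp add: eval_nat_numeral)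

text \<open>Since \<open>0 \<le> s \<le> 1\<close>, the value at each angle is bounded by a convex combination.\<close>

lemma interpolation_trig_poly:
  "norm (trig_poly (interpolation_coeff y x v) 4 \<theta>) \<le> max (norm y) (norm x + norm v)"
proof -
  define s where "s = (1 - cos \<theta>) / 2"
  have s: "0 \<le> s" "s \<le> 1" using cos_ge_minus_one[of \<theta>] cos_le_one[of \<theta>] by (auto simp: s_def)
  define c where "c = cis \<theta>"
  have "c\<^sup>2 + 1 = 2 * of_real (cos \<theta>) * c"
    using sin_cos_squared_add2[of \<theta>]
    by (simp add: c_def complex_eq_iff power2_eq_square algebra_simps)
  then have c: "of_real s * c = c / 2 - (c\<^sup>2 + 1) / 4"
    by (simp add: s_def field_simps)
  have pw: "cis (real n * \<theta>) = c ^ n" for n by (simp add: c_def Complex.DeMoivre)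
  have q: "(1 / 16) *\<^sub>R z = scaleC (1 / 16) z" "(1 / 8) *\<^sub>R z = scaleC (1 / 8) z"
      "(1 / 4) *\<^sub>R z = scaleC (1 / 4) z" "(1 / 2) *\<^sub>R z = scaleC (1 / 2) z" for z :: 'a
    using scaleC_of_real[of "1 / 16" z] scaleC_of_real[of "1 / 8" z]
      scaleC_of_real[of "1 / 4" z] scaleC_of_real[of "1 / 2" z] by simp_all
  have "trig_poly (interpolation_coeff y x v) 4 \<theta> = scaleC (- (c / 4) + c\<^sup>2 / 2 - c ^ 3 / 4) y
      + scaleC (c / 4 + c\<^sup>2 / 2 + c ^ 3 / 4) x + scaleC (- (1 / 16) + c\<^sup>2 / 8 - c ^ 4 / 16) v"
    by (simp add: trig_poly_def sum_atMost_4 pw interpolation_coeff_def q scaleC_scaleC scaleC.add_left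
        scaleC.diff_left scaleC.add_right scaleC.diff_right scaleC.minus_left scaleC.minus_right)
  also have "- (c / 4) + c\<^sup>2 / 2 - c ^ 3 / 4 = c\<^sup>2 * of_real s"
  proof -
    have "c\<^sup>2 * of_real s = c * (of_real s * c)" by (simp add: power2_eq_square mult_ac)
    also have "\<dots> = c * (c / 2 - (c\<^sup>2 + 1) / 4)" by (simp only: c)
    also have "\<dots> = - (c / 4) + c\<^sup>2 / 2 - c ^ 3 / 4" by (simp add: field_simps power2_eq_square power3_eq_cube)
    finally show ?thesis by (rule sym)
  qed
  also have "c / 4 + c\<^sup>2 / 2 + c ^ 3 / 4 = c\<^sup>2 * of_real (1 - s)"
  proof -
    have "c\<^sup>2 * of_real (1 - s) = c\<^sup>2 - c * (of_real s * c)" by (simp add: power2_eq_square algebra_simps)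
    also have "\<dots> = c\<^sup>2 - c * (c / 2 - (c\<^sup>2 + 1) / 4)" by (simp only: c)
    also have "\<dots> = c / 4 + c\<^sup>2 / 2 + c ^ 3 / 4" by (simp add: field_simps power2_eq_square power3_eq_cube)
    finally show ?thesis by (rule sym)
  qed
  also have "- (1 / 16) + c\<^sup>2 / 8 - c ^ 4 / 16 = c\<^sup>2 * of_real (s * (1 - s))"
  proof -
    have "c\<^sup>2 * of_real (s * (1 - s)) = c * (of_real s * c) - (of_real s * c)\<^sup>2"
      by (simp add: power2_eq_square algebra_simps)
    also have "\<dots> = c * (c / 2 - (c\<^sup>2 + 1) / 4) - (c / 2 - (c\<^sup>2 + 1) / 4)\<^sup>2" by (simp only: c)
    also have "\<dots> = - (1 / 16) + c\<^sup>2 / 8 - c ^ 4 / 16" by (simp add: field_simps power2_eq_square power3_eq_cube power4_eq_xxxx)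
    finally show ?thesis by (rule sym)
  qed
  also have "scaleC (c\<^sup>2 * of_real s) y + scaleC (c\<^sup>2 * of_real (1 - s)) x + scaleC (c\<^sup>2 * of_real (s * (1 - s))) v
      = scaleC (c\<^sup>2) (s *\<^sub>R y + (1 - s) *\<^sub>R x + (s * (1 - s)) *\<^sub>R v)"
    by (simp only: scaleC_of_real[symmetric] scaleC_scaleC[symmetric] scaleC_add_right)
  finally have "norm (trig_poly (interpolation_coeff y x v) 4 \<theta>)
      = norm (s *\<^sub>R y + (1 - s) *\<^sub>R x + (s * (1 - s)) *\<^sub>R v)"
    by (simp add: norm_scaleC c_def norm_power)
  also have "\<dots> \<le> s * norm y + (1 - s) * norm x + (s * (1 - s)) * norm v"
    using s by (intro norm_triangle_le add_mono) auto
  also have "(s * (1 - s)) * norm v \<le> (1 - s) * norm v"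
    using s by (intro mult_right_mono mult_left_le_one_le) auto
  also have "s * norm y + (1 - s) * norm x + (1 - s) * norm v
      = s * norm y + (1 - s) * (norm x + norm v)" by (simp add: algebra_simps)
  also have "\<dots> \<le> s * max (norm y) (norm x + norm v) + (1 - s) * max (norm y) (norm x + norm v)"
    using s by (intro add_mono mult_left_mono) auto
  finally show ?thesis by (simp add: algebra_simps)
qed

lemma upow_cut_off:
  assumes w: "quasi_unitary w"
  shows "cut_off w * x + w * (cut_off w * x) = - ((1 / 4) *\<^sub>R (w * (w * x)))"
proof -
  have "w * star w = - w - star w"
    using w by (auto simp: quasi_unitary_def eq_neg_iff_add_eq_0 algebra_simps)
  from arg_cong[OF this, of "\<lambda>y. y * x"] have "w * (star w * x) = - w * x - star w * x"
    by (simp add: algebra_simps)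
  note eq = this
  have "cut_off w * x + w * (cut_off w * x)
      = - ((1 / 4) *\<^sub>R (w * x + star w * x + (w * (w * x) + w * (star w * x))))"
    by (simp add: cut_off_def algebra_simps)
  also have "\<dots> = - ((1 / 4) *\<^sub>R (w * (w * x)))" unfolding eq by simp
  finally show ?thesis .
qed

text \<open>The factor \<open>U\<^sup>2\<close> clears the negative powers of \<open>U\<close>, and does not change the norm.\<close>

lemma interpolation_unitary_poly:
  assumes w: "quasi_unitary w"
  shows "unitary_poly (interpolation_coeff y x v) 4 w
    = upow w 2 (cut_off w * y + (x - cut_off w * x) + (cut_off w * v - cut_off w * (cut_off w * v)))"
proof -
  let ?E = "\<lambda>x. cut_off w * x"
  \<comment> \<open>In terms of \<open>U\<close> these are \<open>- 4 U\<^sup>2 e x\<close> and \<open>- 16 U\<^sup>2 e (1 - e) x\<close>.\<close>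
  define D where "D x = upow w 1 x + upow w 3 x - 2 *\<^sub>R upow w 2 x" for x
  define Q where "Q x = x + upow w 4 x - 2 *\<^sub>R upow w 2 x" for x
  have u1: "upow w 1 x = x + w * x" for x by (simp add: upow_def)
  have u2: "upow w 2 x = x + w * x + w * (x + w * x)" for x
    using upow_Suc[of w 1 x] unfolding u1 Suc_1 .
  have u3: "upow w 3 x = upow w 2 x + w * upow w 2 x" for x using upow_Suc[of w 2 x] by simp
  have u4: "upow w 4 x = upow w 3 x + w * upow w 3 x" for x using upow_Suc[of w 3 x] by simp
  note u = u1 u2 u3 u4
  have D: "D x = w * (w * x) + w * (w * (w * x))" for x
    unfolding D_def u by (simp add: algebra_simps scaleR_2)
  have Q: "Q x = D x + D x + (D x + D x) + w * (w * (w * (w * x)))" for x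
    unfolding D_def Q_def u by (simp add: algebra_simps scaleR_2)
  have half: "upow w 2 x = (1 / 2) *\<^sub>R upow w 2 x + (1 / 2) *\<^sub>R upow w 2 x"
    by (simp only: scaleR_left_distrib[symmetric]) simp
  have "unitary_poly (interpolation_coeff y x v) 4 w
      = upow w 2 x + (1 / 4) *\<^sub>R D x - (1 / 4) *\<^sub>R D y - (1 / 16) *\<^sub>R Q v"
    by (subst half) (simp add: unitary_poly_def sum_atMost_4 interpolation_coeff_def D_def Q_def upow_add upow_diff
        upow_scaleR scaleR_add_right scaleR_diff_right upow_minus)
  moreover have E2: "upow w 2 (?E x) = - ((1 / 4) *\<^sub>R D x)" for x
  proof -
    have "upow w 2 (?E x) = upow w 1 (?E x + w * ?E x)" by (simp only: u1 u2)
    also have "\<dots> = - ((1 / 4) *\<^sub>R (w * (w * x) + w * (w * (w * x))))"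
      unfolding upow_cut_off[OF w] u1 by (simp add: scaleR_add_right)
    finally show ?thesis by (simp add: D)
  qed
  moreover have "upow w 2 (?E (?E v)) = (1 / 16) *\<^sub>R (w * (w * (w * (w * v))))"
  proof -
    have "D (?E v) = w * (w * (?E v + w * ?E v))" by (simp add: D algebra_simps)
    also have "\<dots> = - ((1 / 4) *\<^sub>R (w * (w * (w * (w * v)))))"
      unfolding upow_cut_off[OF w] by simp
    finally show ?thesis by (simp add: E2)
  qed
  moreover have "(1 / 16) *\<^sub>R Q v = (1 / 4) *\<^sub>R D v + (1 / 16) *\<^sub>R (w * (w * (w * (w * v))))"
  proof -
    have "D v + D v + (D v + D v) = 4 *\<^sub>R D v"
      by (simp only: scaleR_2[symmetric] scaleR_left_distrib[symmetric]) simp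
    then have "Q v = 4 *\<^sub>R D v + w * (w * (w * (w * v)))" unfolding Q by (simp only:)
    then show ?thesis by (simp add: scaleR_add_right)
  qed
  ultimately show ?thesis by (simp add: upow_add upow_diff)
qed

lemma norm_add_add_le: "norm (a + (b + c)) \<le> norm a + (norm b + norm (c::'a::real_normed_vector))"
  using norm_triangle_ineq[of a "b + c"] norm_triangle_ineq[of b c] by simp

text \<open>An element of the ideal that interpolates contractively: it is almost central, and
  \<open>e y + (1 - e) x + e (1 - e) v\<close> is bounded by a maximum, not by a sum, in which \<open>x\<close> and \<open>v\<close> count
  only modulo the ideal. A sum would accumulate in a long iteration.\<close>

definition interpolating :: "'a::cstar_algebra set \<Rightarrow> 'a set \<Rightarrow> real \<Rightarrow> 'a \<Rightarrow> bool" where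
  "interpolating I C \<delta> e \<longleftrightarrow> e \<in> I \<and> star e = e
    \<and> (\<forall>x. norm (e * x) \<le> norm x \<and> norm (x - e * x) \<le> norm x \<and> norm (x * e) \<le> norm x)
    \<and> (\<forall>y\<in>C. norm (commutator e y) \<le> \<delta>)
    \<and> (\<forall>y\<in>C. \<forall>x\<in>C. \<forall>v\<in>C. norm (e * y + (x - e * x) + (e * v - e * (e * v)))
          \<le> max (norm y) (infdist x I + infdist v I) + \<delta>)"

lemma interpolating_finite:
  assumes I: "closed_ideal I" and C: "finite C" and d: "\<delta> > 0"
  shows "\<exists>e. interpolating I C \<delta> e"
proof -
  \<comment> \<open>The representative \<open>x - p x\<close> nearly attains the norm of \<open>x\<close> modulo the ideal. The estimate is
    proved for such representatives; \<open>1 - e\<close> is small on the elements \<open>p x\<close>.\<close>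
  have "\<exists>i. i \<in> I \<and> norm (x - i) < infdist x I + \<delta> / 8" for x
    using infdist_less_witness[OF I, of x "infdist x I + \<delta> / 8"] d by auto
  then obtain p where p: "p x \<in> I" "norm (x - p x) < infdist x I + \<delta> / 8" for x by metis
  have fin: "finite (p ` C)" "p ` C \<subseteq> I" "finite (C \<union> p ` C)" using C p by auto
  obtain w where w: "\<And>k::nat. w k \<in> I" "\<And>k. quasi_unitary (w k)"
      "\<And>x. x \<in> p ` C \<Longrightarrow> (\<lambda>k. 2 *\<^sub>R x + w k * x) \<longlonglongrightarrow> 0"
      "\<And>a. a \<in> C \<union> p ` C \<Longrightarrow> (\<lambda>k. commutator (w k) a) \<longlonglongrightarrow> 0"
    using central_unitary_sequence[OF I fin] by blast
  let ?e = "\<lambda>k. cut_off (w k)"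
  have ev1: "eventually (\<lambda>k. \<forall>y\<in>C. norm (commutator (?e k) y) \<le> \<delta>) sequentially"
  proof (rule eventually_ball_finite[OF C], rule ballI)
    fix y assume "y \<in> C"
    then have "(\<lambda>k. norm (commutator (w k) y)) \<longlonglongrightarrow> 0" using w(4)[of y] by (intro tendsto_norm_zero) auto
    then have "eventually (\<lambda>k. norm (commutator (w k) y) < \<delta>) sequentially" using d by (rule order_tendstoD)
    then show "eventually (\<lambda>k. norm (commutator (?e k) y) \<le> \<delta>) sequentially"
      by eventually_elim (use cut_off_commutator[OF w(2)] order_trans less_imp_le in blast)
  qed
  have ev2: "eventually (\<lambda>k. \<forall>x\<in>C. norm (p x - ?e k * p x) \<le> \<delta> / 4) sequentially"
  proof (rule eventually_ball_finite[OF C], rule ballI)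
    fix x assume "x \<in> C"
    then have "(\<lambda>k. norm (2 *\<^sub>R p x + w k * p x)) \<longlonglongrightarrow> 0" using w(3)[of "p x"] by (intro tendsto_norm_zero) auto
    then have "eventually (\<lambda>k. norm (2 *\<^sub>R p x + w k * p x) < \<delta> / 4) sequentially" 
      using d by (intro order_tendstoD(2)) auto
    then show "eventually (\<lambda>k. norm (p x - ?e k * p x) \<le> \<delta> / 4) sequentially"
      by eventually_elim (use cut_off_annihilates[OF w(2)] order_trans less_imp_le in blast)
  qed
  let ?Z = "\<lambda>k y x v. ?e k * y + (x - ?e k * x) + (?e k * v - ?e k * (?e k * v))"
  have ev3: "eventually (\<lambda>k. \<forall>y\<in>C. \<forall>x\<in>C. \<forall>v\<in>C. norm (?Z k y (x - p x) (v - p v))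
      < max (norm y) (norm (x - p x) + norm (v - p v)) + \<delta> / 4) sequentially"
  proof (intro eventually_ball_finite[OF C] ballI)
    fix y x v assume yxv: "y \<in> C" "x \<in> C" "v \<in> C"
    let ?z = "interpolation_coeff y (x - p x) (v - p v)"
    have lin: "(\<lambda>k. commutator (w k) (a + b)) \<longlonglongrightarrow> 0" "(\<lambda>k. commutator (w k) (a - b)) \<longlonglongrightarrow> 0"
        "(\<lambda>k. commutator (w k) (- a)) \<longlonglongrightarrow> 0" "(\<lambda>k. commutator (w k) (r *\<^sub>R a)) \<longlonglongrightarrow> 0"
      if "(\<lambda>k. commutator (w k) a) \<longlonglongrightarrow> 0" "(\<lambda>k. commutator (w k) b) \<longlonglongrightarrow> 0" for a b r
    proof -
      have eq: "commutator (w k) (a + b) = commutator (w k) a + commutator (w k) b"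
        "commutator (w k) (a - b) = commutator (w k) a - commutator (w k) b"
        "commutator (w k) (- a) = - commutator (w k) a"
        "commutator (w k) (r *\<^sub>R a) = r *\<^sub>R commutator (w k) a" for k
        by (simp_all add: commutator_def algebra_simps)
      show "(\<lambda>k. commutator (w k) (a + b)) \<longlonglongrightarrow> 0" "(\<lambda>k. commutator (w k) (a - b)) \<longlonglongrightarrow> 0"
        "(\<lambda>k. commutator (w k) (- a)) \<longlonglongrightarrow> 0" "(\<lambda>k. commutator (w k) (r *\<^sub>R a)) \<longlonglongrightarrow> 0"
        unfolding eq using tendsto_add[OF that] tendsto_diff[OF that] tendsto_minus[OF that(1)]
          tendsto_scaleR[OF tendsto_const that(1), of r] by simp_all
    qed
    have c: "(\<lambda>k. commutator (w k) (?z n)) \<longlonglongrightarrow> 0" for n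
      using w(4) yxv by (auto simp: interpolation_coeff_def intro!: lin)
    have "eventually (\<lambda>k. norm (unitary_poly ?z 4 (w k))
        < max (norm y) (norm (x - p x) + norm (v - p v)) + \<delta> / 4) sequentially"
      by (rule unitary_poly_bound[OF w(2) c interpolation_trig_poly]) (use d in simp)
    then show "eventually (\<lambda>k. norm (?Z k y (x - p x) (v - p v))
        < max (norm y) (norm (x - p x) + norm (v - p v)) + \<delta> / 4) sequentially"
      by (simp only: interpolation_unitary_poly[OF w(2)] upow_norm[OF w(2)])
  qed
  obtain k where k: "\<forall>y\<in>C. norm (commutator (?e k) y) \<le> \<delta>"
      "\<forall>x\<in>C. norm (p x - ?e k * p x) \<le> \<delta> / 4"
      "\<forall>y\<in>C. \<forall>x\<in>C. \<forall>v\<in>C. norm (?Z k y (x - p x) (v - p v))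
        < max (norm y) (norm (x - p x) + norm (v - p v)) + \<delta> / 4"
    using eventually_happens'[OF sequentially_bot eventually_conj[OF ev1 eventually_conj[OF ev2 ev3]]] by blast
  have "norm (?Z k y x v) \<le> max (norm y) (infdist x I + infdist v I) + \<delta>"
    if "y \<in> C" "x \<in> C" "v \<in> C" for y x v
  proof -
    have "?Z k y x v = ?Z k y (x - p x) (v - p v) + (p x - ?e k * p x) + ?e k * (p v - ?e k * p v)"
      by (simp add: algebra_simps)
    also have "norm \<dots> \<le> (norm (?Z k y (x - p x) (v - p v)) + norm (p x - ?e k * p x))
        + norm (?e k * (p v - ?e k * p v))"
      by (intro norm_triangle_le add_mono order_refl)
    also have "\<dots> \<le> (max (norm y) (norm (x - p x) + norm (v - p v)) + \<delta> / 4 + \<delta> / 4) + \<delta> / 4"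
      using k(2,3) that cut_off_norm(1)[OF w(2), of k "p v - ?e k * p v"]
      by (intro add_mono) (auto intro: less_imp_le order_trans)
    also have "\<dots> \<le> max (norm y) (infdist x I + infdist v I) + \<delta>"
      using p(2)[of x] p(2)[of v] d by linarith
    finally show ?thesis .
  qed
  moreover have "?e k \<in> I"
    unfolding cut_off_def using w(1) closed_ideal_star[OF I] closed_idealD[OF I]
    by (intro closed_ideal_minus closed_ideal_scaleR I) auto
  moreover have "star (?e k) = ?e k" by (simp add: cut_off_def star_simps add.commute)
  ultimately have "interpolating I C \<delta> (?e k)"
    unfolding interpolating_def using k(1) cut_off_norm[OF w(2)[of k]] by blast
  then show ?thesis ..
qed

lemma interpolating_compact:
  assumes I: "closed_ideal I" and C: "compact C" and d: "\<delta> > 0"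
  shows "\<exists>e. interpolating I C \<delta> e"
proof -
  obtain F where F: "finite F" "F \<subseteq> C" "C \<subseteq> (\<Union>x\<in>F. ball x (\<delta> / 10))"
    using compactE_image[OF C, of C "\<lambda>x. ball x (\<delta> / 10)"] d by (metis UN_I centre_in_ball open_ball subsetI zero_less_divide_iff zero_less_numeral)
  have near: "\<exists>y'\<in>F. norm (y - y') < \<delta> / 10" if "y \<in> C" for y
  proof -
    obtain y' where "y' \<in> F" "y \<in> ball y' (\<delta> / 10)" using F(3) \<open>y \<in> C\<close> by blast
    then show ?thesis by (intro bexI[of _ y']) (simp_all add: dist_norm norm_minus_commute)
  qed
  obtain e where e: "interpolating I F (\<delta> / 2) e"
    using interpolating_finite[OF I F(1) half_gt_zero[OF d]] by blast
  have n: "norm (e * x) \<le> norm x" "norm (x - e * x) \<le> norm x" "norm (x * e) \<le> norm x" for x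
    using e by (auto simp: interpolating_def)
  have "norm (commutator e y) \<le> \<delta>" if yC: "y \<in> C" for y
  proof -
    obtain y' where y': "y' \<in> F" "norm (y - y') < \<delta> / 10" using near[OF yC] by blast
    have "commutator e y = e * (y - y') - (y - y') * e + commutator e y'"
      by (simp add: commutator_def algebra_simps)
    also have "norm \<dots> \<le> (norm (y - y') + norm (y - y')) + \<delta> / 2"
      using e y' n by (intro norm_triangle_le add_mono order_trans[OF norm_triangle_ineq4])
        (auto simp: interpolating_def)
    finally show ?thesis using y' d by linarith
  qed
  moreover have "norm (e * y + (x - e * x) + (e * v - e * (e * v))) \<le> max (norm y) (infdist x I + infdist v I) + \<delta>"
    if C3: "y \<in> C" "x \<in> C" "v \<in> C" for y x v
  proof -
    obtain y' where y': "y' \<in> F" "norm (y - y') < \<delta> / 10" using near[OF C3(1)] by blast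
    obtain x' where x': "x' \<in> F" "norm (x - x') < \<delta> / 10" using near[OF C3(2)] by blast
    obtain v' where v': "v' \<in> F" "norm (v - v') < \<delta> / 10" using near[OF C3(3)] by blast
    let ?a = "e * (y - y')" and ?b = "(x - x') - e * (x - x')" and ?c = "e * ((v - v') - e * (v - v'))"
      and ?Z = "e * y' + (x' - e * x') + (e * v' - e * (e * v'))"
    have "e * y + (x - e * x) + (e * v - e * (e * v)) = ?Z + (?a + (?b + ?c))"
      by (simp add: algebra_simps)
    also have "norm \<dots> \<le> norm ?Z + (norm ?a + (norm ?b + norm ?c))"
      by (intro norm_triangle_le add_mono order_refl)
    finally have 1: "norm (e * y + (x - e * x) + (e * v - e * (e * v)))
        \<le> norm ?Z + (norm ?a + (norm ?b + norm ?c))" .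
    have 2: "norm ?Z \<le> max (norm y') (infdist x' I + infdist v' I) + \<delta> / 2"
      using e y' x' v' by (auto simp: interpolating_def)
    have 3: "norm y' \<le> norm y + norm (y - y')"
      by (metis norm_minus_commute norm_triangle_sub)
    have 4: "infdist x' I \<le> infdist x I + norm (x - x')" "infdist v' I \<le> infdist v I + norm (v - v')"
      using infdist_triangle[of x' I x] infdist_triangle[of v' I v] by (auto simp: dist_norm norm_minus_commute)
    have 5: "norm ?a \<le> norm (y - y')" "norm ?b \<le> norm (x - x')" by (rule n)+
    have 6: "norm ?c \<le> norm (v - v')" using n(1)[of "(v - v') - e * (v - v')"] n(2)[of "v - v'"] by (rule order_trans)
    show ?thesis using 1 2 3 4 5 6 y'(2) x'(2) v'(2) d by linarith
  qed
  ultimately have "interpolating I C \<delta> e" using e unfolding interpolating_def by blast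
  then show ?thesis ..
qed

section \<open>One step of the construction\<close>

definition blend :: "'a::cstar_algebra \<Rightarrow> 'a \<Rightarrow> 'a \<Rightarrow> 'a" where
  "blend e y g = e * y + (g - e * g)"

text \<open>Passing from \<open>y\<close> to \<open>blend e y g\<close> moves the class modulo the ideal from that of \<open>y\<close> to
  that of \<open>g\<close>. The failure of any algebraic relation among the new elements is at most the
  maximum of the failure for the old ones and of the failure modulo the ideal for the \<open>g\<close>'s.
  For products the latter includes the square of the step size modulo the ideal.\<close>

proposition blend_step:
  fixes I :: "'a::cstar_algebra set"
  assumes I: "closed_ideal I" and K: "compact K" and d: "\<delta> > 0"
  obtains e where "e \<in> I"
    "\<And>y1 y2 y3 g1 g2 g3. {y1, y2, y3, g1, g2, g3} \<subseteq> K \<Longrightarrow>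
      norm (blend e y1 g1 * blend e y2 g2 - blend e y3 g3)
        \<le> max (norm (y1 * y2 - y3)) (infdist (g1 * g2 - g3) I + infdist (g1 - y1) I * infdist (g2 - y2) I) + \<delta>"
    "\<And>y1 y2 y3 g1 g2 g3 \<mu> \<nu>. {y1, y2, y3, g1, g2, g3} \<subseteq> K \<Longrightarrow> cmod \<mu> \<le> R \<Longrightarrow> cmod \<nu> \<le> R \<Longrightarrow>
      norm (scaleC \<mu> (blend e y1 g1) + scaleC \<nu> (blend e y2 g2) - blend e y3 g3)
        \<le> max (norm (scaleC \<mu> y1 + scaleC \<nu> y2 - y3)) (infdist (scaleC \<mu> g1 + scaleC \<nu> g2 - g3) I) + \<delta>"
    "\<And>y1 y2 g1 g2. {y1, y2, g1, g2} \<subseteq> K \<Longrightarrow>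
      norm (star (blend e y1 g1) - blend e y2 g2)
        \<le> max (norm (star y1 - y2)) (infdist (star g1 - g2) I) + \<delta>"
    "\<And>y g. {y, g} \<subseteq> K \<Longrightarrow> norm (blend e y g - y) \<le> infdist (g - y) I + \<delta>"
proof -
  obtain B where B: "B > 0" "\<And>x. x \<in> K \<Longrightarrow> norm x \<le> B"
    using compact_imp_bounded[OF K] by (auto simp: bounded_pos)
  \<comment> \<open>All arguments for which the interpolation estimate is going to be used.\<close>
  define C1 where "C1 = (\<lambda>(x, y, z). x * y - z) ` (K \<times> K \<times> K)"
  define C2 where "C2 = (\<lambda>((\<mu>, \<nu>), x, y, z). scaleC \<mu> x + scaleC \<nu> y - z) ` ((cball 0 R \<times> cball 0 R) \<times> (K \<times> K \<times> K))"
  define C3 where "C3 = (\<lambda>(x, y). star x - y) ` (K \<times> K)"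
  define C4 where "C4 = (\<lambda>(x, y). x - y) ` (K \<times> K)"
  define C5 where "C5 = (\<lambda>((x, y), (z, u)). (x - y) * (z - u)) ` ((K \<times> K) \<times> (K \<times> K))"
  define C where "C = insert 0 (K \<union> star ` K \<union> C1 \<union> C2 \<union> C3 \<union> C4 \<union> C5)"
  have cstar: "continuous_on S (\<lambda>x. star (f x))" if "continuous_on S f" for f :: "'b::topological_space \<Rightarrow> 'a" and S
    by (rule bounded_linear.continuous_on[OF bounded_linear_star that])
  have "compact C1" "compact C2" "compact C3" "compact C4" "compact C5" "compact (star ` K)"
    unfolding C1_def C2_def C3_def C4_def C5_def case_prod_beta
    by (intro compact_continuous_image compact_Times K compact_cball continuous_intros scaleC.continuous_on cstar)+
  then have "compact C" unfolding C_def using K by (auto intro!: compact_insert compact_Un)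
  define \<delta>' where "\<delta>' = \<delta> / (6 * B + 5)"
  have \<delta>': "\<delta>' > 0" "(6 * B + 5) * \<delta>' = \<delta>" using B d by (auto simp: \<delta>'_def)
  then have \<delta>1: "6 * B * \<delta>' \<ge> 0" "6 * B * \<delta>' + 5 * \<delta>' = \<delta>" using B by (auto simp: algebra_simps)
  have \<delta>3: "3 * \<delta>' \<le> \<delta>" using \<delta>1 \<delta>'(1) by (smt (verit))
  obtain e where e: "interpolating I C \<delta>' e"
    using interpolating_compact[OF I \<open>compact C\<close> \<delta>'(1)] by blast
  have eI: "e \<in> I" and se: "star e = e"
    and n: "norm (e * x) \<le> norm x" "norm (x - e * x) \<le> norm x" "norm (x * e) \<le> norm x"
    and comm: "y \<in> C \<Longrightarrow> norm (commutator e y) \<le> \<delta>'"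
    and main: "y \<in> C \<Longrightarrow> z \<in> C \<Longrightarrow> v \<in> C \<Longrightarrow> norm (e * y + (z - e * z) + (e * v - e * (e * v)))
          \<le> max (norm y) (infdist z I + infdist v I) + \<delta>'" for x y z v
    using e unfolding interpolating_def by blast+
  have C0: "0 \<in> C" and CK: "x \<in> K \<Longrightarrow> x \<in> C" and CsK: "x \<in> K \<Longrightarrow> star x \<in> C" for x
    by (auto simp: C_def)
  have m1: "x * y - z \<in> C" if "x \<in> K" "y \<in> K" "z \<in> K" for x y z
  proof -
    have "x * y - z \<in> C1" unfolding C1_def by (rule image_eqI[of _ _ "(x, y, z)"]) (use that in simp_all)
    then show ?thesis by (simp add: C_def)
  qed
  have m2: "scaleC \<mu> x + scaleC \<nu> y - z \<in> C" if "x \<in> K" "y \<in> K" "z \<in> K" "cmod \<mu> \<le> R" "cmod \<nu> \<le> R" for x y z \<mu> \<nu>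
  proof -
    have "scaleC \<mu> x + scaleC \<nu> y - z \<in> C2"
      unfolding C2_def by (rule image_eqI[of _ _ "((\<mu>, \<nu>), x, y, z)"]) (use that in simp_all)
    then show ?thesis by (simp add: C_def)
  qed
  have m3: "star x - y \<in> C" and m4: "x - y \<in> C" if "x \<in> K" "y \<in> K" for x y
  proof -
    have "star x - y \<in> C3" unfolding C3_def by (rule image_eqI[of _ _ "(x, y)"]) (use that in simp_all)
    then show "star x - y \<in> C" by (simp add: C_def)
    have "x - y \<in> C4" unfolding C4_def by (rule image_eqI[of _ _ "(x, y)"]) (use that in simp_all)
    then show "x - y \<in> C" by (simp add: C_def)
  qed
  have m5: "(x - y) * (z - u) \<in> C" if "x \<in> K" "y \<in> K" "z \<in> K" "u \<in> K" for x y z u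
  proof -
    have "(x - y) * (z - u) \<in> C5" unfolding C5_def by (rule image_eqI[of _ _ "((x, y), (z, u))"]) (use that in simp_all)
    then show ?thesis by (simp add: C_def)
  qed
  have i0: "infdist 0 I = 0" using closed_idealD(1)[OF I] by simp
  have main0: "norm (e * y + (z - e * z)) \<le> max (norm y) (infdist z I) + \<delta>'" if "y \<in> C" "z \<in> C" for y z
    using main[OF that C0] i0 by simp
  show thesis
  proof (rule that[OF eI])
    fix y1 y2 y3 g1 g2 g3 assume S: "{y1, y2, y3, g1, g2, g3} \<subseteq> K"
    define d1 where "d1 = y1 - g1" define d2 where "d2 = y2 - g2"
    have inC: "y1 * y2 - y3 \<in> C" "g1 * g2 - g3 \<in> C" "(g1 - y1) * (y2 - g2) \<in> C" "d1 \<in> C" "g1 \<in> C"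
      using S by (simp_all add: m1 m4 m5 CK d1_def)
    have nd: "norm d2 \<le> 2 * B"
      using norm_triangle_ineq4[of y2 g2] B(2)[of y2] B(2)[of g2] S by (simp add: d2_def)
    let ?Z = "e * (y1 * y2 - y3) + ((g1 * g2 - g3) - e * (g1 * g2 - g3))
        + (e * ((g1 - y1) * (y2 - g2)) - e * (e * ((g1 - y1) * (y2 - g2))))"
    \<comment> \<open>For central \<open>e\<close>, with \<open>v = (g\<^sub>1 - y\<^sub>1) (y\<^sub>2 - g\<^sub>2)\<close>:
      \<open>(e y\<^sub>1 + (1 - e) g\<^sub>1) (e y\<^sub>2 + (1 - e) g\<^sub>2) = e y\<^sub>1 y\<^sub>2 + (1 - e) g\<^sub>1 g\<^sub>2 + e (1 - e) v\<close>.\<close>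
    have "blend e y1 g1 * blend e y2 g2 - blend e y3 g3
        = ?Z + (- (commutator e g1 * d2) + - (e * (commutator e d1 * d2)))"
      by (simp add: blend_def commutator_def d1_def d2_def algebra_simps)
    also have "norm \<dots> \<le> norm ?Z + (norm (- (commutator e g1 * d2)) + norm (- (e * (commutator e d1 * d2))))"
      by (rule norm_add_add_le)
    also have "norm (- (commutator e g1 * d2)) = norm (commutator e g1 * d2)" by (rule norm_minus_cancel)
    also have "norm (- (e * (commutator e d1 * d2))) = norm (e * (commutator e d1 * d2))" by (rule norm_minus_cancel)
    finally have 1: "norm (blend e y1 g1 * blend e y2 g2 - blend e y3 g3)
        \<le> norm ?Z + (norm (commutator e g1 * d2) + norm (e * (commutator e d1 * d2)))" .
    have 2: "norm (commutator e g1 * d2) \<le> \<delta>' * (2 * B)"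
      using comm[OF inC(5)] nd \<delta>' by (intro order_trans[OF norm_mult_ineq] mult_mono) auto
    have 3: "norm (e * (commutator e d1 * d2)) \<le> \<delta>' * (2 * B)"
      using comm[OF inC(4)] nd \<delta>' by (intro order_trans[OF n(1)] order_trans[OF norm_mult_ineq] mult_mono) auto
    have 4: "norm ?Z \<le> max (norm (y1 * y2 - y3)) (infdist (g1 * g2 - g3) I
        + infdist ((g1 - y1) * (y2 - g2)) I) + \<delta>'" by (rule main[OF inC(1-3)])
    have 5: "infdist ((g1 - y1) * (y2 - g2)) I \<le> infdist (g1 - y1) I * infdist (g2 - y2) I"
      using infdist_ideal_mult[OF I, of "g1 - y1" "y2 - g2"] infdist_ideal_minus[OF I, of "g2 - y2"] by simp
    have 6: "\<delta>' * (2 * B) + \<delta>' * (2 * B) + \<delta>' \<le> \<delta>"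
      using \<delta>1 \<delta>'(1) by (simp add: algebra_simps)
    show "norm (blend e y1 g1 * blend e y2 g2 - blend e y3 g3)
        \<le> max (norm (y1 * y2 - y3)) (infdist (g1 * g2 - g3) I + infdist (g1 - y1) I * infdist (g2 - y2) I) + \<delta>"
      using 1 2 3 4 5 6 by linarith
  next
    fix y1 y2 y3 g1 g2 g3 \<mu> \<nu> assume S: "{y1, y2, y3, g1, g2, g3} \<subseteq> K" "cmod \<mu> \<le> R" "cmod \<nu> \<le> R"
    have inC: "scaleC \<mu> y1 + scaleC \<nu> y2 - y3 \<in> C" "scaleC \<mu> g1 + scaleC \<nu> g2 - g3 \<in> C"
      using S by (simp_all add: m2)
    have "scaleC \<mu> (blend e y1 g1) + scaleC \<nu> (blend e y2 g2) - blend e y3 g3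
        = e * (scaleC \<mu> y1 + scaleC \<nu> y2 - y3)
          + ((scaleC \<mu> g1 + scaleC \<nu> g2 - g3) - e * (scaleC \<mu> g1 + scaleC \<nu> g2 - g3))"
      by (simp add: blend_def scaleC.add_right scaleC.diff_right scaleC_mult_right algebra_simps)
    also have "norm \<dots> \<le> max (norm (scaleC \<mu> y1 + scaleC \<nu> y2 - y3)) (infdist (scaleC \<mu> g1 + scaleC \<nu> g2 - g3) I) + \<delta>'"
      by (rule main0[OF inC])
    finally show "norm (scaleC \<mu> (blend e y1 g1) + scaleC \<nu> (blend e y2 g2) - blend e y3 g3)
        \<le> max (norm (scaleC \<mu> y1 + scaleC \<nu> y2 - y3)) (infdist (scaleC \<mu> g1 + scaleC \<nu> g2 - g3) I) + \<delta>"
      using \<delta>3 \<delta>'(1) by linarith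
  next
    fix y1 y2 g1 g2 assume S: "{y1, y2, g1, g2} \<subseteq> K"
    have inC: "star y1 - y2 \<in> C" "star g1 - g2 \<in> C" "star y1 \<in> C" "star g1 \<in> C"
      using S by (simp_all add: m3 CsK)
    let ?Z = "e * (star y1 - y2) + ((star g1 - g2) - e * (star g1 - g2))"
    have "star (blend e y1 g1) - blend e y2 g2 = ?Z + (- commutator e (star y1) + commutator e (star g1))"
      by (simp add: blend_def commutator_def star_simps se algebra_simps)
    also have "norm \<dots> \<le> norm ?Z + (norm (- commutator e (star y1)) + norm (commutator e (star g1)))"
      by (rule norm_add_add_le)
    also have "norm (- commutator e (star y1)) = norm (commutator e (star y1))" by (rule norm_minus_cancel)
    finally show "norm (star (blend e y1 g1) - blend e y2 g2)
        \<le> max (norm (star y1 - y2)) (infdist (star g1 - g2) I) + \<delta>"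
      using main0[OF inC(1,2)] comm[OF inC(3)] comm[OF inC(4)] \<delta>3 \<delta>'(1) by linarith
  next
    fix y g assume S: "{y, g} \<subseteq> K"
    then have "g - y \<in> C" by (simp add: m4)
    then have "norm (e * 0 + ((g - y) - e * (g - y))) \<le> max (norm (0::'a)) (infdist (g - y) I) + \<delta>'"
      by (intro main0 C0)
    moreover have "blend e y g - y = e * 0 + ((g - y) - e * (g - y))"
      by (simp add: blend_def algebra_simps)
    ultimately have "norm (blend e y g - y) \<le> max 0 (infdist (g - y) I) + \<delta>'"
      by (simp only: norm_zero)
    then show "norm (blend e y g - y) \<le> infdist (g - y) I + \<delta>"
      using infdist_nonneg[of "g - y" I] \<delta>3 \<delta>'(1) by linarith
  qed
qed

section \<open>Asymptotic homomorphisms are asymptotically bounded\<close>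

text \<open>The relations of an asymptotic homomorphism along a filter, for the norm modulo an ideal. The
  zero ideal gives the norm itself.\<close>

definition asymptotic_mod :: "'d::cstar_algebra set \<Rightarrow> 'i filter \<Rightarrow> ('b::cstar_algebra \<Rightarrow> 'i \<Rightarrow> 'd) \<Rightarrow> bool" where
  "asymptotic_mod I F f \<longleftrightarrow>
     (\<forall>a. ((\<lambda>i. infdist (f (star a) i - star (f a i)) I) \<longlongrightarrow> 0) F) \<and>
     (\<forall>a b \<mu> \<nu>. ((\<lambda>i. infdist (f (scaleC \<mu> a + scaleC \<nu> b) i - (scaleC \<mu> (f a i) + scaleC \<nu> (f b i))) I) \<longlongrightarrow> 0) F) \<and>
     (\<forall>a b. ((\<lambda>i. infdist (f (a * b) i - f a i * f b i) I) \<longlongrightarrow> 0) F)"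

text \<open>If \<open>C\<^sup>2 + H\<^sup>2 = 2 C\<close> for commuting self-adjoint \<open>C\<close> and \<open>H\<close>, then \<open>1 - C + iH\<close> is unitary,
  which bounds \<open>C\<close> and \<open>H\<close>. The bound persists if the hypotheses hold only up to a small error.\<close>

lemma almost_unitary_bound:
  fixes C H :: "'a::cstar_algebra"
  assumes I: "closed_ideal I"
    and 1: "infdist (C * C + H * H - 2 *\<^sub>R C) I \<le> 1 / 8" and 2: "infdist (H * C - C * H) I \<le> 1 / 8"
    and 3: "infdist (star C - C) I \<le> 1 / 8" and 4: "infdist (star H - H) I \<le> 1 / 8"
  shows "infdist H I \<le> 6"
proof -
  define p where "p x = infdist x I" for x
  have tri: "p (x + y) \<le> p x + p y" for x y
    unfolding p_def by (rule infdist_ideal_triangle[OF I])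
  have mult: "p (x * y) \<le> p x * p y" for x y
    unfolding p_def by (rule infdist_ideal_mult[OF I])
  have sc: "p (scaleC c x) \<le> cmod c * p x" for c x
    unfolding p_def by (rule infdist_ideal_scaleC_le[OF I])
  have neg: "p (- x) = p x" for x unfolding p_def by (rule infdist_ideal_minus[OF I])
  have pstar: "p (star x) = p x" for x unfolding p_def by (rule infdist_ideal_star[OF I])
  have p0: "p x \<ge> 0" for x unfolding p_def by (rule infdist_nonneg)
  have cs: "p (star x * x) = (p x)\<^sup>2" for x unfolding p_def by (rule infdist_ideal_cstar[OF I])
  have sci: "p (scaleC \<i> x) \<le> p x" for x using sc[of \<i> x] by simp
  define W where "W = scaleC \<i> H - C"
  define E where "E = W + star W + star W * W"
  define \<eta> where "\<eta> = (4 + 2 * p C + 2 * p H) / 8"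
  have sW: "star W = - scaleC \<i> (star H) - star C"
    by (simp add: W_def star_simps scaleC.minus_left)
  have "E = (C * C + H * H - 2 *\<^sub>R C) + ((star C - C) * C + ((star H - H) * H
      + (scaleC \<i> ((star H - H) * C) + (- scaleC \<i> ((star C - C) * H) + (scaleC \<i> (H * C - C * H)
      + (- (star C - C) + - scaleC \<i> (star H - H)))))))"
    unfolding E_def sW unfolding W_def
    by (simp add: algebra_simps scaleR_2 scaleC_mult_left scaleC_mult_right scaleC_scaleC
        scaleC.diff_right scaleC.add_right scaleC.minus_left scaleC.minus_right)
  also have "p \<dots> \<le> 1 / 8 + ((1 / 8) * p C + ((1 / 8) * p H + ((1 / 8) * p C + ((1 / 8) * p H + (1 / 8 + (1 / 8 + 1 / 8))))))"
  proof -
    have C: "p ((star C - C) * x) \<le> (1 / 8) * p x" and H: "p ((star H - H) * x) \<le> (1 / 8) * p x" for x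
      using order_trans[OF mult mult_right_mono[OF 3[folded p_def] p0]]
        order_trans[OF mult mult_right_mono[OF 4[folded p_def] p0]] by blast+
    have f: "p (scaleC \<i> ((star H - H) * C)) \<le> (1 / 8) * p C" "p (- scaleC \<i> ((star C - C) * H)) \<le> (1 / 8) * p H"
      unfolding neg by (rule order_trans[OF sci H], rule order_trans[OF sci C])
    have g: "p (C * C + H * H - 2 *\<^sub>R C) \<le> 1 / 8" "p (scaleC \<i> (H * C - C * H)) \<le> 1 / 8"
        "p (- (star C - C)) \<le> 1 / 8" "p (- scaleC \<i> (star H - H)) \<le> 1 / 8"
      unfolding neg using 1 2 3 4 sci[of "H * C - C * H"] sci[of "star H - H"] unfolding p_def by linarith+
    show ?thesis by (intro order_trans[OF tri add_mono] C H f g)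
  qed
  finally have E: "p E \<le> \<eta>" by (simp add: \<eta>_def)
  have \<eta>0: "\<eta> \<ge> 0" using p0[of C] p0[of H] by (simp add: \<eta>_def)
  have pW: "p W \<le> 2 + \<eta>"
  proof -
    \<comment> \<open>Almost isometric action on \<open>W\<^sup>*\<close> bounds \<open>\<parallel>W W\<^sup>*\<parallel> = \<parallel>W\<parallel>\<^sup>2\<close> by \<open>(2 + \<eta>) \<parallel>W\<parallel>\<close>.\<close>
    define x where "x = star W"
    have "(p (x + W * x))\<^sup>2 = p (star (x + W * x) * (x + W * x))" by (simp add: cs)
    also have "star (x + W * x) * (x + W * x) = star x * x + star x * E * x"
      by (simp add: E_def star_simps algebra_simps)
    also have "p \<dots> \<le> p (star x * x) + p (star x * E * x)" by (rule tri)
    also have "p (star x * E * x) \<le> (p x * \<eta>) * p x"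
      using E p0 \<eta>0 by (intro order_trans[OF mult] mult_mono) (auto simp: pstar)
    also have "p (star x * x) + (p x * \<eta>) * p x = (p x)\<^sup>2 * (1 + \<eta>)"
      by (simp add: cs power2_eq_square algebra_simps)
    also have "\<dots> \<le> (p x)\<^sup>2 * (1 + \<eta>)\<^sup>2"
      using \<eta>0 by (intro mult_left_mono) (auto simp: power2_eq_square algebra_simps)
    finally have "(p (x + W * x))\<^sup>2 \<le> (p x * (1 + \<eta>))\<^sup>2" by (simp add: power_mult_distrib)
    then have "p (x + W * x) \<le> p x * (1 + \<eta>)" by (rule power2_le_imp_le) (use p0 \<eta>0 in simp)
    moreover have "p (W * x) \<le> p (x + W * x) + p x"
      using tri[of "x + W * x" "- x"] unfolding neg by simp
    ultimately have "p (W * x) \<le> p x * (2 + \<eta>)" by (simp add: algebra_simps)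
    moreover have "p (W * x) = p W * p W" using cs[of "star W"] by (simp add: x_def star_star pstar power2_eq_square)
    ultimately have "p W * p W \<le> p W * (2 + \<eta>)" by (simp add: x_def pstar)
    then show ?thesis using p0[of W] \<eta>0 by (cases "p W = 0") auto
  qed
  have half: "2 * p x \<le> p (x + x)" for x
    using sc[of "1 / 2" "x + x"] scaleC.add_left[of "1 / 2" "1 / 2" x] by (simp add: scaleC.add_right)
  have ends: "p (- (star C - C)) \<le> 1 / 8" "p (- scaleC \<i> (star H - H)) \<le> 1 / 8"
      "p (- star W) \<le> p W" "p (- W) \<le> p W"
    unfolding neg pstar using 3 4 sci[of "star H - H"] unfolding p_def by linarith+
  have "scaleC \<i> H + scaleC \<i> H = W + (- star W + (- (star C - C) + - scaleC \<i> (star H - H)))"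
    unfolding sW unfolding W_def by (simp add: scaleC.diff_right)
  also have "p \<dots> \<le> p W + (p W + (1 / 8 + 1 / 8))"
    by (intro order_trans[OF tri add_mono] ends order_refl)
  finally have "2 * p (scaleC \<i> H) \<le> 2 * p W + 1 / 4" using half[of "scaleC \<i> H"] by simp
  moreover have "p H \<le> p (scaleC \<i> H)"
    using sc[of "- \<i>" "scaleC \<i> H"] by (simp add: scaleC_scaleC)
  ultimately have H: "p H \<le> p W + 1 / 8" by simp
  have "C + C = - W + (- star W + (- (star C - C) + - scaleC \<i> (star H - H)))"
    unfolding sW unfolding W_def by (simp add: scaleC.diff_right)
  also have "p \<dots> \<le> p W + (p W + (1 / 8 + 1 / 8))"
    by (intro order_trans[OF tri add_mono] ends order_refl)
  finally have C: "p C \<le> p W + 1 / 8" using half[of C] by simp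
  \<comment> \<open>\<open>\<eta>\<close> is at most \<open>(5 + 4 \<parallel>W\<parallel>) / 8\<close>, so the bound \<open>2 + \<eta>\<close> can be solved for \<open>\<parallel>W\<parallel>\<close>.\<close>
  show ?thesis
    using H C pW unfolding \<eta>_def p_def[symmetric] by argo
qed

text \<open>A self-adjoint element of norm at most one half is the imaginary part of a unitary of the
  unitisation: \<open>c = 1 - sqrt (1 - h\<^sup>2)\<close> is the fixed point of \<open>x \<mapsto> (h\<^sup>2 + x\<^sup>2) / 2\<close>.\<close>

lemma unitary_with_imaginary_part:
  fixes h :: "'b::cstar_algebra"
  assumes h: "star h = h" "norm h \<le> 1 / 2"
  obtains c where "star c = c" "c * h = h * c" "c * c + h * h = 2 *\<^sub>R c"
proof -
  define S where "S = {x::'b. norm x \<le> 1 / 2} \<inter> {x. star x = x} \<inter> {x. x * h = h * x}"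
  define \<phi> where "\<phi> x = (1 / 2) *\<^sub>R (x * x + h * h)" for x
  have "closed S" unfolding S_def
    by (intro closed_Int closed_Collect_le closed_Collect_eq continuous_intros
        bounded_linear.continuous_on[OF bounded_linear_star])
  then have 1: "complete S" by (simp add: complete_eq_closed)
  have "0 \<in> S" by (simp add: S_def star_0)
  then have 2: "S \<noteq> {}" by blast
  have sq: "norm (x * x) \<le> 1 / 4" if "norm x \<le> 1 / 2" for x :: 'b
    using norm_mult_ineq[of x x] mult_mono[OF that that] by auto
  have 3: "\<phi> ` S \<subseteq> S"
  proof safe
    fix x assume x: "x \<in> S"
    have "norm (x * x + h * h) \<le> 1 / 4 + 1 / 4"
      using x sq h by (intro norm_triangle_le add_mono) (auto simp: S_def)
    moreover have "x * x * h = h * x * x" using x by (simp add: S_def mult.assoc) (simp add: mult.assoc[symmetric])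
    moreover have "norm (\<phi> x) = (1 / 2) * norm (x * x + h * h)" unfolding \<phi>_def norm_scaleR by simp
    ultimately have "norm (\<phi> x) \<le> 1 / 2" "\<phi> x * h = h * \<phi> x"
      by (simp_all add: \<phi>_def algebra_simps)
    moreover have "star (\<phi> x) = \<phi> x" using x h by (simp add: S_def \<phi>_def star_simps)
    ultimately show "\<phi> x \<in> S" by (simp add: S_def)
  qed
  have 4: "dist (\<phi> x) (\<phi> y) \<le> (1 / 2) * dist x y" if "x \<in> S \<and> y \<in> S" for x y
  proof -
    have "\<phi> x - \<phi> y = (1 / 2) *\<^sub>R (x * (x - y) + (x - y) * y)"
      by (simp add: \<phi>_def algebra_simps)
    moreover have "norm (x * (x - y) + (x - y) * y) \<le> (1 / 2) * norm (x - y) + norm (x - y) * (1 / 2)"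
      using that by (intro norm_triangle_le add_mono order_trans[OF norm_mult_ineq] mult_mono) (auto simp: S_def)
    ultimately show ?thesis by (simp add: dist_norm)
  qed
  have "\<exists>!x\<in>S. \<phi> x = x"
    by (rule Banach_fix[OF 1 2, of "1 / 2"]) (use 3 4 in auto)
  then obtain c where c: "c \<in> S" "\<phi> c = c" by blast
  have "c * c + h * h = 2 *\<^sub>R \<phi> c" by (simp add: \<phi>_def)
  with c show thesis using that unfolding S_def by auto
qed

context
  fixes I :: "'d::cstar_algebra set" and F :: "'i filter" and f :: "'b::cstar_algebra \<Rightarrow> 'i \<Rightarrow> 'd"
  assumes I: "closed_ideal I" and f: "asymptotic_mod I F f"
begin

lemma asymptotic_mod_star: "((\<lambda>i. infdist (f (star a) i - star (f a i)) I) \<longlongrightarrow> 0) F"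
  and asymptotic_mod_lin: "((\<lambda>i. infdist (f (scaleC \<mu> a + scaleC \<nu> b) i - (scaleC \<mu> (f a i) + scaleC \<nu> (f b i))) I) \<longlongrightarrow> 0) F"
  and asymptotic_mod_mult: "((\<lambda>i. infdist (f (a * b) i - f a i * f b i) I) \<longlongrightarrow> 0) F"
  using f by (auto simp: asymptotic_mod_def)

lemma infdist_sum3_tendsto_zero:
  assumes "((\<lambda>i. infdist (u i) I) \<longlongrightarrow> 0) F" "((\<lambda>i. infdist (v i) I) \<longlongrightarrow> 0) F" "((\<lambda>i. infdist (w i) I) \<longlongrightarrow> 0) F"
  shows "((\<lambda>i. infdist (u i + v i + w i) I) \<longlongrightarrow> 0) F"
proof (rule tendsto_sandwich[OF _ _ tendsto_const])
  show "eventually (\<lambda>i. infdist (u i + v i + w i) I \<le> infdist (u i) I + infdist (v i) I + infdist (w i) I) F"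
    by (intro always_eventually allI order_trans[OF infdist_ideal_triangle[OF I]] add_mono
        infdist_ideal_triangle[OF I] order_refl)
  show "((\<lambda>i. infdist (u i) I + infdist (v i) I + infdist (w i) I) \<longlongrightarrow> 0) F"
    using tendsto_add[OF tendsto_add[OF assms(1,2)] assms(3)] by simp
qed (simp add: infdist_nonneg)

text \<open>The relations that express unitarity involve finitely many elements, so they persist asymptotically.\<close>

lemma asymptotic_bound_selfadjoint_half:
  assumes h: "star h = h" "norm h \<le> 1 / 2"
  shows "eventually (\<lambda>i. infdist (f h i) I \<le> 6) F"
proof -
  obtain c where c: "star c = c" "c * h = h * c" "c * c + h * h = 2 *\<^sub>R c"
    using unitary_with_imaginary_part[OF h] by blast
  let ?C = "\<lambda>i. f c i" and ?H = "\<lambda>i. f h i"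
  have two: "scaleC 2 x = 2 *\<^sub>R x" for x :: "'x::cstar_algebra" using scaleC_of_real[of 2 x] by simp
  have neg: "((\<lambda>i. infdist (- u i) I) \<longlongrightarrow> 0) F" if "((\<lambda>i. infdist (u i) I) \<longlongrightarrow> 0) F" for u
    using that by (simp add: infdist_ideal_minus[OF I])
  have lin: "((\<lambda>i. infdist (f (x + y) i - (f x i + f y i)) I) \<longlongrightarrow> 0) F" for x y
    using asymptotic_mod_lin[of 1 x 1 y] by simp
  have "((\<lambda>i. infdist ((- (f (c * c) i - ?C i * ?C i) + - (f (h * h) i - ?H i * ?H i))
        + (- (f (c * c + h * h) i - (f (c * c) i + f (h * h) i)) + (f (c + c) i - (?C i + ?C i)) + 0) + 0) I) \<longlongrightarrow> 0) F"
    by (intro infdist_sum3_tendsto_zero[of _ _ "\<lambda>_. 0", simplified add_0_right] infdist_sum3_tendsto_zero neg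
        asymptotic_mod_mult lin) (use closed_idealD(1)[OF I] in simp_all)
  moreover have "c * c + h * h = c + c" using c by (simp add: scaleR_2)
  ultimately have 1: "((\<lambda>i. infdist (?C i * ?C i + ?H i * ?H i - 2 *\<^sub>R ?C i) I) \<longlongrightarrow> 0) F"
    by (simp add: algebra_simps scaleR_2)
  have "((\<lambda>i. infdist (- (f (h * c) i - ?H i * ?C i) + (f (c * h) i - ?C i * ?H i) + 0) I) \<longlongrightarrow> 0) F"
    by (intro infdist_sum3_tendsto_zero neg asymptotic_mod_mult) (use closed_idealD(1)[OF I] in simp)
  then have 2: "((\<lambda>i. infdist (?H i * ?C i - ?C i * ?H i) I) \<longlongrightarrow> 0) F"
    by (simp add: c)
  have 3: "((\<lambda>i. infdist (star (?C i) - ?C i) I) \<longlongrightarrow> 0) F"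
    using neg[OF asymptotic_mod_star[of c]] by (simp add: c)
  have 4: "((\<lambda>i. infdist (star (?H i) - ?H i) I) \<longlongrightarrow> 0) F"
    using neg[OF asymptotic_mod_star[of h]] by (simp add: h)
  have ev: "eventually (\<lambda>i. infdist (u i) I < 1 / 8) F" if "((\<lambda>i. infdist (u i) I) \<longlongrightarrow> 0) F" for u
    using that by (rule order_tendstoD) simp
  show ?thesis
    using ev[OF 1] ev[OF 2] ev[OF 3] ev[OF 4]
  proof eventually_elim
    case (elim i)
    then show ?case by (intro almost_unitary_bound[OF I, of "f c i"]) auto
  qed
qed

lemma asymptotic_bound_selfadjoint:
  assumes h: "star h = h" and e: "\<epsilon> > 0"
  shows "eventually (\<lambda>i. infdist (f h i) I \<le> 12 * norm h + \<epsilon>) F"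
proof -
  define k where "k = (if h = 0 then 0 else (1 / (2 * norm h)) *\<^sub>R h)"
  have k: "star k = k" "norm k \<le> 1 / 2"
    using h by (auto simp: k_def star_simps)
  have k3: "h = scaleC (of_real (2 * norm h)) k"
    by (simp only: scaleC_of_real) (simp add: k_def)
  have "((\<lambda>i. infdist (f h i - scaleC (of_real (2 * norm h)) (f k i)) I) \<longlongrightarrow> 0) F"
    using asymptotic_mod_lin[of "of_real (2 * norm h)" k 0 k] k3[symmetric] by (simp add: scaleC.zero_left)
  then have "eventually (\<lambda>i. infdist (f h i - scaleC (of_real (2 * norm h)) (f k i)) I < \<epsilon>) F"
    using e by (rule order_tendstoD)
  then show ?thesis
    using asymptotic_bound_selfadjoint_half[OF k(1,2)]
  proof eventually_elim
    case (elim i)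
    have "infdist (f h i) I \<le> infdist (f h i - scaleC (of_real (2 * norm h)) (f k i)) I
        + infdist (scaleC (of_real (2 * norm h)) (f k i)) I"
      using infdist_ideal_triangle[OF I, of "f h i - scaleC (of_real (2 * norm h)) (f k i)"
          "scaleC (of_real (2 * norm h)) (f k i)"] by simp
    also have "infdist (scaleC (of_real (2 * norm h)) (f k i)) I \<le> cmod (of_real (2 * norm h)) * infdist (f k i) I"
      by (rule infdist_ideal_scaleC_le[OF I])
    also have "\<dots> \<le> (2 * norm h) * 6"
      using mult_left_mono[OF elim(2), of "2 * norm h"] by (simp add: norm_mult)
    finally show ?case using elim(1) by simp
  qed
qed

text \<open>From self-adjoint elements to all elements by the C*-identity; \<open>12\<close> is less than \<open>4\<^sup>2\<close>.\<close>

lemma asymptotic_bound: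
  assumes e: "\<epsilon> > 0"
  shows "eventually (\<lambda>i. infdist (f b i) I \<le> 4 * norm b + \<epsilon>) F"
proof -
  define \<epsilon>' where "\<epsilon>' = min (\<epsilon> / 2) (\<epsilon>\<^sup>2 / 8)"
  have e': "\<epsilon>' > 0" "\<epsilon>' \<le> \<epsilon> / 2" "\<epsilon>' \<le> \<epsilon>\<^sup>2 / 8" using e by (auto simp: \<epsilon>'_def)
  have "star (star b * b) = star b * b" by (simp add: star_simps)
  then have "eventually (\<lambda>i. infdist (f (star b * b) i) I \<le> 12 * norm (star b * b) + \<epsilon>') F"
    by (rule asymptotic_bound_selfadjoint[OF _ e'(1)])
  moreover have "eventually (\<lambda>i. infdist (f (star b * b) i - f (star b) i * f b i) I < \<epsilon>') F"
    using asymptotic_mod_mult e'(1) by (rule order_tendstoD)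
  moreover have "eventually (\<lambda>i. infdist (f (star b) i - star (f b i)) I < \<epsilon>') F"
    using asymptotic_mod_star e'(1) by (rule order_tendstoD)
  ultimately show ?thesis
  proof eventually_elim
    case (elim i)
    define M where "M = infdist (f b i) I"
    have M0: "0 \<le> M" by (simp add: M_def infdist_nonneg)
    have "M\<^sup>2 = infdist (star (f b i) * f b i) I" by (simp add: M_def infdist_ideal_cstar[OF I])
    also have "star (f b i) * f b i = f (star b * b) i
        + (- (f (star b * b) i - f (star b) i * f b i) + - ((f (star b) i - star (f b i)) * f b i))"
      by (simp add: algebra_simps)
    also have "infdist \<dots> I \<le> infdist (f (star b * b) i) I
        + (infdist (f (star b * b) i - f (star b) i * f b i) I + infdist ((f (star b) i - star (f b i)) * f b i) I)"
      using infdist_ideal_triangle[OF I] infdist_ideal_minus[OF I] by (smt (verit))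
    also have "infdist ((f (star b) i - star (f b i)) * f b i) I \<le> \<epsilon>' * M"
      using elim(3) unfolding M_def
      by (intro order_trans[OF infdist_ideal_mult[OF I]] mult_right_mono infdist_nonneg) auto
    also have "infdist (f (star b * b) i) I \<le> 12 * (norm b)\<^sup>2 + \<epsilon>'"
      using elim(1) by (simp add: cstar_identity)
    finally have M2: "M\<^sup>2 \<le> 12 * (norm b)\<^sup>2 + \<epsilon>' + (\<epsilon>' + \<epsilon>' * M)" using elim(2) by linarith
    show "M \<le> 4 * norm b + \<epsilon>"
    proof (rule ccontr)
      assume "\<not> M \<le> 4 * norm b + \<epsilon>"
      then have less: "4 * norm b + \<epsilon> < M" by simp
      have "(4 * norm b + \<epsilon>) * (4 * norm b + \<epsilon> / 2) \<le> M * (M - \<epsilon>')"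
        using less e e' M0 by (intro mult_mono) auto
      also have "\<dots> \<le> 12 * (norm b)\<^sup>2 + 2 * \<epsilon>'" using M2 by (simp add: power2_eq_square algebra_simps)
      also have "\<dots> \<le> 12 * (norm b)\<^sup>2 + \<epsilon>\<^sup>2 / 4" using e' by simp
      also have "\<dots> < (4 * norm b + \<epsilon>) * (4 * norm b + \<epsilon> / 2)"
      proof -
        have "(4 * norm b + \<epsilon>) * (4 * norm b + \<epsilon> / 2) = 16 * (norm b)\<^sup>2 + 6 * (norm b * \<epsilon>) + \<epsilon>\<^sup>2 / 2"
          by (simp add: power2_eq_square algebra_simps)
        moreover have "norm b * \<epsilon> \<ge> 0" "\<epsilon>\<^sup>2 > 0" "(norm b)\<^sup>2 \<ge> 0" using e by auto
        ultimately show ?thesis by linarith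
      qed
      finally show False by simp
    qed
  qed
qed

text \<open>The form in which the bound is used: a relation that holds up to \<open>x - c\<close> in the source holds
  asymptotically up to a multiple of the norm of \<open>x - c\<close>. It makes sense for elements of a dense
  subset that is not closed under the operations.\<close>

lemma asymptotic_defect:
  assumes d: "((\<lambda>i. infdist (f x i - u i) I) \<longlongrightarrow> 0) F" and e: "\<epsilon> > 0"
  shows "eventually (\<lambda>i. infdist (u i - f c i) I \<le> 4 * norm (x - c) + \<epsilon>) F"
proof -
  have e3: "\<epsilon> / 3 > 0" using e by simp
  have "scaleC 1 x + scaleC (- 1) c = x - c" by (simp add: scaleC.minus_left)
  then have lin: "((\<lambda>i. infdist (f (x - c) i - (f x i - f c i)) I) \<longlongrightarrow> 0) F"
    using asymptotic_mod_lin[of 1 x "-1" c] by (simp add: scaleC.minus_left)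
  show ?thesis
    using asymptotic_bound[OF e3, of "x - c"] order_tendstoD(2)[OF lin e3] order_tendstoD(2)[OF d e3]
  proof eventually_elim
    case (elim i)
    have "u i - f c i = f (x - c) i + (- (f (x - c) i - (f x i - f c i)) + - (f x i - u i))" by simp
    also have "infdist \<dots> I \<le> infdist (f (x - c) i) I
        + (infdist (f (x - c) i - (f x i - f c i)) I + infdist (f x i - u i) I)"
      using infdist_ideal_triangle[OF I] infdist_ideal_minus[OF I] by (smt (verit))
    finally show ?case using elim by simp
  qed
qed

lemma asymptotic_defect_mult:
  "\<epsilon> > 0 \<Longrightarrow> eventually (\<lambda>i. infdist (f a i * f b i - f c i) I \<le> 4 * norm (a * b - c) + \<epsilon>) F"
  by (rule asymptotic_defect[OF asymptotic_mod_mult])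

lemma asymptotic_defect_lin:
  "\<epsilon> > 0 \<Longrightarrow> eventually (\<lambda>i. infdist (scaleC \<mu> (f a i) + scaleC \<nu> (f b i) - f c i) I
    \<le> 4 * norm (scaleC \<mu> a + scaleC \<nu> b - c) + \<epsilon>) F"
  by (rule asymptotic_defect[OF asymptotic_mod_lin])

lemma asymptotic_defect_star:
  "\<epsilon> > 0 \<Longrightarrow> eventually (\<lambda>i. infdist (star (f a i) - f c i) I \<le> 4 * norm (star a - c) + \<epsilon>) F"
  by (rule asymptotic_defect[OF asymptotic_mod_star])

end

section \<open>Continuous selections\<close>

lemma continuous_on_if_locally:
  fixes g :: "'a::metric_space \<Rightarrow> 'b::metric_space"
  assumes "\<And>x. x \<in> S \<Longrightarrow> \<exists>V. open V \<and> x \<in> V \<and> continuous_on (V \<inter> S) g"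
  shows "continuous_on S g"
proof (unfold continuous_on_eq_continuous_within, rule ballI)
  fix x assume x: "x \<in> S"
  then obtain V where V: "open V" "x \<in> V" "continuous_on (V \<inter> S) g" using assms by blast
  then have "continuous (at x within V \<inter> S) g"
    using x by (simp add: continuous_on_eq_continuous_within)
  moreover have "at x within S = at x within V \<inter> S"
    by (rule at_within_nhd[OF V(2,1)]) blast
  ultimately show "continuous (at x within S) g" by simp
qed

text \<open>A convex condition that can be solved pointwise by a locally constant choice can be solved
  continuously: glue the local solutions by a partition of unity.\<close>

proposition convex_selection:
  fixes S :: "'a::{metric_space,second_countable_topology} set"
    and P :: "'a \<Rightarrow> 'b::real_normed_vector \<Rightarrow> bool"
  assumes conv: "\<And>x. x \<in> S \<Longrightarrow> convex {y. P x y}"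
    and loc: "\<And>x. x \<in> S \<Longrightarrow> \<exists>y V. open V \<and> x \<in> V \<and> (\<forall>x'\<in>V \<inter> S. P x' y)"
  shows "\<exists>g. continuous_on S g \<and> (\<forall>x\<in>S. P x (g x))"
proof -
  obtain Y V where YV: "\<And>x. x \<in> S \<Longrightarrow> open (V x) \<and> x \<in> V x \<and> (\<forall>x'\<in>V x \<inter> S. P x' (Y x))"
    using loc by metis
  have cover: "S \<subseteq> \<Union> (V ` S)" "\<And>W. W \<in> V ` S \<Longrightarrow> open W" using YV by auto
  have "\<exists>C. S \<subseteq> \<Union> C \<and> (\<forall>U\<in>C. open U \<and> (\<exists>W. W \<in> V ` S \<and> U \<subseteq> W))
      \<and> (\<forall>x\<in>S. \<exists>W. open W \<and> x \<in> W \<and> finite {U. U \<in> C \<and> (U \<inter> W \<noteq> {})})"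
  proof (rule paracompact[OF cover])
    fix C assume a: "S \<subseteq> \<Union> C" and b: "\<And>U. U \<in> C \<Longrightarrow> open U \<and> (\<exists>W. W \<in> V ` S \<and> U \<subseteq> W)"
      and c: "\<And>x. x \<in> S \<Longrightarrow> \<exists>W. open W \<and> x \<in> W \<and> finite {U. U \<in> C \<and> (U \<inter> W \<noteq> {})}"
    show ?thesis by (rule exI[of _ C], rule conjI[OF a], rule conjI; rule ballI) (erule b, erule c)
  qed
  then obtain C where C: "S \<subseteq> \<Union> C" "\<forall>U\<in>C. open U \<and> (\<exists>W. W \<in> V ` S \<and> U \<subseteq> W)"
      "\<forall>x\<in>S. \<exists>W. open W \<and> x \<in> W \<and> finite {U. U \<in> C \<and> (U \<inter> W \<noteq> {})}"
    by (elim exE conjE)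
  have "\<exists>y. \<forall>x\<in>U \<inter> S. P x y" if "U \<in> C" for U
    using bspec[OF C(2) that] YV by blast
  then obtain y where y: "\<And>U x. U \<in> C \<Longrightarrow> x \<in> U \<Longrightarrow> x \<in> S \<Longrightarrow> P x (y U)" by (metis Int_iff)
  have fin: "\<exists>W. open W \<and> x \<in> W \<and> finite {U \<in> C. U \<inter> W \<noteq> {}}" if "x \<in> S" for x
    using bspec[OF C(3) that] by simp
  obtain F :: "'a set \<Rightarrow> 'a \<Rightarrow> real" where F: "\<And>U. U \<in> C \<Longrightarrow> continuous_on S (F U) \<and> (\<forall>x\<in>S. 0 \<le> F U x)"
      "\<And>x U. \<lbrakk>U \<in> C; x \<in> S; x \<notin> U\<rbrakk> \<Longrightarrow> F U x = 0"
      "\<And>x. x \<in> S \<Longrightarrow> supp_sum (\<lambda>W. F W x) C = 1"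
      "\<And>x. x \<in> S \<Longrightarrow> \<exists>W. open W \<and> x \<in> W \<and> finite {U \<in> C. \<exists>x\<in>W. F U x \<noteq> 0}"
  proof (rule subordinate_partition_of_unity[OF C(1) _ fin])
    fix F :: "'a set \<Rightarrow> 'a \<Rightarrow> real"
    assume a: "\<And>U. U \<in> C \<Longrightarrow> continuous_on S (F U) \<and> (\<forall>x\<in>S. 0 \<le> F U x)"
      and b: "\<And>x U. \<lbrakk>U \<in> C; x \<in> S; x \<notin> U\<rbrakk> \<Longrightarrow> F U x = 0"
      and c: "\<And>x. x \<in> S \<Longrightarrow> supp_sum (\<lambda>W. F W x) C = 1"
      and d: "\<And>x. x \<in> S \<Longrightarrow> \<exists>W. open W \<and> x \<in> W \<and> finite {U \<in> C. \<exists>x\<in>W. F U x \<noteq> 0}"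
    show thesis by (rule that[of F]) (fact a, fact b, fact c, fact d)
  qed (use C(2) in blast)+
  define g where "g x = supp_sum (\<lambda>U. F U x *\<^sub>R y U) C" for x
  have "P x (g x)" if x: "x \<in> S" for x
  proof -
    have "supp_sum (\<lambda>U. F U x *\<^sub>R y U) C \<in> {z. P x z}"
    proof (rule convex_supp_sum[OF conv[OF x] F(3)[OF x]])
      fix U assume U: "U \<in> C"
      show "0 \<le> F U x \<and> (F U x = 0 \<or> y U \<in> {z. P x z})"
        using F(1)[OF U] F(2)[OF U x] y[OF U _ x] x by auto
    qed
    then show ?thesis by (simp add: g_def)
  qed
  moreover have "continuous_on S g"
  proof (rule continuous_on_if_locally)
    fix x assume x: "x \<in> S"
    obtain W where W: "open W" "x \<in> W" "finite {U \<in> C. \<exists>x\<in>W. F U x \<noteq> 0}" using F(4)[OF x] by blast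
    let ?N = "{U \<in> C. \<exists>x\<in>W. F U x \<noteq> 0}"
    have eq: "g z = (\<Sum>U\<in>?N. F U z *\<^sub>R y U)" if "z \<in> W \<inter> S" for z
      unfolding g_def supp_sum_def
      by (rule sum.mono_neutral_left[OF W(3)]) (use that in \<open>auto simp: support_on_def\<close>)
    have "continuous_on (W \<inter> S) (\<lambda>z. \<Sum>U\<in>?N. F U z *\<^sub>R y U)"
      by (intro continuous_on_sum continuous_on_scaleR continuous_on_const)
        (use F(1) in \<open>auto intro: continuous_on_subset\<close>)
    then have "continuous_on (W \<inter> S) g" by (rule continuous_on_cong[THEN iffD2, OF refl eq, rotated])
    then show "\<exists>V. open V \<and> x \<in> V \<and> continuous_on (V \<inter> S) g" using W by blast
  qed
  ultimately show ?thesis by blast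
qed

lemma eventually_within_neighbourhood:
  assumes "eventually P (at x within S)" "P x"
  shows "\<exists>V. open V \<and> x \<in> V \<and> (\<forall>z\<in>V \<inter> S. P z)"
  using assms unfolding eventually_at_topological by (metis IntD1 IntD2)

lemma convex_infdist_ideal:
  assumes I: "closed_ideal I"
  shows "convex {y. infdist (y - c) I < r}"
proof (rule convexI, unfold mem_Collect_eq)
  fix x y and u v :: real assume xy: "infdist (x - c) I < r" "infdist (y - c) I < r"
    and uv: "0 \<le> u" "0 \<le> v" "u + v = 1"
  have sc: "infdist (u *\<^sub>R z) I \<le> u * infdist z I" if "0 \<le> u" for u z
    using infdist_ideal_scaleC_le[OF I, of "of_real u" z] that by (simp add: scaleC_of_real)
  have "u *\<^sub>R x + v *\<^sub>R y - c = u *\<^sub>R x + v *\<^sub>R y - (u + v) *\<^sub>R c" using uv by simp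
  also have "\<dots> = u *\<^sub>R (x - c) + v *\<^sub>R (y - c)" by (simp add: algebra_simps)
  finally have "infdist (u *\<^sub>R x + v *\<^sub>R y - c) I \<le> u * infdist (x - c) I + v * infdist (y - c) I"
    using infdist_ideal_triangle[OF I, of "u *\<^sub>R (x - c)" "v *\<^sub>R (y - c)"] sc[OF uv(1)] sc[OF uv(2)]
    by (smt (verit))
  also have "\<dots> < r" using convex_bound_lt[OF xy uv] .
  finally show "infdist (u *\<^sub>R x + v *\<^sub>R y - c) I < r" .
qed

lemma geometric_uniform_limit:
  fixes f :: "nat \<Rightarrow> 'x \<Rightarrow> 'd::banach"
  assumes "\<And>k x. k \<ge> K \<Longrightarrow> x \<in> S \<Longrightarrow> norm (f (Suc k) x - f k x) \<le> (1 / 2) ^ k"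
  shows "uniform_limit S f (\<lambda>x. lim (\<lambda>k. f k x)) sequentially"
proof -
  define L where "L x = suminf (\<lambda>i. f (Suc (i + K)) x - f (i + K) x) + f K x" for x
  have "uniform_limit S (\<lambda>n x. \<Sum>i<n. f (Suc (i + K)) x - f (i + K) x)
      (\<lambda>x. suminf (\<lambda>i. f (Suc (i + K)) x - f (i + K) x)) sequentially"
  proof (rule Weierstrass_m_test[of _ _ "\<lambda>n. (1 / 2) ^ n"])
    fix n x assume "x \<in> S"
    then have "norm (f (Suc (n + K)) x - f (n + K) x) \<le> (1 / 2) ^ (n + K)" by (intro assms) auto
    also have "\<dots> \<le> (1 / 2) ^ n" by (intro power_decreasing) auto
    finally show "norm (f (Suc (n + K)) x - f (n + K) x) \<le> (1 / 2) ^ n" .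
  qed simp
  moreover have "(\<Sum>i<n. f (Suc (i + K)) x - f (i + K) x) = f (n + K) x - f K x" for n x
    using sum_lessThan_telescope[of "\<lambda>i. f (i + K) x" n] by simp
  ultimately have "uniform_limit S (\<lambda>n x. f (n + K) x - f K x)
      (\<lambda>x. suminf (\<lambda>i. f (Suc (i + K)) x - f (i + K) x)) sequentially" by simp
  from uniform_limit_add[OF this uniform_limit_const]
  have "uniform_limit S (\<lambda>n x. f (n + K) x - f K x + f K x) L sequentially" unfolding L_def .
  then have shifted: "uniform_limit S (\<lambda>n x. f (n + K) x) L sequentially" by simp
  have "uniform_limit S f L sequentially"
    unfolding uniform_limit_iff
  proof (intro allI impI)
    fix e :: real assume "e > 0"
    then have "eventually (\<lambda>n. \<forall>x\<in>S. dist (f (n + K) x) (L x) < e) sequentially"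
      using shifted by (simp add: uniform_limit_iff)
    then show "eventually (\<lambda>n. \<forall>x\<in>S. dist (f n x) (L x) < e) sequentially"
      by (rule eventually_sequentially_seg[THEN iffD1])
  qed
  moreover have "lim (\<lambda>k. f k x) = L x" if "x \<in> S" for x
    using tendsto_uniform_limitI[OF \<open>uniform_limit S f L sequentially\<close> that] by (rule limI)
  ultimately show ?thesis by (simp cong: uniform_limit_cong')
qed

text \<open>A function that is continuous modulo the ideal has a continuous lift. It is the uniform limit
  of continuous functions whose distance to a lift modulo the ideal decreases geometrically.\<close>

proposition continuous_lift:
  fixes S :: "'a::{metric_space,second_countable_topology} set" and f :: "'a \<Rightarrow> 'd::cstar_algebra"
  assumes I: "closed_ideal I"
    and f: "\<And>x. x \<in> S \<Longrightarrow> ((\<lambda>y. infdist (f y - f x) I) \<longlongrightarrow> 0) (at x within S)"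
  obtains g where "continuous_on S g" "\<And>x. x \<in> S \<Longrightarrow> g x - f x \<in> I"
proof -
  have I0: "infdist i I = 0" if "i \<in> I" for i using that by simp
  have near: "eventually (\<lambda>z. infdist (f x + i - f z) I < s) (at x within S)" if "x \<in> S" "i \<in> I" "s > 0" for x i s
    using order_tendstoD(2)[OF f[OF that(1)] that(3)]
  proof eventually_elim
    case (elim z)
    have "infdist (f x + i - f z) I = infdist (f x - f z) I"
      by (rule infdist_ideal_cong[OF I]) (use that in simp)
    also have "\<dots> = infdist (f z - f x) I" using infdist_ideal_minus[OF I, of "f z - f x"] by simp
    finally show ?case using elim by simp
  qed
  have start: "\<exists>g. continuous_on S g \<and> (\<forall>x\<in>S. infdist (g x - f x) I < (1 / 2) ^ 0)"
  proof (rule convex_selection[of S "\<lambda>x y. infdist (y - f x) I < (1 / 2) ^ 0"])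
      show "convex {y. infdist (y - f x) I < (1 / 2) ^ 0}" for x by (rule convex_infdist_ideal[OF I])
      fix x assume x: "x \<in> S"
      have "eventually (\<lambda>z. infdist (f x + 0 - f z) I < (1 / 2) ^ 0) (at x within S)"
        using x closed_idealD(1)[OF I] by (intro near) auto
      moreover have "infdist (f x + 0 - f x) I < (1 / 2) ^ 0" using closed_idealD(1)[OF I] by simp
      ultimately show "\<exists>y V. open V \<and> x \<in> V \<and> (\<forall>x'\<in>V \<inter> S. infdist (y - f x') I < (1 / 2) ^ 0)"
        by (intro exI[of _ "f x + 0"] eventually_within_neighbourhood)
  qed
  have step: "\<exists>h. (continuous_on S h \<and> (\<forall>x\<in>S. infdist (h x - f x) I < (1 / 2) ^ Suc n))
      \<and> (\<forall>x\<in>S. norm (h x - g x) < (1 / 2) ^ n)"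
    if g: "continuous_on S g \<and> (\<forall>x\<in>S. infdist (g x - f x) I < (1 / 2) ^ n)" for g n
  proof -
    let ?P = "\<lambda>x y. infdist (y - f x) I < (1 / 2) ^ Suc n \<and> norm (y - g x) < (1 / 2) ^ n"
    have "\<exists>h. continuous_on S h \<and> (\<forall>x\<in>S. ?P x (h x))"
    proof (rule convex_selection[of S ?P])
      fix x assume x: "x \<in> S"
      have "{y. ?P x y} = {y. infdist (y - f x) I < (1 / 2) ^ Suc n} \<inter> ball (g x) ((1 / 2) ^ n)"
        by (auto simp: dist_norm norm_minus_commute)
      then show "convex {y. ?P x y}" by (simp only: convex_Int convex_infdist_ideal[OF I] convex_ball)
      obtain i where i: "i \<in> I" "norm (g x - f x - i) < (1 / 2) ^ n"
        using infdist_less_witness[OF I] g x by blast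
      have "((\<lambda>z. norm (f x + i - g z)) \<longlongrightarrow> norm (f x + i - g x)) (at x within S)"
        using g x by (intro tendsto_intros) (auto simp: continuous_on_def)
      moreover have *: "norm (f x + i - g x) < (1 / 2) ^ n"
        using i(2) norm_minus_commute[of "f x + i" "g x"] by (simp add: algebra_simps)
      ultimately have "eventually (\<lambda>z. norm (f x + i - g z) < (1 / 2) ^ n) (at x within S)"
        by (rule order_tendstoD)
      moreover have "eventually (\<lambda>z. infdist (f x + i - f z) I < (1 / 2) ^ Suc n) (at x within S)"
        by (rule near[OF x i(1)]) simp
      ultimately have "eventually (\<lambda>z. ?P z (f x + i)) (at x within S)" by eventually_elim auto
      moreover have "?P x (f x + i)" using * I0[OF i(1)] by simp
      ultimately show "\<exists>y V. open V \<and> x \<in> V \<and> (\<forall>x'\<in>V \<inter> S. ?P x' y)"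
        by (intro exI[of _ "f x + i"] eventually_within_neighbourhood)
    qed
    then show ?thesis by blast
  qed
  have "\<exists>g. \<forall>n. (continuous_on S (g n) \<and> (\<forall>x\<in>S. infdist (g n x - f x) I < (1 / 2) ^ n))
      \<and> (\<forall>x\<in>S. norm (g (Suc n) x - g n x) < (1 / 2) ^ n)"
    by (rule dependent_nat_choice[of "\<lambda>n g. continuous_on S g \<and> (\<forall>x\<in>S. infdist (g x - f x) I < (1 / 2) ^ n)"
      "\<lambda>n g h. \<forall>x\<in>S. norm (h x - g x) < (1 / 2) ^ n", OF start step])
  then obtain g where g0: "\<forall>n. (continuous_on S (g n) \<and> (\<forall>x\<in>S. infdist (g n x - f x) I < (1 / 2) ^ n))
      \<and> (\<forall>x\<in>S. norm (g (Suc n) x - g n x) < (1 / 2) ^ n)" ..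
  have g: "\<And>n. continuous_on S (g n) \<and> (\<forall>x\<in>S. infdist (g n x - f x) I < (1 / 2) ^ n)"
      "\<And>n. \<forall>x\<in>S. norm (g (Suc n) x - g n x) < (1 / 2) ^ n"
    using g0 by simp_all
  define G where "G x = lim (\<lambda>n. g n x)" for x
  have lim: "uniform_limit S g G sequentially"
    unfolding G_def by (rule geometric_uniform_limit[of 0]) (use g(2) in \<open>auto intro: less_imp_le\<close>)
  have "continuous_on S G"
    by (rule uniform_limit_theorem[OF _ lim]) (use g(1) in \<open>auto intro: always_eventually\<close>)
  moreover have "G x - f x \<in> I" if x: "x \<in> S" for x
  proof -
    have "(\<lambda>n. g n x) \<longlonglongrightarrow> G x" by (rule tendsto_uniform_limitI[OF lim x])
    then have 1: "(\<lambda>n. infdist (g n x - f x) I) \<longlonglongrightarrow> infdist (G x - f x) I"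
      by (intro tendsto_infdist tendsto_diff tendsto_const)
    have "(\<lambda>n. infdist (g n x - f x) I) \<longlonglongrightarrow> 0"
      by (rule tendsto_sandwich[OF _ _ tendsto_const LIMSEQ_power_zero[of "1 / 2 :: real"]])
        (use g(1) x in \<open>auto simp: infdist_nonneg intro!: always_eventually less_imp_le\<close>)
    then have "infdist (G x - f x) I = 0" using 1 LIMSEQ_unique by blast
    then show ?thesis
      using in_closed_iff_infdist_zero[OF closed_idealD(6)[OF I]] closed_idealD(1)[OF I] by blast
  qed
  ultimately show thesis using that by blast
qed

section \<open>The parameter space\<close>

definition param_space :: "(real \<times> real) set" where
  "param_space = {1..} \<times> {0..1}"

text \<open>The limit \<open>\<lambda> \<rightarrow> \<infinity>\<close>, uniformly in the homotopy parameter.\<close>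

definition param_limit :: "(real \<times> real) filter" where
  "param_limit = inf (filtercomap fst at_top) (principal param_space)"

lemma eventually_param_limit:
  "eventually P param_limit \<longleftrightarrow> (\<exists>L. \<forall>l t. L \<le> l \<longrightarrow> 1 \<le> l \<longrightarrow> 0 \<le> t \<longrightarrow> t \<le> 1 \<longrightarrow> P (l, t))"
  unfolding param_limit_def eventually_inf_principal eventually_filtercomap_at_top_linorder param_space_def
  by auto

lemma eventually_param_limit_all:
  assumes "eventually P param_limit"
  shows "eventually (\<lambda>x. \<forall>s\<in>{0..1}. P (fst x, s)) param_limit"
proof -
  obtain L where "\<And>l t. L \<le> l \<Longrightarrow> 1 \<le> l \<Longrightarrow> 0 \<le> t \<Longrightarrow> t \<le> 1 \<Longrightarrow> P (l, t)"
    using assms unfolding eventually_param_limit by blast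
  then show ?thesis unfolding eventually_param_limit by (intro exI[of _ L]) simp
qed

lemma eventually_param_limit_Ball:
  "eventually P param_limit \<longleftrightarrow> (\<exists>L. \<forall>x\<in>param_space. L \<le> fst x \<longrightarrow> P x)"
  unfolding param_limit_def eventually_inf_principal eventually_filtercomap_at_top_linorder
  by (rule arg_cong[where f = Ex], rule ext) auto

lemma eventually_param_limit_ge: "eventually (\<lambda>x. L \<le> fst x \<and> x \<in> param_space) param_limit"
  unfolding eventually_param_limit by (auto simp: param_space_def)

lemma tendsto_zeroI_eventually:
  fixes f :: "'i \<Rightarrow> real"
  assumes "\<And>i. f i \<ge> 0" "\<And>\<epsilon>. \<epsilon> > 0 \<Longrightarrow> eventually (\<lambda>i. f i \<le> \<epsilon>) F"
  shows "(f \<longlongrightarrow> 0) F"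
proof (rule tendstoI)
  fix e :: real assume "e > 0"
  then have "eventually (\<lambda>i. f i \<le> e / 2) F" by (intro assms) simp
  then show "eventually (\<lambda>i. dist (f i) 0 < e) F"
    by eventually_elim (use assms(1) \<open>e > 0\<close> in \<open>auto intro: le_less_trans\<close>)
qed

lemma filterlim_fst_param_limit: "filterlim fst at_top param_limit"
  unfolding param_limit_def by (rule filterlim_mono[OF filterlim_filtercomap]) auto

lemma filterlim_param_limit_at: "t \<in> {0..1} \<Longrightarrow> filterlim (\<lambda>l. (l, t)) param_limit at_top"
  unfolding filterlim_iff eventually_param_limit
proof (intro allI impI, elim exE)
  fix P :: "real \<times> real \<Rightarrow> bool" and L
  assume t: "t \<in> {0..1}" and L: "\<forall>l t. L \<le> l \<longrightarrow> 1 \<le> l \<longrightarrow> 0 \<le> t \<longrightarrow> t \<le> 1 \<longrightarrow> P (l, t)"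
  show "eventually (\<lambda>l. P (l, t)) at_top"
    using eventually_ge_at_top[of "max L 1"] by eventually_elim (use t L in auto)
qed

lemma tendsto_param_limitI:
  fixes h :: "real \<times> real \<Rightarrow> real"
  assumes h: "\<And>x. x \<in> param_space \<Longrightarrow> 0 \<le> h x \<and> h x \<le> H (fst x)" and H: "(H \<longlongrightarrow> 0) at_top"
  shows "(h \<longlongrightarrow> 0) param_limit"
proof (rule tendsto_sandwich[OF _ _ tendsto_const])
  show "((\<lambda>x. H (fst x)) \<longlongrightarrow> 0) param_limit"
    by (rule filterlim_compose[OF H filterlim_fst_param_limit])
  show "eventually (\<lambda>x. 0 \<le> h x) param_limit" "eventually (\<lambda>x. h x \<le> H (fst x)) param_limit"
    using eventually_param_limit_ge[of 0] by (eventually_elim, use h in blast)+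
qed

lemma Sup_tendsto_param_limit:
  fixes h :: "real \<times> real \<Rightarrow> real"
  assumes h: "(h \<longlongrightarrow> 0) param_limit" and k: "\<And>l t. 1 \<le> l \<Longrightarrow> t \<in> {0..1} \<Longrightarrow> k l t = h (l, t)"
  shows "((\<lambda>l. SUP t\<in>{0..1}. k l t) \<longlongrightarrow> 0) at_top"
proof (rule tendstoI)
  fix e :: real assume e: "e > 0"
  then have "eventually (\<lambda>x. dist (h x) 0 < e / 2) param_limit" using h by (intro tendstoD) auto
  then obtain L where L: "\<forall>l t. L \<le> l \<longrightarrow> 1 \<le> l \<longrightarrow> 0 \<le> t \<longrightarrow> t \<le> 1 \<longrightarrow> dist (h (l, t)) 0 < e / 2"
    unfolding eventually_param_limit by blast
  show "eventually (\<lambda>l. dist (SUP t\<in>{0..1}. k l t) 0 < e) at_top"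
    using eventually_ge_at_top[of "max L 1"]
  proof eventually_elim
    case (elim l)
    have "\<bar>SUP t\<in>{0..1}. k l t\<bar> \<le> e / 2"
    proof (rule cSup_abs_le)
      fix y assume "y \<in> k l ` {0..1}"
      then obtain t where t: "t \<in> {0..1}" "y = k l t" by blast
      then have "dist (h (l, t)) 0 < e / 2" using L elim by auto
      then show "\<bar>y\<bar> \<le> e / 2" using k[of l t] t elim by simp
    qed simp
    then show ?case using e by simp
  qed
qed

section \<open>Sliding along the homotopy\<close>

lemma uniform_step_size:
  fixes G :: "'b \<Rightarrow> real \<times> real \<Rightarrow> 'd::real_normed_vector" and \<alpha> :: "nat \<Rightarrow> 'b"
  assumes G: "\<And>a. continuous_on param_space (G a)"
  shows "\<exists>M\<ge>1. \<forall>l\<in>{1..real n + 1}. \<forall>j\<le>n + 1. \<forall>s\<in>{0..1}. \<forall>s'\<in>{0..1}.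
    \<bar>s - s'\<bar> \<le> 1 / M \<longrightarrow> norm (G (\<alpha> j) (l, s) - G (\<alpha> j) (l, s')) \<le> 1 / (real n + 1)"
proof -
  let ?K = "{1..real n + 1} \<times> {0..1::real}"
  have "\<exists>d>0. \<forall>x\<in>?K. \<forall>x'\<in>?K. dist x' x < d \<longrightarrow> dist (G (\<alpha> j) x') (G (\<alpha> j) x) < 1 / (real n + 1)" for j :: nat
  proof -
    have "uniformly_continuous_on ?K (G (\<alpha> j))"
      by (intro compact_uniformly_continuous compact_Times compact_Icc continuous_on_subset[OF G])
        (auto simp: param_space_def)
    then show ?thesis unfolding uniformly_continuous_on_def by simp
  qed
  then obtain d where d: "\<And>j. d j > 0"
      "\<And>j x x'. x \<in> ?K \<Longrightarrow> x' \<in> ?K \<Longrightarrow> dist x' x < d j \<Longrightarrow> dist (G (\<alpha> j) x') (G (\<alpha> j) x) < 1 / (real n + 1)"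
    by metis
  define e where "e = Min (d ` {..n + 1})"
  have e: "e > 0" "\<And>j. j \<le> n + 1 \<Longrightarrow> e \<le> d j" using d(1) by (auto simp: e_def)
  show ?thesis
  proof (intro exI[of _ "max 1 (2 / e)"] conjI ballI allI impI)
    fix l j s s' assume l: "l \<in> {1..real n + 1}" and j: "j \<le> n + 1" and s: "s \<in> {0..1::real}" "s' \<in> {0..1}"
      and le: "\<bar>s - s'\<bar> \<le> 1 / max 1 (2 / e)"
    have "1 / max 1 (2 / e) \<le> 1 / (2 / e)" using e(1) by (intro divide_left_mono) auto
    then have "\<bar>s - s'\<bar> < d j" using le e(1) e(2)[OF j] by simp
    then have "dist (l, s) (l, s') < d j" by (simp add: dist_Pair_Pair dist_real_def)
    then have "dist (G (\<alpha> j) (l, s)) (G (\<alpha> j) (l, s')) < 1 / (real n + 1)"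
      using l s by (intro d(2)) auto
    then show "norm (G (\<alpha> j) (l, s) - G (\<alpha> j) (l, s')) \<le> 1 / (real n + 1)" by (simp add: dist_norm)
  qed simp
qed

text \<open>How many steps suffice is a locally bounded function of the parameter \<open>l\<close>. It is majorised by a
  continuous one, so that the slide along the homotopy depends continuously on \<open>l\<close>.\<close>

lemma continuous_step_size:
  fixes G :: "'b \<Rightarrow> real \<times> real \<Rightarrow> 'd::real_normed_vector" and \<alpha> :: "nat \<Rightarrow> 'b"
  assumes G: "\<And>a. continuous_on param_space (G a)"
  shows "\<exists>N. continuous_on {1::real..} N \<and> (\<forall>l\<ge>1. N l \<ge> (1::real) \<and>
    (\<forall>j s s'. real j \<le> l \<longrightarrow> s \<in> {0..1} \<longrightarrow> s' \<in> {0..1} \<longrightarrow> \<bar>s - s'\<bar> \<le> 1 / N l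
      \<longrightarrow> norm (G (\<alpha> j) (l, s) - G (\<alpha> j) (l, s')) \<le> 1 / l))"
proof -
  have "\<forall>n. \<exists>M\<ge>1. \<forall>l\<in>{1..real n + 1}. \<forall>j\<le>n + 1. \<forall>s\<in>{0..1}. \<forall>s'\<in>{0..1}.
    \<bar>s - s'\<bar> \<le> 1 / M \<longrightarrow> norm (G (\<alpha> j) (l, s) - G (\<alpha> j) (l, s')) \<le> 1 / (real n + 1)"
    using uniform_step_size[of G, OF G] by blast
  then obtain M where M: "\<forall>n. M n \<ge> 1 \<and> (\<forall>l\<in>{1..real n + 1}. \<forall>j\<le>n + 1. \<forall>s\<in>{0..1}. \<forall>s'\<in>{0..1}.
      \<bar>s - s'\<bar> \<le> 1 / M n \<longrightarrow> norm (G (\<alpha> j) (l, s) - G (\<alpha> j) (l, s')) \<le> 1 / (real n + 1))"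
    by metis
  have "\<exists>N. continuous_on {1::real..} N \<and> (\<forall>l\<in>{1..}. \<forall>n. real n \<le> l \<longrightarrow> M n \<le> N l)"
  proof (rule convex_selection)
    fix l :: real
    have "{y. \<forall>n. real n \<le> l \<longrightarrow> M n \<le> y} = (\<Inter>n\<in>{n. real n \<le> l}. {M n..})" by auto
    then show "convex {y. \<forall>n. real n \<le> l \<longrightarrow> M n \<le> y}" by (simp add: convex_INT)
    define y where "y = Max (insert 0 (M ` {n. real n \<le> l + 1}))"
    have "finite {n. real n \<le> l + 1}"
      by (rule finite_subset[of _ "{..nat \<lceil>l + 1\<rceil>}"]) (auto, linarith)
    then have "M n \<le> y" if "real n \<le> l + 1" for n using that by (auto simp: y_def)
    then show "\<exists>y V. open V \<and> l \<in> V \<and> (\<forall>l'\<in>V \<inter> {1..}. \<forall>n. real n \<le> l' \<longrightarrow> M n \<le> y)"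
      by (intro exI[of _ y] exI[of _ "{l - 1<..<l + 1}"]) auto
  qed
  then obtain N where N: "continuous_on {1::real..} N" "\<And>l n. l \<ge> 1 \<Longrightarrow> real n \<le> l \<Longrightarrow> M n \<le> N l" by auto
  show ?thesis
  proof (intro exI[of _ N] conjI N(1) allI impI)
    show N1: "N l \<ge> 1" if "l \<ge> 1" for l using N(2)[of l 0] M that order_trans by fastforce
    fix l s s' :: real and j :: nat
    assume l: "l \<ge> 1" and j: "real j \<le> l" and s: "s \<in> {0..1}" "s' \<in> {0..1}" "\<bar>s - s'\<bar> \<le> 1 / N l"
    define n where "n = nat \<lfloor>l\<rfloor>"
    have n: "real n \<le> l" "l \<le> real n + 1" using l unfolding n_def by linarith+
    have j': "j \<le> n + 1" using j n by linarith
    have "1 / N l \<le> 1 / M n" using N(2)[OF l n(1)] M[rule_format, of n] by (intro divide_left_mono) auto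
    then have "\<bar>s - s'\<bar> \<le> 1 / M n" using s by linarith
    then have "norm (G (\<alpha> j) (l, s) - G (\<alpha> j) (l, s')) \<le> 1 / (real n + 1)"
      using M l n j' s by simp
    also have "\<dots> \<le> 1 / l" using l n by (intro divide_left_mono) auto
    finally show "norm (G (\<alpha> j) (l, s) - G (\<alpha> j) (l, s')) \<le> 1 / l" .
  qed
qed

text \<open>The fraction of the homotopy that is covered at parameter \<open>l\<close> after \<open>k\<close> steps. The motion
  starts at step \<open>l\<close> and takes about \<open>N l\<close> steps.\<close>

definition slide :: "(real \<Rightarrow> real) \<Rightarrow> nat \<Rightarrow> real \<Rightarrow> real" where
  "slide N k l = max 0 (min 1 ((real k - l) / N l))"

lemma slide_range: "0 \<le> slide N k l" "slide N k l \<le> 1"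
  by (auto simp: slide_def)

lemma slide_before: "N l \<ge> 1 \<Longrightarrow> real k \<le> l \<Longrightarrow> slide N k l = 0"
  by (auto simp: slide_def divide_nonpos_pos)

lemma slide_after: "N l \<ge> 1 \<Longrightarrow> l + N l \<le> real k \<Longrightarrow> slide N k l = 1"
  by (auto simp: slide_def)

lemma slide_step: "N l \<ge> 1 \<Longrightarrow> \<bar>slide N (Suc k) l - slide N k l\<bar> \<le> 1 / N l"
proof -
  assume N: "N l \<ge> 1"
  have "(real (Suc k) - l) / N l = (real k - l) / N l + 1 / N l" by (simp add: add_divide_distrib diff_divide_distrib)
  moreover have "1 / N l \<ge> 0" using N by simp
  ultimately show ?thesis unfolding slide_def by linarith
qed

definition slide_along :: "(real \<Rightarrow> real) \<Rightarrow> nat \<Rightarrow> (real \<times> real \<Rightarrow> 'd) \<Rightarrow> real \<times> real \<Rightarrow> 'd" where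
  "slide_along N k u x = u (fst x, snd x * slide N k (fst x))"

lemma slide_along_in_param_space: "x \<in> param_space \<Longrightarrow> (fst x, snd x * slide N k (fst x)) \<in> param_space"
  using slide_range[of N k "fst x"] by (auto simp: param_space_def intro: mult_le_one)

lemma continuous_on_slide_along:
  assumes N: "continuous_on {1..} N" "\<And>l. l \<ge> 1 \<Longrightarrow> N l \<ge> (1::real)" and u: "continuous_on param_space u"
  shows "continuous_on param_space (slide_along N k u)"
  unfolding slide_along_def
proof (rule continuous_on_compose2[OF u])
  have "continuous_on param_space (\<lambda>x. N (fst x))"
    by (rule continuous_on_compose2[OF N(1)]) (auto intro!: continuous_intros simp: param_space_def)
  moreover have "N (fst x) \<noteq> 0" if "x \<in> param_space" for x
    using N(2)[of "fst x"] that by (auto simp: param_space_def)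
  ultimately show "continuous_on param_space (\<lambda>x. (fst x, snd x * slide N k (fst x)))"
    unfolding slide_def by (intro continuous_intros continuous_on_max continuous_on_min) auto
qed (use slide_along_in_param_space in blast)

section \<open>The iteration\<close>

text \<open>One step, with tolerance \<open>2\<^sup>-\<^sup>k\<close>. It controls the members of the sequence with index at most
  \<open>k\<close>, and the parameters up to \<open>k + 1\<close>, which include all those at which the motion has begun. The
  same \<open>e\<close> serves for all parameters, so that continuity is preserved.\<close>

definition good_step :: "'d::cstar_algebra set \<Rightarrow> (nat \<Rightarrow> 'b) \<Rightarrow> nat \<Rightarrow> ('b \<Rightarrow> real \<times> real \<Rightarrow> 'd) \<Rightarrow>
    ('b \<Rightarrow> real \<times> real \<Rightarrow> 'd) \<Rightarrow> ('b \<Rightarrow> real \<times> real \<Rightarrow> 'd) \<Rightarrow> bool" where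
  "good_step I \<alpha> k g T T' \<longleftrightarrow> (\<exists>e\<in>I. T' = (\<lambda>a x. blend e (T a x) (g a x))) \<and>
    (\<forall>x\<in>param_space. fst x \<le> real k + 1 \<longrightarrow> (\<forall>a\<in>\<alpha> ` {..k}.
      norm (T' a x - T a x) \<le> infdist (g a x - T a x) I + (1 / 2) ^ k \<and>
      (\<forall>b\<in>\<alpha> ` {..k}.
        norm (star (T' a x) - T' b x) \<le> max (norm (star (T a x) - T b x)) (infdist (star (g a x) - g b x) I) + (1 / 2) ^ k \<and>
        (\<forall>c\<in>\<alpha> ` {..k}.
          norm (T' a x * T' b x - T' c x) \<le> max (norm (T a x * T b x - T c x))
            (infdist (g a x * g b x - g c x) I + infdist (g a x - T a x) I * infdist (g b x - T b x) I) + (1 / 2) ^ k \<and>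
          (\<forall>\<mu> \<nu>. cmod \<mu> \<le> real k \<longrightarrow> cmod \<nu> \<le> real k \<longrightarrow>
            norm (scaleC \<mu> (T' a x) + scaleC \<nu> (T' b x) - T' c x)
              \<le> max (norm (scaleC \<mu> (T a x) + scaleC \<nu> (T b x) - T c x))
                  (infdist (scaleC \<mu> (g a x) + scaleC \<nu> (g b x) - g c x) I) + (1 / 2) ^ k)))))"

lemma good_step_exists:
  fixes I :: "'d::cstar_algebra set" and \<alpha> :: "nat \<Rightarrow> 'b" and T g :: "'b \<Rightarrow> real \<times> real \<Rightarrow> 'd"
  assumes I: "closed_ideal I"
    and T: "\<And>a. continuous_on param_space (T a)" and g: "\<And>a. continuous_on param_space (g a)"
  shows "\<exists>T'. good_step I \<alpha> k g T T'"
proof -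
  define S where "S = {1..real k + 1} \<times> {0..1::real}"
  define K where "K = (\<Union>j\<le>k. T (\<alpha> j) ` S \<union> g (\<alpha> j) ` S)"
  have S: "compact S" "S \<subseteq> param_space" unfolding S_def param_space_def by (auto intro: compact_Times)
  have K: "compact K" unfolding K_def
    by (intro compact_UN compact_Un compact_continuous_image continuous_on_subset[OF T S(2)]
        continuous_on_subset[OF g S(2)] S) auto
  have mem: "T a x \<in> K" "g a x \<in> K" if "a \<in> \<alpha> ` {..k}" "x \<in> param_space" "fst x \<le> real k + 1" for a x
  proof -
    have "x \<in> S" using that by (auto simp: S_def param_space_def)
    then show "T a x \<in> K" "g a x \<in> K" using that(1) by (auto simp: K_def)
  qed
  have pos: "(1 / 2 :: real) ^ k > 0" by simp
  obtain e where e: "e \<in> I"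
    "\<And>y1 y2 y3 g1 g2 g3. {y1, y2, y3, g1, g2, g3} \<subseteq> K \<Longrightarrow>
      norm (blend e y1 g1 * blend e y2 g2 - blend e y3 g3)
        \<le> max (norm (y1 * y2 - y3)) (infdist (g1 * g2 - g3) I + infdist (g1 - y1) I * infdist (g2 - y2) I) + (1 / 2) ^ k"
    "\<And>y1 y2 y3 g1 g2 g3 \<mu> \<nu>. {y1, y2, y3, g1, g2, g3} \<subseteq> K \<Longrightarrow> cmod \<mu> \<le> real k \<Longrightarrow> cmod \<nu> \<le> real k \<Longrightarrow>
      norm (scaleC \<mu> (blend e y1 g1) + scaleC \<nu> (blend e y2 g2) - blend e y3 g3)
        \<le> max (norm (scaleC \<mu> y1 + scaleC \<nu> y2 - y3)) (infdist (scaleC \<mu> g1 + scaleC \<nu> g2 - g3) I) + (1 / 2) ^ k"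
    "\<And>y1 y2 g1 g2. {y1, y2, g1, g2} \<subseteq> K \<Longrightarrow>
      norm (star (blend e y1 g1) - blend e y2 g2)
        \<le> max (norm (star y1 - y2)) (infdist (star g1 - g2) I) + (1 / 2) ^ k"
    "\<And>y g. {y, g} \<subseteq> K \<Longrightarrow> norm (blend e y g - y) \<le> infdist (g - y) I + (1 / 2) ^ k"
    using blend_step[OF I K pos, of "real k"] by blast
  have "good_step I \<alpha> k g T (\<lambda>a x. blend e (T a x) (g a x))"
    unfolding good_step_def
    by (intro conjI ballI impI allI bexI[OF refl e(1)] e(2-5)) (simp_all add: mem)
  then show ?thesis by (intro exI[of _ "\<lambda>a x. blend e (T a x) (g a x)"])
qed

lemma continuous_on_blend:
  assumes "continuous_on S y" "continuous_on S g"
  shows "continuous_on S (\<lambda>x. blend e (y x) (g x))"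
  unfolding blend_def by (intro continuous_intros assms)

lemma blend_mod_ideal: "closed_ideal I \<Longrightarrow> e \<in> I \<Longrightarrow> blend e y g - g \<in> I"
  using closed_idealD(5)[of I e y] closed_idealD(5)[of I e g] closed_ideal_diff[of I "e * y" "e * g"]
  by (simp add: blend_def)

lemma blend_same: "blend e y y = y"
  by (simp add: blend_def)

text \<open>The term \<open>2 (1 / 2)\<^sup>k\<close> is the sum of the tolerances that are still to come.\<close>

lemma max_recursion:
  fixes d :: "nat \<Rightarrow> real"
  assumes "\<And>k. k \<ge> m \<Longrightarrow> d (Suc k) \<le> max (d k) E + (1 / 2) ^ k" and "k \<ge> m"
  shows "d k \<le> max (d m) E + 2 * (1 / 2) ^ m - 2 * (1 / 2) ^ k"
  using \<open>k \<ge> m\<close>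
proof (induction k rule: dec_induct)
  case (step k)
  have "d (Suc k) \<le> max (d k) E + (1 / 2) ^ k" using step by (intro assms(1)) auto
  moreover have "(1 / 2 :: real) ^ k \<le> (1 / 2) ^ m" using step by (intro power_decreasing) auto
  moreover have "(1 / 2 :: real) ^ Suc k = (1 / 2) * (1 / 2) ^ k" by simp
  ultimately show ?case using step.IH by linarith
qed simp

text \<open>Defects that obey the recursion from step \<open>l\<close> on stay small: the tolerances used at parameter
  \<open>l\<close> sum up to at most \<open>4 (1 / 2)\<^sup>l\<close>, however many steps the motion takes.\<close>

lemma defect_limit:
  fixes d :: "nat \<Rightarrow> real \<times> real \<Rightarrow> real"
  assumes step: "\<And>\<epsilon>. \<epsilon> > 0 \<Longrightarrow> eventually (\<lambda>x. \<forall>k\<ge>nat \<lfloor>fst x\<rfloor>. d (Suc k) x \<le> max (d k x) (c + \<epsilon>) + (1 / 2) ^ k) param_limit"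
    and start: "\<And>\<epsilon>. \<epsilon> > 0 \<Longrightarrow> eventually (\<lambda>x. d (nat \<lfloor>fst x\<rfloor>) x \<le> c + \<epsilon>) param_limit"
    and lim: "\<And>x. x \<in> param_space \<Longrightarrow> (\<lambda>k. d k x) \<longlonglongrightarrow> D x" and e: "\<epsilon> > 0"
  shows "eventually (\<lambda>x. D x \<le> c + \<epsilon>) param_limit"
proof -
  have e2: "\<epsilon> / 2 > 0" using e by simp
  have "(\<lambda>n. 2 * (1 / 2 :: real) ^ n) \<longlonglongrightarrow> 2 * 0" by (intro tendsto_intros LIMSEQ_power_zero) simp
  then have "eventually (\<lambda>n. 2 * (1 / 2 :: real) ^ n < \<epsilon> / 2) sequentially"
    by (rule order_tendstoD(2)) (use e in simp)
  then obtain m where m: "\<And>n. n \<ge> m \<Longrightarrow> 2 * (1 / 2 :: real) ^ n < \<epsilon> / 2"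
    unfolding eventually_sequentially by blast
  show ?thesis
    using step[OF e2] start[OF e2] eventually_param_limit_ge[of "real m"]
  proof eventually_elim
    case (elim x)
    let ?n = "nat \<lfloor>fst x\<rfloor>"
    have "?n \<ge> m" using elim(3) by (auto simp: le_nat_floor)
    have "d k x \<le> c + \<epsilon>" if "k \<ge> ?n" for k
    proof -
      have "d k x \<le> max (d ?n x) (c + \<epsilon> / 2) + 2 * (1 / 2) ^ ?n - 2 * (1 / 2) ^ k"
        by (rule max_recursion) (use elim(1) that in auto)
      moreover have "(1 / 2 :: real) ^ k \<ge> 0" by simp
      ultimately show ?thesis using elim(2) m[OF \<open>?n \<ge> m\<close>] by linarith
    qed
    then have "eventually (\<lambda>k. d k x \<le> c + \<epsilon>) sequentially" unfolding eventually_sequentially by blast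
    then show ?case using lim elim(3) by (intro tendsto_upperbound[OF _ _ sequentially_bot]) auto
  qed
qed

lemma finite_subset_range:
  assumes "finite A" "A \<subseteq> range \<alpha>"
  obtains m :: nat where "A \<subseteq> \<alpha> ` {..m}"
proof -
  obtain C where C: "finite C" "A = \<alpha> ` C" using finite_subset_image[OF assms] by blast
  have "C \<subseteq> {..Max (insert 0 C)}" using C(1) by auto
  then show thesis using that C(2) by blast
qed

text \<open>At parameter \<open>l\<close> the iteration starts at step \<open>l\<close> from the lift at the end \<open>0\<close> of the
  homotopy and slides to the prescribed class in steps of size at most \<open>1 / l\<close> modulo the ideal. It
  converges, since once the class is reached all further changes are within the tolerances.\<close>

proposition lift_on_sequence:
  fixes I :: "'d::cstar_algebra set" and G :: "'b::cstar_algebra \<Rightarrow> real \<times> real \<Rightarrow> 'd" and \<alpha> :: "nat \<Rightarrow> 'b"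
  assumes I: "closed_ideal I" and G: "\<And>a. continuous_on param_space (G a)"
    and hom: "asymptotic_mod I param_limit G"
    and bottom: "asymptotic_mod {0} param_limit (\<lambda>a x. G a (fst x, 0))"
  obtains T where "\<And>a. a \<in> range \<alpha> \<Longrightarrow> continuous_on param_space (T a)"
    "\<And>a x. a \<in> range \<alpha> \<Longrightarrow> x \<in> param_space \<Longrightarrow> T a x - G a x \<in> I"
    "\<And>a b c \<epsilon>. {a, b, c} \<subseteq> range \<alpha> \<Longrightarrow> \<epsilon> > 0 \<Longrightarrow>
      eventually (\<lambda>x. norm (T a x * T b x - T c x) \<le> 4 * norm (a * b - c) + \<epsilon>) param_limit"
    "\<And>a b c \<mu> \<nu> \<epsilon>. {a, b, c} \<subseteq> range \<alpha> \<Longrightarrow> \<epsilon> > 0 \<Longrightarrow>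
      eventually (\<lambda>x. norm (scaleC \<mu> (T a x) + scaleC \<nu> (T b x) - T c x)
        \<le> 4 * norm (scaleC \<mu> a + scaleC \<nu> b - c) + \<epsilon>) param_limit"
    "\<And>a b \<epsilon>. {a, b} \<subseteq> range \<alpha> \<Longrightarrow> \<epsilon> > 0 \<Longrightarrow>
      eventually (\<lambda>x. norm (star (T a x) - T b x) \<le> 4 * norm (star a - b) + \<epsilon>) param_limit"
proof -
  obtain N where N0: "continuous_on {1::real..} N" "\<forall>l\<ge>1. N l \<ge> (1::real) \<and>
    (\<forall>j s s'. real j \<le> l \<longrightarrow> s \<in> {0..1} \<longrightarrow> s' \<in> {0..1} \<longrightarrow> \<bar>s - s'\<bar> \<le> 1 / N l
      \<longrightarrow> norm (G (\<alpha> j) (l, s) - G (\<alpha> j) (l, s')) \<le> 1 / l)"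
    using continuous_step_size[of G \<alpha>, OF G] by (elim exE conjE)
  have N: "continuous_on {1..} N" "\<And>l. l \<ge> 1 \<Longrightarrow> N l \<ge> 1"
    "\<And>l j s s'. \<lbrakk>l \<ge> 1; real j \<le> l; s \<in> {0..1}; s' \<in> {0..1}; \<bar>s - s'\<bar> \<le> 1 / N l\<rbrakk>
      \<Longrightarrow> norm (G (\<alpha> j) (l, s) - G (\<alpha> j) (l, s')) \<le> 1 / l"
    using N0 by simp_all
  define g where "g k a = slide_along N k (G a)" for k a
  have gcont: "continuous_on param_space (g k a)" for k a
    unfolding g_def by (rule continuous_on_slide_along[OF N(1,2) G])
  have l1: "fst x \<ge> 1" "0 \<le> snd x" "snd x \<le> 1" if "x \<in> param_space" for x
    using that by (auto simp: param_space_def)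
  have N1: "N (fst x) \<ge> 1" if "x \<in> param_space" for x using N(2) l1(1)[OF that] .
  have g0: "g k a x = G a (fst x, 0)" if "x \<in> param_space" "real k \<le> fst x" for k a x
    using slide_before[of N "fst x", OF N1[OF that(1)] that(2)] by (simp add: g_def slide_along_def)
  have g1: "g k a x = G a x" if "x \<in> param_space" "fst x + N (fst x) \<le> real k" for k a x
    using slide_after[of N "fst x", OF N1[OF that(1)] that(2)] by (simp add: g_def slide_along_def)
  \<comment> \<open>The invariant: \<open>T a\<close> lifts the class prescribed after \<open>k\<close> steps, and nothing has moved at
    parameters from \<open>k\<close> on.\<close>
  define P where "P k T \<longleftrightarrow> (\<forall>a. continuous_on param_space (T a) \<and>
      (\<forall>x\<in>param_space. T a x - g k a x \<in> I \<and> (real k \<le> fst x \<longrightarrow> T a x = G a (fst x, 0))))" for k T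
  define Q where "Q k = good_step I \<alpha> k (g (Suc k))" for k
  have start: "\<exists>T. P 0 T"
  proof (intro exI[of _ "\<lambda>a x. G a (fst x, 0)"])
    have "continuous_on param_space (\<lambda>x. G a (fst x, 0))" for a
      by (rule continuous_on_compose2[OF G]) (auto intro!: continuous_intros simp: param_space_def)
    then show "P 0 (\<lambda>a x. G a (fst x, 0))"
      using l1 closed_idealD(1)[OF I] by (force simp: P_def g0)
  qed
  have step: "\<exists>T'. P (Suc k) T' \<and> Q k T T'" if PT: "P k T" for k T
  proof -
    have "continuous_on param_space (T a)" for a using PT by (simp add: P_def)
    then obtain T' where T': "good_step I \<alpha> k (g (Suc k)) T T'"
      using good_step_exists[OF I, of T "g (Suc k)"] gcont by blast
    then obtain e where e: "e \<in> I" "T' = (\<lambda>a x. blend e (T a x) (g (Suc k) a x))"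
      unfolding good_step_def by blast
    have "P (Suc k) T'" unfolding P_def
    proof (intro allI conjI ballI impI)
      fix a show "continuous_on param_space (T' a)"
        unfolding e(2) using PT gcont by (intro continuous_on_blend) (auto simp: P_def)
      fix x assume x: "x \<in> param_space"
      show "T' a x - g (Suc k) a x \<in> I" unfolding e(2) by (rule blend_mod_ideal[OF I e(1)])
      assume le: "real (Suc k) \<le> fst x"
      then have "T a x = G a (fst x, 0)" "g (Suc k) a x = G a (fst x, 0)"
        using PT x g0[OF x le] by (auto simp: P_def)
      then show "T' a x = G a (fst x, 0)" unfolding e(2) by (simp add: blend_same)
    qed
    with T' show ?thesis by (auto simp: Q_def)
  qed
  have "\<exists>T. \<forall>k. P k (T k) \<and> Q k (T k) (T (Suc k))"
    by (rule dependent_nat_choice) (use start step in blast)+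
  then obtain T where PT: "\<And>k. P k (T k)" and QT: "\<And>k. Q k (T k) (T (Suc k))" by blast
  have Tcont: "continuous_on param_space (T k a)" for k a using PT by (auto simp: P_def)
  have Tmod: "T k a x - g k a x \<in> I" if "x \<in> param_space" for k a x using PT that by (auto simp: P_def)
  have Tstart: "T k a x = G a (fst x, 0)" if "x \<in> param_space" "real k \<le> fst x" for k a x
    using PT that by (auto simp: P_def)
  have move: "infdist (g (Suc k) a x - T k a x) I = infdist (g (Suc k) a x - g k a x) I"
    if "x \<in> param_space" for k a x
    using closed_ideal_minus[OF I Tmod[OF that]] by (intro infdist_ideal_cong[OF I]) simp
  have move_small: "infdist (g (Suc k) a x - T k a x) I \<le> 1 / fst x"
    if x: "x \<in> param_space" and a: "a = \<alpha> j" "real j \<le> fst x" for k a x j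
  proof -
    have "\<bar>slide N (Suc k) (fst x) - slide N k (fst x)\<bar> \<le> 1 / N (fst x)"
      by (rule slide_step[of N "fst x", OF N1[OF x]])
    then have "snd x * \<bar>slide N (Suc k) (fst x) - slide N k (fst x)\<bar> \<le> 1 * (1 / N (fst x))"
      using l1[OF x] by (intro mult_mono) auto
    moreover have "\<bar>snd x * slide N (Suc k) (fst x) - snd x * slide N k (fst x)\<bar>
        = snd x * \<bar>slide N (Suc k) (fst x) - slide N k (fst x)\<bar>"
      using l1[OF x] by (simp add: abs_mult flip: right_diff_distrib)
    moreover have "snd x * slide N k' (fst x) \<in> {0..1}" for k'
      using slide_along_in_param_space[OF x, of N k'] by (auto simp: param_space_def)
    ultimately have "norm (g (Suc k) a x - g k a x) \<le> 1 / fst x"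
      unfolding g_def slide_along_def a(1) using l1[OF x] a(2) by (intro N(3)) auto
    then show ?thesis unfolding move[OF x] by (rule order_trans[OF infdist_ideal_le_norm[OF I]])
  qed
  have gs: "fst x \<le> real k + 1 \<Longrightarrow> x \<in> param_space \<Longrightarrow> a \<in> \<alpha> ` {..k} \<Longrightarrow>
      norm (T (Suc k) a x - T k a x) \<le> infdist (g (Suc k) a x - T k a x) I + (1 / 2) ^ k" for k a x
    using QT[of k] unfolding Q_def good_step_def by blast
  define Tlim where "Tlim a x = lim (\<lambda>k. T k a x)" for a x
  have unif: "uniform_limit ({1..real n} \<times> {0..1}) (\<lambda>k. T k a) (Tlim a) sequentially"
    if a: "a \<in> range \<alpha>" for a n
  proof -
    obtain j where j: "a = \<alpha> j" using a by blast
    have "compact (N ` {1..real n})"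
      by (intro compact_continuous_image continuous_on_subset[OF N(1)]) auto
    from compact_imp_bounded[OF this] obtain B where B0: "\<forall>y\<in>N ` {1..real n}. norm y \<le> B"
      unfolding bounded_iff by blast
    have B: "N l \<le> B" if "l \<in> {1..real n}" for l
      using bspec[OF B0 imageI[OF that]] by (simp add: abs_le_iff)
    define K where "K = nat \<lceil>real n + B\<rceil> + j + n"
    show ?thesis unfolding Tlim_def
    proof (rule geometric_uniform_limit[of K])
      fix k x assume k: "k \<ge> K" and x: "x \<in> {1..real n} \<times> {0..1::real}"
      have xp: "x \<in> param_space" using x by (auto simp: param_space_def)
      have "N (fst x) \<le> B" using B[of "fst x"] x by auto
      moreover have "real n + B \<le> real k" using k unfolding K_def by linarith
      ultimately have ge: "fst x + N (fst x) \<le> real k" using x by auto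
      have "infdist (g (Suc k) a x - T k a x) I = 0"
        unfolding move[OF xp] using g1[OF xp ge] g1[OF xp, of "Suc k"] ge closed_idealD(1)[OF I] by simp
      moreover have "fst x \<le> real k + 1" using ge N1[OF xp] by linarith
      moreover have "a \<in> \<alpha> ` {..k}" using j k by (auto simp: K_def)
      ultimately show "norm (T (Suc k) a x - T k a x) \<le> (1 / 2) ^ k"
        using gs[of x k a] xp by simp
    qed
  qed
  have lim: "(\<lambda>k. T k a x) \<longlonglongrightarrow> Tlim a x" if "a \<in> range \<alpha>" "x \<in> param_space" for a x
  proof (rule tendsto_uniform_limitI[OF unif[OF that(1)]])
    show "x \<in> {1..real (nat \<lceil>fst x\<rceil>)} \<times> {0..1}"
      using that(2) real_nat_ceiling_ge[of "fst x"] by (auto simp: param_space_def)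
  qed
  show thesis
  proof (rule that[of Tlim])
    fix a assume a: "a \<in> range \<alpha>"
    show "continuous_on param_space (Tlim a)"
    proof (rule continuous_on_if_locally)
      fix x :: "real \<times> real" assume x: "x \<in> param_space"
      let ?n = "nat \<lceil>fst x + 1\<rceil>" and ?V = "{..<fst x + 1} \<times> (UNIV :: real set)"
      have "continuous_on ({1..real ?n} \<times> {0..1}) (Tlim a)"
        by (rule uniform_limit_theorem[OF _ unif[OF a]])
          (auto intro!: always_eventually continuous_on_subset[OF Tcont] simp: param_space_def)
      then have "continuous_on (?V \<inter> param_space) (Tlim a)"
        by (rule continuous_on_subset)
          (auto simp: param_space_def, linarith)
      then show "\<exists>V. open V \<and> x \<in> V \<and> continuous_on (V \<inter> param_space) (Tlim a)"
        by (intro exI[of _ ?V]) (auto intro: open_Times simp: mem_Times_iff)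
    qed
    fix x assume x: "x \<in> param_space"
    show "Tlim a x - G a x \<in> I"
    proof (rule Lim_in_closed_set[OF closed_idealD(6)[OF I] _ sequentially_bot])
      show "(\<lambda>k. T k a x - G a x) \<longlonglongrightarrow> Tlim a x - G a x"
        using lim[OF a x] by (intro tendsto_intros)
      show "eventually (\<lambda>k. T k a x - G a x \<in> I) sequentially"
        unfolding eventually_sequentially
      proof (intro exI[of _ "nat \<lceil>fst x + N (fst x)\<rceil>"] allI impI)
        fix k assume "nat \<lceil>fst x + N (fst x)\<rceil> \<le> k"
        then have "fst x + N (fst x) \<le> real k" by linarith
        then show "T k a x - G a x \<in> I" using Tmod[OF x, of k a] g1[OF x] by simp
      qed
    qed
  next
    have floor: "real (nat \<lfloor>fst x\<rfloor>) \<le> fst x" "fst x \<le> real k + 1" if "nat \<lfloor>fst x\<rfloor> \<le> k" "x \<in> param_space" for x k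
      using that l1(1)[OF that(2)] by linarith+
    have start_norm: "T (nat \<lfloor>fst x\<rfloor>) a x = G a (fst x, 0)" if "x \<in> param_space" for a x
      using floor(1)[OF order_refl that] by (rule Tstart[OF that])
    \<comment> \<open>What holds eventually for \<open>G\<close> holds for all positions of the slide at once, as eventuality
      is uniform in the homotopy parameter.\<close>
    have shift: "eventually (\<lambda>x. \<forall>k. E (\<lambda>a. g k a x)) param_limit"
      if "eventually (\<lambda>x. E (\<lambda>a. G a x)) param_limit" for E :: "('b \<Rightarrow> 'd) \<Rightarrow> bool"
      using eventually_param_limit_all[OF that] eventually_param_limit_ge[of 0]
    proof eventually_elim
      case (elim x)
      show ?case
      proof
        fix k
        have "snd x * slide N k (fst x) \<in> {0..1}"
          using slide_along_in_param_space[of x N k] elim by (auto simp: param_space_def)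
        then show "E (\<lambda>a. g k a x)" using elim(1) by (simp add: g_def slide_along_def)
      qed
    qed
    have bottom0: "eventually (\<lambda>x. norm (E (\<lambda>a. T (nat \<lfloor>fst x\<rfloor>) a x)) \<le> r) param_limit"
      if "eventually (\<lambda>x. infdist (E (\<lambda>a. G a (fst x, 0))) {0} \<le> r) param_limit" for E :: "('b \<Rightarrow> 'd) \<Rightarrow> 'd" and r
      using that eventually_param_limit_ge[of 0]
      by eventually_elim (simp add: start_norm)
    {
      fix a b c \<epsilon> assume S: "{a, b, c} \<subseteq> range \<alpha>" and e: "(\<epsilon>::real) > 0"
      obtain m where m: "{a, b, c} \<subseteq> \<alpha> ` {..m}"
        by (rule finite_subset_range[OF _ S]) auto
      show "eventually (\<lambda>x. norm (Tlim a x * Tlim b x - Tlim c x) \<le> 4 * norm (a * b - c) + \<epsilon>) param_limit"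
      proof (rule defect_limit[OF _ _ _ e])
        show "(\<lambda>k. norm (T k a x * T k b x - T k c x)) \<longlonglongrightarrow> norm (Tlim a x * Tlim b x - Tlim c x)"
          if "x \<in> param_space" for x
          using S that by (intro tendsto_intros lim) auto
        show "eventually (\<lambda>x. norm (T (nat \<lfloor>fst x\<rfloor>) a x * T (nat \<lfloor>fst x\<rfloor>) b x - T (nat \<lfloor>fst x\<rfloor>) c x)
            \<le> 4 * norm (a * b - c) + e) param_limit" if "e > 0" for e
          by (rule bottom0[OF asymptotic_defect_mult[OF closed_ideal_zero bottom that]])
        fix e :: real assume e: "e > 0"
        have e2: "e / 2 > 0" using e by simp
        show "eventually (\<lambda>x. \<forall>k\<ge>nat \<lfloor>fst x\<rfloor>. norm (T (Suc k) a x * T (Suc k) b x - T (Suc k) c x)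
            \<le> max (norm (T k a x * T k b x - T k c x)) (4 * norm (a * b - c) + e) + (1 / 2) ^ k) param_limit"
          using shift[OF asymptotic_defect_mult[OF I hom e2, of a b c]]
            eventually_param_limit_ge[of "max (2 / e) (real m + 1)"]
        proof eventually_elim
          case (elim x)
          then have x: "x \<in> param_space" and le: "2 / e \<le> fst x" "real m + 1 \<le> fst x" by auto
          show ?case
          proof (intro allI impI)
            fix k assume k: "nat \<lfloor>fst x\<rfloor> \<le> k"
            have mk: "m \<le> k" using k le by linarith
            have abc: "a \<in> \<alpha> ` {..k}" "b \<in> \<alpha> ` {..k}" "c \<in> \<alpha> ` {..k}"
              using m mk image_mono[of "{..m}" "{..k}" \<alpha>] by auto
            obtain ja jb where jab: "a = \<alpha> ja" "ja \<le> m" "b = \<alpha> jb" "jb \<le> m" using m by auto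
            have step: "norm (T (Suc k) a x * T (Suc k) b x - T (Suc k) c x) \<le> max (norm (T k a x * T k b x - T k c x))
                (infdist (g (Suc k) a x * g (Suc k) b x - g (Suc k) c x) I
                  + infdist (g (Suc k) a x - T k a x) I * infdist (g (Suc k) b x - T k b x) I) + (1 / 2) ^ k"
              using QT[of k] abc x floor(2)[OF k x] unfolding Q_def good_step_def by blast
            \<comment> \<open>The square of the step size is negligible, being at most \<open>1 / fst x\<close>.\<close>
            have "infdist (g (Suc k) a x - T k a x) I * infdist (g (Suc k) b x - T k b x) I \<le> (1 / fst x) * 1"
            proof (intro mult_mono infdist_nonneg)
              show "infdist (g (Suc k) a x - T k a x) I \<le> 1 / fst x"
                by (rule move_small[OF x jab(1)]) (use jab le in linarith)
              have "infdist (g (Suc k) b x - T k b x) I \<le> 1 / fst x"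
                by (rule move_small[OF x jab(3)]) (use jab le in linarith)
              also have "\<dots> \<le> 1" using l1[OF x] by simp
              finally show "infdist (g (Suc k) b x - T k b x) I \<le> 1" .
            qed (use l1[OF x] in simp)
            also have "\<dots> \<le> e / 2" using le e l1[OF x] by (simp add: divide_simps mult.commute)
            finally have "infdist (g (Suc k) a x - T k a x) I * infdist (g (Suc k) b x - T k b x) I \<le> e / 2" .
            moreover have "infdist (g (Suc k) a x * g (Suc k) b x - g (Suc k) c x) I \<le> 4 * norm (a * b - c) + e / 2"
              using elim(1) by blast
            ultimately show "norm (T (Suc k) a x * T (Suc k) b x - T (Suc k) c x)
                \<le> max (norm (T k a x * T k b x - T k c x)) (4 * norm (a * b - c) + e) + (1 / 2) ^ k"
              using step by linarith
          qed
        qed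
      qed
    next
      fix a b c \<mu> \<nu> \<epsilon> assume S: "{a, b, c} \<subseteq> range \<alpha>" and e: "(\<epsilon>::real) > 0"
      obtain m where m: "{a, b, c} \<subseteq> \<alpha> ` {..m}"
        by (rule finite_subset_range[OF _ S]) auto
      show "eventually (\<lambda>x. norm (scaleC \<mu> (Tlim a x) + scaleC \<nu> (Tlim b x) - Tlim c x)
        \<le> 4 * norm (scaleC \<mu> a + scaleC \<nu> b - c) + \<epsilon>) param_limit"
      proof (rule defect_limit[OF _ _ _ e])
        show "(\<lambda>k. norm (scaleC \<mu> (T k a x) + scaleC \<nu> (T k b x) - T k c x))
            \<longlonglongrightarrow> norm (scaleC \<mu> (Tlim a x) + scaleC \<nu> (Tlim b x) - Tlim c x)"
          if "x \<in> param_space" for x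
          using S that by (intro tendsto_intros scaleC.tendsto lim) auto
        show "eventually (\<lambda>x. norm (scaleC \<mu> (T (nat \<lfloor>fst x\<rfloor>) a x) + scaleC \<nu> (T (nat \<lfloor>fst x\<rfloor>) b x) - T (nat \<lfloor>fst x\<rfloor>) c x)
            \<le> 4 * norm (scaleC \<mu> a + scaleC \<nu> b - c) + e) param_limit" if "e > 0" for e
          by (rule bottom0[OF asymptotic_defect_lin[OF closed_ideal_zero bottom that]])
        fix e :: real assume e: "e > 0"
        show "eventually (\<lambda>x. \<forall>k\<ge>nat \<lfloor>fst x\<rfloor>. norm (scaleC \<mu> (T (Suc k) a x) + scaleC \<nu> (T (Suc k) b x) - T (Suc k) c x)
            \<le> max (norm (scaleC \<mu> (T k a x) + scaleC \<nu> (T k b x) - T k c x))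
                (4 * norm (scaleC \<mu> a + scaleC \<nu> b - c) + e) + (1 / 2) ^ k) param_limit"
          using shift[OF asymptotic_defect_lin[OF I hom e, of \<mu> a \<nu> b c]]
            eventually_param_limit_ge[of "max (cmod \<mu> + cmod \<nu> + 1) (real m + 1)"]
        proof eventually_elim
          case (elim x)
          then have x: "x \<in> param_space" and le: "cmod \<mu> + cmod \<nu> + 1 \<le> fst x" "real m + 1 \<le> fst x" by auto
          show ?case
          proof (intro allI impI)
            fix k assume k: "nat \<lfloor>fst x\<rfloor> \<le> k"
            have mk: "m \<le> k" using k le by linarith
            have abc: "a \<in> \<alpha> ` {..k}" "b \<in> \<alpha> ` {..k}" "c \<in> \<alpha> ` {..k}"
              using m mk image_mono[of "{..m}" "{..k}" \<alpha>] by auto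
            have "cmod \<mu> + cmod \<nu> \<le> real k" using k le by linarith
            then have "cmod \<mu> \<le> real k" "cmod \<nu> \<le> real k"
              using norm_ge_zero[of \<mu>] norm_ge_zero[of \<nu>] by linarith+
            then have step: "norm (scaleC \<mu> (T (Suc k) a x) + scaleC \<nu> (T (Suc k) b x) - T (Suc k) c x)
                \<le> max (norm (scaleC \<mu> (T k a x) + scaleC \<nu> (T k b x) - T k c x))
                  (infdist (scaleC \<mu> (g (Suc k) a x) + scaleC \<nu> (g (Suc k) b x) - g (Suc k) c x) I) + (1 / 2) ^ k"
              using QT[of k] abc x floor(2)[OF k x] unfolding Q_def good_step_def by blast
            moreover have "infdist (scaleC \<mu> (g (Suc k) a x) + scaleC \<nu> (g (Suc k) b x) - g (Suc k) c x) I
                \<le> 4 * norm (scaleC \<mu> a + scaleC \<nu> b - c) + e"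
              using elim(1) by blast
            ultimately show "norm (scaleC \<mu> (T (Suc k) a x) + scaleC \<nu> (T (Suc k) b x) - T (Suc k) c x)
                \<le> max (norm (scaleC \<mu> (T k a x) + scaleC \<nu> (T k b x) - T k c x))
                  (4 * norm (scaleC \<mu> a + scaleC \<nu> b - c) + e) + (1 / 2) ^ k"
              by linarith
          qed
        qed
      qed
    next
      fix a b \<epsilon> assume S: "{a, b} \<subseteq> range \<alpha>" and e: "(\<epsilon>::real) > 0"
      obtain m where m: "{a, b} \<subseteq> \<alpha> ` {..m}"
        by (rule finite_subset_range[OF _ S]) auto
      show "eventually (\<lambda>x. norm (star (Tlim a x) - Tlim b x) \<le> 4 * norm (star a - b) + \<epsilon>) param_limit"
      proof (rule defect_limit[OF _ _ _ e])
        show "(\<lambda>k. norm (star (T k a x) - T k b x)) \<longlonglongrightarrow> norm (star (Tlim a x) - Tlim b x)"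
          if "x \<in> param_space" for x
          using S that by (intro tendsto_intros bounded_linear.tendsto[OF bounded_linear_star] lim) auto
        show "eventually (\<lambda>x. norm (star (T (nat \<lfloor>fst x\<rfloor>) a x) - T (nat \<lfloor>fst x\<rfloor>) b x)
            \<le> 4 * norm (star a - b) + e) param_limit" if "e > 0" for e
          by (rule bottom0[OF asymptotic_defect_star[OF closed_ideal_zero bottom that]])
        fix e :: real assume e: "e > 0"
        show "eventually (\<lambda>x. \<forall>k\<ge>nat \<lfloor>fst x\<rfloor>. norm (star (T (Suc k) a x) - T (Suc k) b x)
            \<le> max (norm (star (T k a x) - T k b x)) (4 * norm (star a - b) + e) + (1 / 2) ^ k) param_limit"
          using shift[OF asymptotic_defect_star[OF I hom e, of a b]]
            eventually_param_limit_ge[of "real m + 1"]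
        proof eventually_elim
          case (elim x)
          then have x: "x \<in> param_space" and le: "real m + 1 \<le> fst x" by auto
          show ?case
          proof (intro allI impI)
            fix k assume k: "nat \<lfloor>fst x\<rfloor> \<le> k"
            have mk: "m \<le> k" using k le by linarith
            have abc: "a \<in> \<alpha> ` {..k}" "b \<in> \<alpha> ` {..k}"
              using m mk image_mono[of "{..m}" "{..k}" \<alpha>] by auto
            then have step: "norm (star (T (Suc k) a x) - T (Suc k) b x)
                \<le> max (norm (star (T k a x) - T k b x)) (infdist (star (g (Suc k) a x) - g (Suc k) b x) I) + (1 / 2) ^ k"
              using QT[of k] x floor(2)[OF k x] unfolding Q_def good_step_def by blast
            moreover have "infdist (star (g (Suc k) a x) - g (Suc k) b x) I \<le> 4 * norm (star a - b) + e"
              using elim(1) by blast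
            ultimately show "norm (star (T (Suc k) a x) - T (Suc k) b x)
                \<le> max (norm (star (T k a x) - T k b x)) (4 * norm (star a - b) + e) + (1 / 2) ^ k"
              by linarith
          qed
        qed
      qed
    }
  qed
qed

section \<open>Extension from a dense sequence\<close>

text \<open>At a single parameter one takes an element close to the lift of a very close \<open>\<alpha> m\<close>, in the class
  of \<open>G a\<close>. The conditions on it are convex and open, so a continuous choice exists.\<close>

lemma lift_near_sequence:
  fixes I :: "'d::cstar_algebra set" and G T :: "'b::cstar_algebra \<Rightarrow> real \<times> real \<Rightarrow> 'd" and \<alpha> :: "nat \<Rightarrow> 'b"
  assumes I: "closed_ideal I" and G: "\<And>a. continuous_on param_space (G a)"
    and hom: "asymptotic_mod I param_limit G"
    and dense: "\<And>b \<epsilon>. \<epsilon> > 0 \<Longrightarrow> \<exists>j. norm (b - \<alpha> j) < \<epsilon>"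
    and Tcont: "\<And>a. a \<in> range \<alpha> \<Longrightarrow> continuous_on param_space (T a)"
    and Tmod: "\<And>a x. a \<in> range \<alpha> \<Longrightarrow> x \<in> param_space \<Longrightarrow> T a x - G a x \<in> I"
    and Tdiff: "\<And>i j \<epsilon>. \<epsilon> > 0 \<Longrightarrow>
      eventually (\<lambda>x. norm (T (\<alpha> i) x - T (\<alpha> j) x) \<le> 4 * norm (\<alpha> i - \<alpha> j) + \<epsilon>) param_limit"
  shows "\<exists>\<psi>. continuous_on param_space \<psi> \<and> (\<forall>x\<in>param_space. \<psi> x - G a x \<in> I) \<and>
    (\<forall>j. \<forall>\<epsilon>>0. eventually (\<lambda>x. norm (\<psi> x - T (\<alpha> j) x) \<le> 4 * norm (a - \<alpha> j) + \<epsilon>) param_limit)"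
proof -
  have "eventually (\<lambda>x. \<exists>i\<in>I. \<forall>j\<in>{..n}. norm (G a x + i - T (\<alpha> j) x) < 4 * norm (a - \<alpha> j) + 1 / (real n + 1)) param_limit" for n
  proof -
    define \<eta> where "\<eta> = 1 / (20 * (real n + 1))"
    have \<eta>: "\<eta> > 0" "20 * \<eta> = 1 / (real n + 1)" by (auto simp: \<eta>_def divide_simps)
    obtain m where m: "norm (a - \<alpha> m) < \<eta>" using dense[OF \<eta>(1)] by blast
    \<comment> \<open>The relation \<open>1 a + 0 a = \<alpha> m\<close>, which fails by less than \<open>\<eta>\<close>.\<close>
    have "eventually (\<lambda>x. infdist (scaleC 1 (G a x) + scaleC 0 (G a x) - G (\<alpha> m) x) I
        \<le> 4 * norm (scaleC 1 a + scaleC 0 a - \<alpha> m) + \<eta>) param_limit"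
      by (rule asymptotic_defect_lin[OF I hom \<eta>(1)])
    then have "eventually (\<lambda>x. infdist (G a x - G (\<alpha> m) x) I \<le> 4 * norm (a - \<alpha> m) + \<eta>) param_limit"
      by (simp add: scaleC.zero_left)
    moreover have "eventually (\<lambda>x. \<forall>j\<in>{..n}. norm (T (\<alpha> m) x - T (\<alpha> j) x) \<le> 4 * norm (\<alpha> m - \<alpha> j) + \<eta>) param_limit"
      by (intro eventually_ball_finite ballI Tdiff \<eta>) simp
    ultimately show ?thesis
      using eventually_param_limit_ge[of 0]
    proof eventually_elim
      case (elim x)
      have "infdist (G a x - T (\<alpha> m) x) I = infdist (G a x - G (\<alpha> m) x) I"
        using closed_ideal_minus[OF I Tmod[of "\<alpha> m" x]] elim(3) by (intro infdist_ideal_cong[OF I]) simp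
      also have "\<dots> < 6 * \<eta>" using elim(1) m \<eta> by simp
      finally obtain i where i: "i \<in> I" "norm (G a x - T (\<alpha> m) x - i) < 6 * \<eta>"
        using infdist_less_witness[OF I] by blast
      have "norm (G a x + - i - T (\<alpha> j) x) < 4 * norm (a - \<alpha> j) + 1 / (real n + 1)" if "j \<in> {..n}" for j
      proof -
        have "G a x + - i - T (\<alpha> j) x = (G a x - T (\<alpha> m) x - i) + (T (\<alpha> m) x - T (\<alpha> j) x)" by simp
        also have "norm \<dots> \<le> norm (G a x - T (\<alpha> m) x - i) + norm (T (\<alpha> m) x - T (\<alpha> j) x)"
          by (rule norm_triangle_ineq)
        also have "\<dots> < 6 * \<eta> + (4 * norm (\<alpha> m - \<alpha> j) + \<eta>)"
          using i elim(2) that by (intro add_less_le_mono) auto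
        finally have "norm (G a x + - i - T (\<alpha> j) x) < 6 * \<eta> + (4 * norm (\<alpha> m - \<alpha> j) + \<eta>)" .
        moreover have "norm (\<alpha> m - \<alpha> j) \<le> norm (a - \<alpha> m) + norm (a - \<alpha> j)"
          using norm_triangle_ineq4[of "a - \<alpha> j" "a - \<alpha> m"] by simp
        ultimately show ?thesis using m \<eta> by linarith
      qed
      then show ?case using closed_ideal_minus[OF I i(1)] by (intro bexI[of _ "- i"]) auto
    qed
  qed
  then have "\<forall>n. \<exists>L. \<forall>x\<in>param_space. L \<le> fst x \<longrightarrow>
      (\<exists>i\<in>I. \<forall>j\<in>{..n}. norm (G a x + i - T (\<alpha> j) x) < 4 * norm (a - \<alpha> j) + 1 / (real n + 1))"
    unfolding eventually_param_limit_Ball by blast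
  then obtain L0 where L0: "\<And>n x. x \<in> param_space \<Longrightarrow> L0 n \<le> fst x \<Longrightarrow>
      \<exists>i\<in>I. \<forall>j\<in>{..n}. norm (G a x + i - T (\<alpha> j) x) < 4 * norm (a - \<alpha> j) + 1 / (real n + 1)"
    by metis
  \<comment> \<open>Only finitely many of the conditions are imposed at each parameter.\<close>
  define L where "L n = max (L0 n) (real n)" for n
  define near where "near x n i \<longleftrightarrow> (\<forall>j\<in>{..n}. norm (G a x + i - T (\<alpha> j) x) < 4 * norm (a - \<alpha> j) + 1 / (real n + 1))" for x n i
  have L: "\<exists>i\<in>I. near x n i" if "x \<in> param_space" "L n \<le> fst x" for n x
    using L0[of x n] that by (auto simp: L_def near_def)
  have near_mono: "near x n i" if "near x n' i" "n \<le> n'" for x n n' i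
    unfolding near_def
  proof
    fix j assume "j \<in> {..n}"
    then have "norm (G a x + i - T (\<alpha> j) x) < 4 * norm (a - \<alpha> j) + 1 / (real n' + 1)"
      using that by (auto simp: near_def)
    moreover have "1 / (real n' + 1) \<le> 1 / (real n + 1)" using that(2) by (intro divide_left_mono) auto
    ultimately show "norm (G a x + i - T (\<alpha> j) x) < 4 * norm (a - \<alpha> j) + 1 / (real n + 1)" by linarith
  qed
  have fin: "finite {n. L n \<le> l}" for l
    by (rule finite_subset[of _ "{..nat \<lceil>l\<rceil>}"]) (auto simp: L_def, linarith)
  have "\<exists>i. continuous_on param_space i \<and> (\<forall>x\<in>param_space. i x \<in> I \<and> (\<forall>n. L n \<le> fst x \<longrightarrow> near x n (i x)))"
  proof (rule convex_selection)
    fix x assume x: "x \<in> param_space"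
    have "convex I"
      using closed_idealD(2)[OF I] closed_ideal_scaleR[OF I] by (auto intro!: convexI)
    moreover have "{i. i \<in> I \<and> (\<forall>n. L n \<le> fst x \<longrightarrow> near x n i)}
        = I \<inter> (\<Inter>n\<in>{n. L n \<le> fst x}. \<Inter>j\<in>{..n}. ball (T (\<alpha> j) x - G a x) (4 * norm (a - \<alpha> j) + 1 / (real n + 1)))"
      by (auto simp: near_def dist_norm norm_minus_commute algebra_simps)
    ultimately show "convex {i. i \<in> I \<and> (\<forall>n. L n \<le> fst x \<longrightarrow> near x n i)}"
      by (simp only:) (intro convex_Int convex_INT convex_ball)
    have "\<exists>i\<in>I. \<forall>n. L n \<le> fst x \<longrightarrow> near x n i"
    proof (cases "{n. L n \<le> fst x} = {}")
      case True
      then show ?thesis using closed_idealD(1)[OF I] by blast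
    next
      case False
      define m where "m = Max {n. L n \<le> fst x}"
      have m: "L m \<le> fst x" "\<And>n. L n \<le> fst x \<Longrightarrow> n \<le> m"
        using Max_in[OF fin False] Max_ge[OF fin] by (auto simp: m_def)
      obtain i where "i \<in> I" "near x m i" using L[OF x m(1)] by blast
      then show ?thesis using m(2) near_mono by blast
    qed
    then obtain i where i: "i \<in> I" "\<And>n. L n \<le> fst x \<Longrightarrow> near x n i" by blast
    have fst_lim: "(fst \<longlongrightarrow> fst x) (at x within param_space)" by (intro tendsto_intros)
    have "eventually (\<lambda>z. \<forall>n\<in>{n. L n \<le> fst x + 1}. L n \<le> fst z \<longrightarrow> near z n i) (at x within param_space)"
    proof (intro eventually_ball_finite fin ballI)
      fix n
      show "eventually (\<lambda>z. L n \<le> fst z \<longrightarrow> near z n i) (at x within param_space)"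
      proof (cases "L n \<le> fst x")
        case True
        have "eventually (\<lambda>z. near z n i) (at x within param_space)"
          unfolding near_def
        proof (intro eventually_ball_finite ballI)
          fix j assume "j \<in> {..n}"
          have "((\<lambda>z. norm (G a z + i - T (\<alpha> j) z)) \<longlongrightarrow> norm (G a x + i - T (\<alpha> j) x)) (at x within param_space)"
            using G[of a] Tcont[of "\<alpha> j"] x by (intro tendsto_intros) (auto simp: continuous_on_def)
          moreover have "norm (G a x + i - T (\<alpha> j) x) < 4 * norm (a - \<alpha> j) + 1 / (real n + 1)"
            using i(2)[OF True] \<open>j \<in> {..n}\<close> by (auto simp: near_def)
          ultimately show "eventually (\<lambda>z. norm (G a z + i - T (\<alpha> j) z) < 4 * norm (a - \<alpha> j) + 1 / (real n + 1)) (at x within param_space)"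
            by (rule order_tendstoD)
        qed simp
        then show ?thesis by eventually_elim auto
      next
        case False
        then have "eventually (\<lambda>z. fst z < L n) (at x within param_space)"
          using fst_lim by (intro order_tendstoD(2)[OF fst_lim]) auto
        then show ?thesis by eventually_elim auto
      qed
    qed
    moreover have "eventually (\<lambda>z. fst z < fst x + 1) (at x within param_space)"
      by (rule order_tendstoD(2)[OF fst_lim]) simp
    ultimately have "eventually (\<lambda>z. i \<in> I \<and> (\<forall>n. L n \<le> fst z \<longrightarrow> near z n i)) (at x within param_space)"
      by eventually_elim (use i(1) in auto)
    then show "\<exists>i V. open V \<and> x \<in> V \<and> (\<forall>z\<in>V \<inter> param_space. i \<in> I \<and> (\<forall>n. L n \<le> fst z \<longrightarrow> near z n i))"
      using i by (intro exI[of _ i] eventually_within_neighbourhood) auto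
  qed
  then obtain i where i: "continuous_on param_space i" "\<And>x. x \<in> param_space \<Longrightarrow> i x \<in> I"
      "\<And>x n. x \<in> param_space \<Longrightarrow> L n \<le> fst x \<Longrightarrow> near x n (i x)" by blast
  show ?thesis
  proof (intro exI[of _ "\<lambda>x. G a x + i x"] conjI allI impI ballI)
    show "continuous_on param_space (\<lambda>x. G a x + i x)" by (intro continuous_on_add G i)
    show "G a x + i x - G a x \<in> I" if "x \<in> param_space" for x using i(2)[OF that] by simp
    fix j and \<epsilon> :: real assume e: "\<epsilon> > 0"
    obtain n0 :: nat where n0: "1 / \<epsilon> < real n0" using reals_Archimedean2 by blast
    define n where "n = max n0 j"
    have "1 / \<epsilon> < real n + 1" using n0 by (simp add: n_def)
    then have n: "1 / (real n + 1) < \<epsilon>" using e by (simp add: divide_simps mult.commute)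
    show "eventually (\<lambda>x. norm (G a x + i x - T (\<alpha> j) x) \<le> 4 * norm (a - \<alpha> j) + \<epsilon>) param_limit"
      using eventually_param_limit_ge[of "L n"]
    proof eventually_elim
      case (elim x)
      then have "near x n (i x)" by (intro i(3)) auto
      then have "norm (G a x + i x - T (\<alpha> j) x) < 4 * norm (a - \<alpha> j) + 1 / (real n + 1)"
        by (simp add: near_def n_def)
      then show ?case using n by simp
    qed
  qed
qed

lemma asymptotic_from_dense_sequence:
  fixes \<Psi> T :: "'b::cstar_algebra \<Rightarrow> real \<times> real \<Rightarrow> 'd::cstar_algebra" and \<alpha> :: "nat \<Rightarrow> 'b"
  assumes dense: "\<And>b \<epsilon>. \<epsilon> > 0 \<Longrightarrow> \<exists>j. norm (b - \<alpha> j) < \<epsilon>"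
    and near: "\<And>a j \<epsilon>. \<epsilon> > 0 \<Longrightarrow>
      eventually (\<lambda>x. norm (\<Psi> a x - T (\<alpha> j) x) \<le> 4 * norm (a - \<alpha> j) + \<epsilon>) param_limit"
    and mult: "\<And>i j k \<epsilon>. \<epsilon> > 0 \<Longrightarrow>
      eventually (\<lambda>x. norm (T (\<alpha> i) x * T (\<alpha> j) x - T (\<alpha> k) x) \<le> 4 * norm (\<alpha> i * \<alpha> j - \<alpha> k) + \<epsilon>) param_limit"
    and lin: "\<And>i j k \<mu> \<nu> \<epsilon>. \<epsilon> > 0 \<Longrightarrow>
      eventually (\<lambda>x. norm (scaleC \<mu> (T (\<alpha> i) x) + scaleC \<nu> (T (\<alpha> j) x) - T (\<alpha> k) x)
        \<le> 4 * norm (scaleC \<mu> (\<alpha> i) + scaleC \<nu> (\<alpha> j) - \<alpha> k) + \<epsilon>) param_limit"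
    and star: "\<And>i j \<epsilon>. \<epsilon> > 0 \<Longrightarrow>
      eventually (\<lambda>x. norm (star (T (\<alpha> i) x) - T (\<alpha> j) x) \<le> 4 * norm (star (\<alpha> i) - \<alpha> j) + \<epsilon>) param_limit"
  shows "asymptotic_mod {0} param_limit \<Psi>"
proof -
  have approx: "\<exists>j. norm (a - \<alpha> j) < \<eta> \<and> eventually (\<lambda>x. norm (\<Psi> a x - T (\<alpha> j) x) \<le> 5 * \<eta>) param_limit"
    if \<eta>: "\<eta> > 0" for a \<eta>
  proof -
    obtain j where j: "norm (a - \<alpha> j) < \<eta>" using dense[OF \<eta>] by blast
    have "eventually (\<lambda>x. norm (\<Psi> a x - T (\<alpha> j) x) \<le> 5 * \<eta>) param_limit"
      using near[OF \<eta>, of a j] by eventually_elim (use j in linarith)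
    with j show ?thesis by blast
  qed
  have Tbound: "eventually (\<lambda>x. norm (T (\<alpha> j) x) \<le> 4 * norm (\<alpha> j) + 1) param_limit" for j
    using lin[of 1 0 j 0 j j] by (simp add: scaleC.zero_left)
  have choose_\<eta>: "\<exists>\<eta>>0. \<eta> \<le> 1 \<and> C * \<eta> \<le> \<epsilon>" if "C > 0" "\<epsilon> > 0" for C \<epsilon> :: real
    using that by (intro exI[of _ "min 1 (\<epsilon> / C)"]) (auto simp: min_def field_simps)
  have 1: "((\<lambda>x. norm (\<Psi> (star a) x - star (\<Psi> a x))) \<longlongrightarrow> 0) param_limit" for a
  proof (rule tendsto_zeroI_eventually)
    fix \<epsilon> :: real assume "\<epsilon> > 0"
    then obtain \<eta> where \<eta>: "\<eta> > 0" "19 * \<eta> \<le> \<epsilon>" using choose_\<eta>[of 19 \<epsilon>] by auto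
    obtain i where i: "norm (a - \<alpha> i) < \<eta>" "eventually (\<lambda>x. norm (\<Psi> a x - T (\<alpha> i) x) \<le> 5 * \<eta>) param_limit"
      using approx[OF \<eta>(1)] by blast
    obtain j where j: "norm (star a - \<alpha> j) < \<eta>" "eventually (\<lambda>x. norm (\<Psi> (star a) x - T (\<alpha> j) x) \<le> 5 * \<eta>) param_limit"
      using approx[OF \<eta>(1)] by blast
    have "norm (star (\<alpha> i) - \<alpha> j) = norm ((star a - \<alpha> j) - star (a - \<alpha> i))" by (simp add: star_diff)
    also have "\<dots> \<le> norm (star a - \<alpha> j) + norm (a - \<alpha> i)"
      using norm_triangle_ineq4[of "star a - \<alpha> j" "star (a - \<alpha> i)"] by simp
    finally have d: "norm (star (\<alpha> i) - \<alpha> j) \<le> 2 * \<eta>" using i j by linarith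
    show "eventually (\<lambda>x. norm (\<Psi> (star a) x - star (\<Psi> a x)) \<le> \<epsilon>) param_limit"
      using i(2) j(2) star[OF \<eta>(1), of i j]
    proof eventually_elim
      case (elim x)
      have "\<Psi> (star a) x - star (\<Psi> a x) = (\<Psi> (star a) x - T (\<alpha> j) x)
          + (- (star (T (\<alpha> i) x) - T (\<alpha> j) x) + - star (\<Psi> a x - T (\<alpha> i) x))"
        by (simp add: star_diff)
      also have "norm \<dots> \<le> norm (\<Psi> (star a) x - T (\<alpha> j) x)
          + (norm (- (star (T (\<alpha> i) x) - T (\<alpha> j) x)) + norm (- star (\<Psi> a x - T (\<alpha> i) x)))"
        by (rule norm_add_add_le)
      finally show ?case using elim d \<eta> unfolding norm_minus_cancel norm_star by linarith
    qed
  qed simp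
  have 2: "((\<lambda>x. norm (\<Psi> (scaleC \<mu> a + scaleC \<nu> b) x - (scaleC \<mu> (\<Psi> a x) + scaleC \<nu> (\<Psi> b x)))) \<longlongrightarrow> 0) param_limit" for \<mu> \<nu> a b
  proof (rule tendsto_zeroI_eventually)
    fix \<epsilon> :: real assume "\<epsilon> > 0"
    moreover have "10 + 9 * cmod \<mu> + 9 * cmod \<nu> > 0" by (intro add_pos_nonneg) auto
    ultimately obtain \<eta> where \<eta>: "\<eta> > 0" "(10 + 9 * cmod \<mu> + 9 * cmod \<nu>) * \<eta> \<le> \<epsilon>"
      using choose_\<eta> by blast
    let ?c = "scaleC \<mu> a + scaleC \<nu> b"
    obtain i where i: "norm (a - \<alpha> i) < \<eta>" "eventually (\<lambda>x. norm (\<Psi> a x - T (\<alpha> i) x) \<le> 5 * \<eta>) param_limit"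
      using approx[OF \<eta>(1)] by blast
    obtain j where j: "norm (b - \<alpha> j) < \<eta>" "eventually (\<lambda>x. norm (\<Psi> b x - T (\<alpha> j) x) \<le> 5 * \<eta>) param_limit"
      using approx[OF \<eta>(1)] by blast
    obtain k where k: "norm (?c - \<alpha> k) < \<eta>" "eventually (\<lambda>x. norm (\<Psi> ?c x - T (\<alpha> k) x) \<le> 5 * \<eta>) param_limit"
      using approx[OF \<eta>(1)] by blast
    have "scaleC \<mu> (\<alpha> i) + scaleC \<nu> (\<alpha> j) - \<alpha> k = (?c - \<alpha> k) + (- scaleC \<mu> (a - \<alpha> i) + - scaleC \<nu> (b - \<alpha> j))"
      by (simp add: scaleC.diff_right)
    then have "norm (scaleC \<mu> (\<alpha> i) + scaleC \<nu> (\<alpha> j) - \<alpha> k)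
        \<le> norm (?c - \<alpha> k) + (norm (- scaleC \<mu> (a - \<alpha> i)) + norm (- scaleC \<nu> (b - \<alpha> j)))"
      by (simp only: norm_add_add_le)
    also have "\<dots> \<le> \<eta> + (cmod \<mu> * \<eta> + cmod \<nu> * \<eta>)"
      unfolding norm_minus_cancel norm_scaleC using i j k by (intro add_mono mult_left_mono) auto
    finally have d: "norm (scaleC \<mu> (\<alpha> i) + scaleC \<nu> (\<alpha> j) - \<alpha> k) \<le> \<eta> + (cmod \<mu> * \<eta> + cmod \<nu> * \<eta>)" .
    show "eventually (\<lambda>x. norm (\<Psi> ?c x - (scaleC \<mu> (\<Psi> a x) + scaleC \<nu> (\<Psi> b x))) \<le> \<epsilon>) param_limit"
      using i(2) j(2) k(2) lin[OF \<eta>(1), of \<mu> i \<nu> j k]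
    proof eventually_elim
      case (elim x)
      let ?D = "scaleC \<mu> (T (\<alpha> i) x) + scaleC \<nu> (T (\<alpha> j) x) - T (\<alpha> k) x"
      have e1: "norm ((\<Psi> ?c x - T (\<alpha> k) x) - ?D) \<le> 5 * \<eta> + (4 * (\<eta> + (cmod \<mu> * \<eta> + cmod \<nu> * \<eta>)) + \<eta>)"
        by (rule order_trans[OF norm_triangle_ineq4 add_mono[OF elim(3) order_trans[OF elim(4)]]])
          (rule add_right_mono, rule mult_left_mono[OF d], simp)
      have "\<Psi> ?c x - (scaleC \<mu> (\<Psi> a x) + scaleC \<nu> (\<Psi> b x)) = ((\<Psi> ?c x - T (\<alpha> k) x) - ?D)
          + (- scaleC \<mu> (\<Psi> a x - T (\<alpha> i) x) + - scaleC \<nu> (\<Psi> b x - T (\<alpha> j) x))"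
        by (simp add: scaleC.diff_right)
      also have "norm \<dots> \<le> norm ((\<Psi> ?c x - T (\<alpha> k) x) - ?D)
          + (norm (- scaleC \<mu> (\<Psi> a x - T (\<alpha> i) x)) + norm (- scaleC \<nu> (\<Psi> b x - T (\<alpha> j) x)))"
        by (rule norm_add_add_le)
      also have "\<dots> \<le> (5 * \<eta> + (4 * (\<eta> + (cmod \<mu> * \<eta> + cmod \<nu> * \<eta>)) + \<eta>))
          + (cmod \<mu> * (5 * \<eta>) + cmod \<nu> * (5 * \<eta>))"
        unfolding norm_minus_cancel norm_scaleC
        using e1 elim(1,2) by (intro add_mono mult_left_mono) auto
      also have "\<dots> = (10 + 9 * cmod \<mu> + 9 * cmod \<nu>) * \<eta>" by (simp add: algebra_simps)
      also have "\<dots> \<le> \<epsilon>" by (rule \<eta>)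
      finally show ?case .
    qed
  qed simp
  have 3: "((\<lambda>x. norm (\<Psi> (a * b) x - \<Psi> a x * \<Psi> b x)) \<longlongrightarrow> 0) param_limit" for a b
  proof (rule tendsto_zeroI_eventually)
    fix \<epsilon> :: real assume "\<epsilon> > 0"
    moreover have "100 + 24 * norm a + 24 * norm b > 0" by (intro add_pos_nonneg) auto
    ultimately obtain \<eta> where \<eta>: "\<eta> > 0" "\<eta> \<le> 1" "(100 + 24 * norm a + 24 * norm b) * \<eta> \<le> \<epsilon>"
      using choose_\<eta> by blast
    obtain i where i: "norm (a - \<alpha> i) < \<eta>" "eventually (\<lambda>x. norm (\<Psi> a x - T (\<alpha> i) x) \<le> 5 * \<eta>) param_limit"
      using approx[OF \<eta>(1)] by blast
    obtain j where j: "norm (b - \<alpha> j) < \<eta>" "eventually (\<lambda>x. norm (\<Psi> b x - T (\<alpha> j) x) \<le> 5 * \<eta>) param_limit"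
      using approx[OF \<eta>(1)] by blast
    obtain k where k: "norm (a * b - \<alpha> k) < \<eta>" "eventually (\<lambda>x. norm (\<Psi> (a * b) x - T (\<alpha> k) x) \<le> 5 * \<eta>) param_limit"
      using approx[OF \<eta>(1)] by blast
    have na: "norm (\<alpha> i) \<le> norm a + 1" using norm_triangle_sub[of "\<alpha> i" a] i \<eta> by (simp add: norm_minus_commute)
    have nb: "norm (\<alpha> j) \<le> norm b + 1" using norm_triangle_sub[of "\<alpha> j" b] j \<eta> by (simp add: norm_minus_commute)
    have "\<alpha> i * \<alpha> j - \<alpha> k = (a * b - \<alpha> k) + (- ((a - \<alpha> i) * \<alpha> j) + - (a * (b - \<alpha> j)))"
      by (simp add: algebra_simps)
    then have "norm (\<alpha> i * \<alpha> j - \<alpha> k) \<le> norm (a * b - \<alpha> k) + (norm (- ((a - \<alpha> i) * \<alpha> j)) + norm (- (a * (b - \<alpha> j))))"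
      by (simp only: norm_add_add_le)
    also have "\<dots> \<le> \<eta> + (\<eta> * (norm b + 1) + norm a * \<eta>)"
      unfolding norm_minus_cancel using i j k nb \<eta>(1)
      by (intro add_mono order_trans[OF norm_mult_ineq] mult_mono) auto
    finally have d: "norm (\<alpha> i * \<alpha> j - \<alpha> k) \<le> \<eta> + (\<eta> * (norm b + 1) + norm a * \<eta>)" .
    show "eventually (\<lambda>x. norm (\<Psi> (a * b) x - \<Psi> a x * \<Psi> b x) \<le> \<epsilon>) param_limit"
      using i(2) j(2) k(2) mult[OF \<eta>(1), of i j k] Tbound[of i] Tbound[of j]
    proof eventually_elim
      case (elim x)
      let ?D = "T (\<alpha> i) x * T (\<alpha> j) x - T (\<alpha> k) x"
      have nTb: "norm (T (\<alpha> j) x) \<le> 4 * norm b + 5" using elim(6) nb by linarith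
      have n\<Psi>a: "norm (\<Psi> a x) \<le> 4 * norm a + 10"
        using norm_triangle_sub[of "\<Psi> a x" "T (\<alpha> i) x"] elim(1,5) na \<eta>(2) by linarith
      have e1: "norm ((\<Psi> (a * b) x - T (\<alpha> k) x) - ?D) \<le> 5 * \<eta> + (4 * (\<eta> + (\<eta> * (norm b + 1) + norm a * \<eta>)) + \<eta>)"
        by (rule order_trans[OF norm_triangle_ineq4 add_mono[OF elim(3) order_trans[OF elim(4)]]])
          (rule add_right_mono, rule mult_left_mono[OF d], simp)
      have e2: "norm (- ((\<Psi> a x - T (\<alpha> i) x) * T (\<alpha> j) x)) \<le> (5 * \<eta>) * (4 * norm b + 5)"
        unfolding norm_minus_cancel by (rule order_trans[OF norm_mult_ineq mult_mono[OF elim(1) nTb]]) (use \<eta> in auto)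
      have e3: "norm (- (\<Psi> a x * (\<Psi> b x - T (\<alpha> j) x))) \<le> (4 * norm a + 10) * (5 * \<eta>)"
        unfolding norm_minus_cancel by (rule order_trans[OF norm_mult_ineq mult_mono[OF n\<Psi>a elim(2)]]) auto
      have eq: "\<Psi> (a * b) x - \<Psi> a x * \<Psi> b x = ((\<Psi> (a * b) x - T (\<alpha> k) x) - ?D)
          + (- ((\<Psi> a x - T (\<alpha> i) x) * T (\<alpha> j) x) + - (\<Psi> a x * (\<Psi> b x - T (\<alpha> j) x)))"
        by (simp add: algebra_simps)
      have "norm (\<Psi> (a * b) x - \<Psi> a x * \<Psi> b x) \<le> 5 * \<eta> + (4 * (\<eta> + (\<eta> * (norm b + 1) + norm a * \<eta>)) + \<eta>)
          + ((5 * \<eta>) * (4 * norm b + 5) + (4 * norm a + 10) * (5 * \<eta>))"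
        by (subst eq) (rule order_trans[OF norm_add_add_le add_mono[OF e1 add_mono[OF e2 e3]]])
      also have "\<dots> = (89 + 24 * norm a + 24 * norm b) * \<eta>" by (simp only: distrib_left distrib_right mult_ac)
      also have "\<dots> \<le> (100 + 24 * norm a + 24 * norm b) * \<eta>" by (rule mult_right_mono) (use \<eta>(1) in simp_all)
      also have "\<dots> \<le> \<epsilon>" by (rule \<eta>)
      finally show ?case .
    qed
  qed simp
  show ?thesis unfolding asymptotic_mod_def infdist_singleton dist_norm diff_zero using 1 2 3 by blast
qed

proposition lift_homotopy:
  fixes I :: "'d::cstar_algebra set" and G :: "'b::cstar_algebra \<Rightarrow> real \<times> real \<Rightarrow> 'd" and \<alpha> :: "nat \<Rightarrow> 'b"
  assumes I: "closed_ideal I" and G: "\<And>a. continuous_on param_space (G a)"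
    and hom: "asymptotic_mod I param_limit G"
    and bottom: "asymptotic_mod {0} param_limit (\<lambda>a x. G a (fst x, 0))"
    and dense: "\<And>b \<epsilon>. \<epsilon> > 0 \<Longrightarrow> \<exists>j. norm (b - \<alpha> j) < \<epsilon>"
  shows "\<exists>\<Psi>. (\<forall>a. continuous_on param_space (\<Psi> a) \<and> (\<forall>x\<in>param_space. \<Psi> a x - G a x \<in> I))
    \<and> asymptotic_mod {0} param_limit \<Psi>"
proof (rule lift_on_sequence[OF I G hom bottom, of \<alpha>])
  fix T :: "'b \<Rightarrow> real \<times> real \<Rightarrow> 'd"
  assume T1: "\<And>a. a \<in> range \<alpha> \<Longrightarrow> continuous_on param_space (T a)"
    and T2: "\<And>a x. a \<in> range \<alpha> \<Longrightarrow> x \<in> param_space \<Longrightarrow> T a x - G a x \<in> I"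
    and T3: "\<And>a b c \<epsilon>. {a, b, c} \<subseteq> range \<alpha> \<Longrightarrow> \<epsilon> > 0 \<Longrightarrow>
      eventually (\<lambda>x. norm (T a x * T b x - T c x) \<le> 4 * norm (a * b - c) + \<epsilon>) param_limit"
    and T4: "\<And>a b c \<mu> \<nu> \<epsilon>. {a, b, c} \<subseteq> range \<alpha> \<Longrightarrow> \<epsilon> > 0 \<Longrightarrow>
      eventually (\<lambda>x. norm (scaleC \<mu> (T a x) + scaleC \<nu> (T b x) - T c x)
        \<le> 4 * norm (scaleC \<mu> a + scaleC \<nu> b - c) + \<epsilon>) param_limit"
    and T5: "\<And>a b \<epsilon>. {a, b} \<subseteq> range \<alpha> \<Longrightarrow> \<epsilon> > 0 \<Longrightarrow>
      eventually (\<lambda>x. norm (star (T a x) - T b x) \<le> 4 * norm (star a - b) + \<epsilon>) param_limit"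
  have "eventually (\<lambda>x. norm (T (\<alpha> i) x - T (\<alpha> j) x) \<le> 4 * norm (\<alpha> i - \<alpha> j) + \<epsilon>) param_limit" if "\<epsilon> > 0" for i j \<epsilon>
    using T4[of "\<alpha> i" "\<alpha> i" "\<alpha> j" \<epsilon> 1 0] that by (simp add: scaleC.zero_left)
  then have "\<exists>\<psi>. continuous_on param_space \<psi> \<and> (\<forall>x\<in>param_space. \<psi> x - G a x \<in> I) \<and>
    (\<forall>j. \<forall>\<epsilon>>0. eventually (\<lambda>x. norm (\<psi> x - T (\<alpha> j) x) \<le> 4 * norm (a - \<alpha> j) + \<epsilon>) param_limit)" for a
    by (intro lift_near_sequence[OF I G hom dense T1 T2])
  then have "\<exists>\<Psi>. \<forall>a. continuous_on param_space (\<Psi> a) \<and> (\<forall>x\<in>param_space. \<Psi> a x - G a x \<in> I) \<and>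
    (\<forall>j. \<forall>\<epsilon>>0. eventually (\<lambda>x. norm (\<Psi> a x - T (\<alpha> j) x) \<le> 4 * norm (a - \<alpha> j) + \<epsilon>) param_limit)"
    by (intro choice allI)
  then obtain \<Psi> where \<Psi>: "\<forall>a. continuous_on param_space (\<Psi> a) \<and> (\<forall>x\<in>param_space. \<Psi> a x - G a x \<in> I) \<and>
    (\<forall>j. \<forall>\<epsilon>>0. eventually (\<lambda>x. norm (\<Psi> a x - T (\<alpha> j) x) \<le> 4 * norm (a - \<alpha> j) + \<epsilon>) param_limit)" ..
  have "asymptotic_mod {0} param_limit \<Psi>"
    by (rule asymptotic_from_dense_sequence[of \<alpha> \<Psi> T, OF dense _ T3 T4 T5]) (use \<Psi> in auto)
  with \<Psi> show ?thesis by blast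
qed

section \<open>The quotient and the algebra of continuous functions\<close>

lemma whole_simps [simp]:
  "elems whole = UNIV" "addS whole = (+)" "scaleS whole = scaleC" "multS whole = (*)"
  "starS whole = star" "normS whole = norm"
  by (simp_all add: whole_def)

lemma distS_whole: "distS whole x y = norm (x - y)"
  by (simp add: distS_def scaleC.minus_left)

lemma continuousS_on_whole: "continuousS_on whole S g \<longleftrightarrow> continuous_on S g"
  by (simp add: continuousS_on_def continuous_on_def distS_whole LIM_zero_iff tendsto_norm_zero_iff)

lemma quotient_norm:
  assumes I: "closed_ideal I"
  shows "normS (quotient_alg I) (qmap I d) = infdist d I"
proof -
  have "qmap I d = (\<lambda>i. d - i) ` I"
  proof safe
    fix x assume "x \<in> qmap I d"
    then have "- (x - d) \<in> I" using closed_ideal_minus[OF I] by (simp only: mem_qmap_iff)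
    then show "x \<in> (\<lambda>i. d - i) ` I" by (rule image_eqI[rotated]) simp
  next
    fix i assume "i \<in> I"
    then show "d - i \<in> qmap I d" using closed_ideal_minus[OF I] by (simp add: mem_qmap_iff)
  qed
  moreover have "I \<noteq> {}" using closed_idealD(1)[OF I] by auto
  ultimately show ?thesis
    by (simp add: quotient_alg_def infdist_notempty image_image dist_norm)
qed

lemma quotient_dist:
  assumes I: "closed_ideal I"
  shows "distS (quotient_alg I) (qmap I d) (qmap I e) = infdist (d - e) I"
  by (simp add: distS_def quotient_scaleS[OF I] quotient_addS[OF I] quotient_norm[OF I] scaleC.minus_left)

lemma quotient_star:
  assumes I: "closed_ideal I"
  shows "starS (quotient_alg I) (qmap I d) = qmap I (star d)"
proof -
  have "qmap I (star x) = qmap I (star d)" if "x \<in> qmap I d" for x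
    using closed_ideal_star[OF I, of "x - d"] that by (simp add: qmap_eq_iff[OF I] mem_qmap_iff star_diff)
  then have "(\<Union>x\<in>qmap I d. qmap I (star x)) = qmap I (star d)"
    by (intro SUP_eq_const) (use qmap_self[OF I] in blast)+
  then show ?thesis by (simp add: quotient_alg_def)
qed

lemma C01_simps:
  "addS (C01 E) g h = (\<lambda>t\<in>{0..1}. addS E (g t) (h t))"
  "scaleS (C01 E) c g = (\<lambda>t\<in>{0..1}. scaleS E c (g t))"
  "multS (C01 E) g h = (\<lambda>t\<in>{0..1}. multS E (g t) (h t))"
  "starS (C01 E) g = (\<lambda>t\<in>{0..1}. starS E (g t))"
  by (simp_all add: C01_def)

lemma C01_dist: "distS (C01 E) g h = (SUP t\<in>{0..1}. distS E (g t) (h t))"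
  unfolding distS_def by (auto simp: C01_def intro!: SUP_cong)

lemma C01_elems: "g \<in> elems (C01 E) \<longleftrightarrow> g \<in> {0..1} \<rightarrow>\<^sub>E elems E \<and> continuousS_on E {0..1} g"
  by (simp add: C01_def)

section \<open>Functions that are continuous modulo an ideal\<close>

definition continuous_mod :: "'d::cstar_algebra set \<Rightarrow> 'x::topological_space set \<Rightarrow> ('x \<Rightarrow> 'd) \<Rightarrow> bool" where
  "continuous_mod I S u \<longleftrightarrow> (\<forall>s\<in>S. ((\<lambda>t. infdist (u t - u s) I) \<longlongrightarrow> 0) (at s within S))"

lemma continuous_mod_if_continuous_on:
  assumes I: "closed_ideal I" and "continuous_on S u"
  shows "continuous_mod I S u"
  unfolding continuous_mod_def
proof
  fix s assume "s \<in> S"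
  then have "((\<lambda>t. u t - u s) \<longlongrightarrow> 0) (at s within S)"
    using assms(2) by (simp add: continuous_on_def LIM_zero)
  then have "((\<lambda>t. norm (u t - u s)) \<longlongrightarrow> 0) (at s within S)" by (rule tendsto_norm_zero)
  then show "((\<lambda>t. infdist (u t - u s) I) \<longlongrightarrow> 0) (at s within S)"
    by (rule Lim_null_comparison[rotated]) (auto simp: infdist_nonneg infdist_ideal_le_norm[OF I])
qed

text \<open>Continuity makes the supremum finite, so that it is an upper bound.\<close>

lemma infdist_le_Sup:
  fixes u v :: "real \<Rightarrow> 'd::cstar_algebra"
  assumes I: "closed_ideal I" and u: "continuous_mod I {0..1} u" and v: "continuous_mod I {0..1} v"
    and t: "t \<in> {0..1}"
  shows "infdist (u t - v t) I \<le> (SUP t\<in>{0..1}. infdist (u t - v t) I)"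
proof -
  have "continuous_on {0..1} (\<lambda>t. infdist (u t - v t) I)"
    unfolding continuous_on_def
  proof
    fix s :: real assume s: "s \<in> {0..1}"
    have le: "norm (infdist x I - infdist y I) \<le> infdist (x - y) I" for x y
      using infdist_ideal_triangle[OF I, of "x - y" y] infdist_ideal_triangle[OF I, of "- (x - y)" x]
        infdist_ideal_minus[OF I, of "x - y"] by auto
    have "norm (infdist (u t - v t) I - infdist (u s - v s) I) \<le> infdist (u t - u s) I + infdist (v t - v s) I" for t
    proof -
      have eq: "(u t - v t) - (u s - v s) = (u t - u s) + - (v t - v s)" by simp
      have "infdist ((u t - v t) - (u s - v s)) I \<le> infdist (u t - u s) I + infdist (v t - v s) I"
        unfolding eq by (rule order_trans[OF infdist_ideal_triangle[OF I]])
          (simp only: infdist_ideal_minus[OF I] order_refl)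
      then show ?thesis using le[of "u t - v t" "u s - v s"] by linarith
    qed
    moreover have "((\<lambda>t. infdist (u t - u s) I + infdist (v t - v s) I) \<longlongrightarrow> 0) (at s within {0..1})"
      using u v s unfolding continuous_mod_def by (intro tendsto_add_zero) auto
    ultimately have "((\<lambda>t. infdist (u t - v t) I - infdist (u s - v s) I) \<longlongrightarrow> 0) (at s within {0..1})"
      by (intro Lim_null_comparison[of "\<lambda>t. infdist (u t - v t) I - infdist (u s - v s) I"]) (auto intro: always_eventually)
    then show "((\<lambda>t. infdist (u t - v t) I) \<longlongrightarrow> infdist (u s - v s) I) (at s within {0..1})"
      by (rule LIM_zero_cancel)
  qed
  then have "compact ((\<lambda>t. infdist (u t - v t) I) ` {0..1})" by (intro compact_continuous_image) auto
  then have "bdd_above ((\<lambda>t. infdist (u t - v t) I) ` {0..1})"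
    by (intro bounded_imp_bdd_above compact_imp_bounded)
  then show ?thesis using t by (intro cSUP_upper)
qed

section \<open>Lifting the homotopy\<close>

text \<open>A homotopy with values in the quotient, as a function of both parameters, is continuous modulo the
  ideal and so has a continuous lift. Its relations hold modulo the ideal uniformly in the homotopy
  parameter. Subtracting the value of the lift at \<open>0\<close> and adding \<open>F\<close> makes it agree with \<open>F\<close>
  at the end \<open>0\<close> and changes it by elements of the ideal only.\<close>

lemma homotopy_continuous_lift:
  fixes I :: "'d::cstar_algebra set" and \<Phi> :: "real \<Rightarrow> 'b::cstar_algebra \<Rightarrow> real \<Rightarrow> 'd set"
  assumes I: "closed_ideal I" and \<Phi>: "asymptotic_homomorphism (C01 (quotient_alg I)) \<Phi>"
    and F: "asymptotic_homomorphism whole F" and F0: "\<And>l a. l \<ge> 1 \<Longrightarrow> qmap I (F l a) = \<Phi> l a 0"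
  shows "\<exists>G. (\<forall>a. continuous_on param_space (G a))
    \<and> (\<forall>l\<ge>1. \<forall>t\<in>{0..1}. \<forall>a. qmap I (G a (l, t)) = \<Phi> l a t) \<and> asymptotic_mod I param_limit G
    \<and> (\<forall>a l. G a (l, 0) = F l a)"
proof -
  let ?Q = "quotient_alg I"
  have elem: "\<Phi> l a \<in> elems (C01 ?Q)" if "l \<ge> 1" for l a
    using \<Phi> that by (auto simp: asymptotic_homomorphism_def)
  have "\<exists>d. \<Phi> l a t = qmap I d" if "l \<ge> 1" "t \<in> {0..1}" for l a t
    using elem[OF that(1), of a] that(2) by (auto simp: C01_elems quotient_alg_def dest!: PiE_mem)
  note ex = this
  define f where "f a x = (SOME d. \<Phi> (fst x) a (snd x) = qmap I d)" for a x
  have f: "\<Phi> l a t = qmap I (f a (l, t))" if "l \<ge> 1" "t \<in> {0..1}" for l a t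
    unfolding f_def fst_conv snd_conv by (rule someI_ex[OF ex[OF that]])
  have slice: "continuous_mod I {0..1} (\<lambda>t. f a (l, t))" if "l \<ge> 1" for l a
    unfolding continuous_mod_def
  proof
    fix s :: real assume s: "s \<in> {0..1}"
    have "((\<lambda>t. distS ?Q (\<Phi> l a t) (\<Phi> l a s)) \<longlongrightarrow> 0) (at s within {0..1})"
      using elem[OF that, of a] s by (auto simp: C01_elems continuousS_on_def)
    then show "((\<lambda>t. infdist (f a (l, t) - f a (l, s)) I) \<longlongrightarrow> 0) (at s within {0..1})"
      by (rule Lim_transform_within[OF _ zero_less_one])
        (use that s in \<open>auto simp: f quotient_dist[OF I]\<close>)
  qed
  have dist: "distS (C01 ?Q) (\<Phi> l a) (\<Phi> l' a) = (SUP t\<in>{0..1}. infdist (f a (l, t) - f a (l', t)) I)"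
    if "l \<ge> 1" "l' \<ge> 1" for l l' a
    unfolding C01_dist using that by (intro SUP_cong refl) (simp add: f quotient_dist[OF I])
  have joint: "((\<lambda>y. infdist (f a y - f a x) I) \<longlongrightarrow> 0) (at x within param_space)" if x: "x \<in> param_space" for a x
  proof -
    obtain l t where lt: "x = (l, t)" "l \<ge> 1" "t \<in> {0..1}" using x by (auto simp: param_space_def)
    have "((\<lambda>l'. distS (C01 ?Q) (\<Phi> l' a) (\<Phi> l a)) \<longlongrightarrow> 0) (at l within {1..})"
      using \<Phi> lt(2) by (auto simp: asymptotic_homomorphism_def continuousS_on_def)
    then have D: "eventually (\<lambda>l'. distS (C01 ?Q) (\<Phi> l' a) (\<Phi> l a) < e) (at l within {1..})" if "e > 0" for e
      using that by (rule order_tendstoD)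
    have S: "eventually (\<lambda>t'. infdist (f a (l, t') - f a (l, t)) I < e) (at t within {0..1})" if "e > 0" for e
      using slice[OF lt(2), of a] lt(3) that unfolding continuous_mod_def by (auto intro: order_tendstoD)
    show ?thesis
    proof (rule tendsto_zeroI_eventually)
      show "0 \<le> infdist (f a y - f a x) I" for y by (rule infdist_nonneg)
      fix e :: real assume "e > 0"
      then have e2: "e / 2 > 0" by simp
      have zz: "distS (C01 ?Q) (\<Phi> l a) (\<Phi> l a) < e / 2"
        using e2 closed_idealD(1)[OF I] by (simp add: dist[OF lt(2) lt(2)])
      have zz2: "infdist (f a (l, t) - f a (l, t)) I < e / 2"
        using e2 closed_idealD(1)[OF I] by simp
      obtain V where V: "open V" "l \<in> V" "\<forall>l'\<in>V \<inter> {1..}. distS (C01 ?Q) (\<Phi> l' a) (\<Phi> l a) < e / 2"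
        using eventually_within_neighbourhood[OF D[OF e2] zz] by blast
      obtain W where W: "open W" "t \<in> W" "\<forall>t'\<in>W \<inter> {0..1}. infdist (f a (l, t') - f a (l, t)) I < e / 2"
        using eventually_within_neighbourhood[OF S[OF e2] zz2] by blast
      show "eventually (\<lambda>y. infdist (f a y - f a x) I \<le> e) (at x within param_space)"
        unfolding eventually_at_topological
      proof (intro exI[of _ "V \<times> W"] conjI ballI impI)
        show "open (V \<times> W)" using V W by (intro open_Times)
        show "x \<in> V \<times> W" using V W lt by simp
        fix y assume y: "y \<in> V \<times> W" "y \<in> param_space"
        obtain l' t' where y': "y = (l', t')" "l' \<ge> 1" "t' \<in> {0..1}" using y(2) by (auto simp: param_space_def)
        have "infdist (f a (l', t') - f a (l, t')) I \<le> distS (C01 ?Q) (\<Phi> l' a) (\<Phi> l a)"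
          unfolding dist[OF y'(2) lt(2)] by (rule infdist_le_Sup[OF I slice[OF y'(2)] slice[OF lt(2)] y'(3)])
        also have "\<dots> < e / 2" using V(3) y y' by auto
        finally have 1: "infdist (f a (l', t') - f a (l, t')) I < e / 2" .
        have 2: "infdist (f a (l, t') - f a (l, t)) I < e / 2" using W(3) y y' by auto
        have "f a y - f a x = (f a (l', t') - f a (l, t')) + (f a (l, t') - f a (l, t))" by (simp add: y' lt)
        then show "infdist (f a y - f a x) I \<le> e"
          using infdist_ideal_triangle[OF I, of "f a (l', t') - f a (l, t')" "f a (l, t') - f a (l, t)"] 1 2 by simp
      qed
    qed
  qed
  have "\<exists>g. continuous_on param_space g \<and> (\<forall>x\<in>param_space. g x - f a x \<in> I)" for a
    by (rule continuous_lift[OF I joint]) blast+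
  then have "\<exists>G0. \<forall>a. continuous_on param_space (G0 a) \<and> (\<forall>x\<in>param_space. G0 a x - f a x \<in> I)"
    by (intro choice allI)
  then obtain G0 where G0: "\<forall>a. continuous_on param_space (G0 a) \<and> (\<forall>x\<in>param_space. G0 a x - f a x \<in> I)" ..
  define G where "G a x = G0 a x + (F (fst x) a - G0 a (fst x, 0))" for a x
  have Fcont: "continuous_on {1..} (\<lambda>l. F l a)" for a
    using F by (simp add: asymptotic_homomorphism_def continuousS_on_whole)
  have Gcont: "continuous_on param_space (G a)" for a
  proof -
    have "continuous_on param_space (\<lambda>x. F (fst x) a)"
      by (rule continuous_on_compose2[OF Fcont]) (auto intro!: continuous_intros simp: param_space_def)
    moreover have "continuous_on param_space (\<lambda>x. G0 a (fst x, 0))"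
      by (rule continuous_on_compose2[of param_space "G0 a"])
        (use G0 in \<open>auto intro!: continuous_intros simp: param_space_def\<close>)
    ultimately show ?thesis unfolding G_def using G0 by (intro continuous_intros) auto
  qed
  have qG: "\<Phi> l a t = qmap I (G a (l, t))" if lt: "l \<ge> 1" "t \<in> {0..1}" for l t a
  proof -
    have mem: "(l, t) \<in> param_space" "(l, 0) \<in> param_space" using lt by (auto simp: param_space_def)
    have "qmap I (F l a) = qmap I (f a (l, 0))" using F0[OF lt(1)] f[OF lt(1), of 0] by simp
    then have 1: "F l a - f a (l, 0) \<in> I" by (simp add: qmap_eq_iff[OF I])
    have "G0 a (l, t) - f a (l, t) + ((F l a - f a (l, 0)) - (G0 a (l, 0) - f a (l, 0))) \<in> I"
      using G0 mem 1 closed_idealD(2)[OF I] closed_ideal_diff[OF I] by blast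
    then have "G a (l, t) - f a (l, t) \<in> I" by (simp add: G_def algebra_simps)
    then have "qmap I (G a (l, t)) = qmap I (f a (l, t))" by (simp add: qmap_eq_iff[OF I])
    then show ?thesis using f[OF lt] by simp
  qed
  have Gslice: "continuous_on {0..1} (\<lambda>t. G a (l, t))" if "l \<ge> 1" for a l
    by (rule continuous_on_compose2[OF Gcont]) (use that in \<open>auto intro!: continuous_intros simp: param_space_def\<close>)
  have bound: "infdist (u t - v t) I \<le> distS (C01 ?Q) g h"
    if "continuous_on {0..1} u" "continuous_on {0..1} v" "\<And>t. t \<in> {0..1} \<Longrightarrow> g t = qmap I (u t)"
      "\<And>t. t \<in> {0..1} \<Longrightarrow> h t = qmap I (v t)" "t \<in> {0..1}" for u v :: "real \<Rightarrow> 'd" and g h t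
  proof -
    have "distS (C01 ?Q) g h = (SUP t\<in>{0..1}. infdist (u t - v t) I)"
      unfolding C01_dist using that(3,4) by (intro SUP_cong refl) (simp add: quotient_dist[OF I])
    then show ?thesis
      using infdist_le_Sup[OF I continuous_mod_if_continuous_on[OF I that(1)] continuous_mod_if_continuous_on[OF I that(2)] that(5)]
      by simp
  qed
  have hom: "asymptotic_mod I param_limit G"
    unfolding asymptotic_mod_def
  proof (intro conjI allI)
    fix a b and \<mu> \<nu> :: complex
    show "((\<lambda>x. infdist (G (star a) x - star (G a x)) I) \<longlongrightarrow> 0) param_limit"
    proof (rule tendsto_param_limitI)
      show "((\<lambda>l. distS (C01 ?Q) (\<Phi> l (star a)) (starS (C01 ?Q) (\<Phi> l a))) \<longlongrightarrow> 0) at_top"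
        using \<Phi> by (simp add: asymptotic_homomorphism_def)
      fix x assume x: "x \<in> param_space"
      then have l: "fst x \<ge> 1" "snd x \<in> {0..1}" by (auto simp: param_space_def)
      have "infdist (G (star a) (fst x, snd x) - star (G a (fst x, snd x))) I
          \<le> distS (C01 ?Q) (\<Phi> (fst x) (star a)) (starS (C01 ?Q) (\<Phi> (fst x) a))"
        by (rule bound) (use l in \<open>auto intro!: Gslice bounded_linear.continuous_on[OF bounded_linear_star]
            simp: qG C01_simps quotient_star[OF I]\<close>)
      then show "0 \<le> infdist (G (star a) x - star (G a x)) I \<and> infdist (G (star a) x - star (G a x)) I
          \<le> distS (C01 ?Q) (\<Phi> (fst x) (star a)) (starS (C01 ?Q) (\<Phi> (fst x) a))"
        by (simp add: infdist_nonneg)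
    qed
    show "((\<lambda>x. infdist (G (scaleC \<mu> a + scaleC \<nu> b) x - (scaleC \<mu> (G a x) + scaleC \<nu> (G b x))) I) \<longlongrightarrow> 0) param_limit"
    proof (rule tendsto_param_limitI)
      show "((\<lambda>l. distS (C01 ?Q) (\<Phi> l (scaleC \<mu> a + scaleC \<nu> b))
          (addS (C01 ?Q) (scaleS (C01 ?Q) \<mu> (\<Phi> l a)) (scaleS (C01 ?Q) \<nu> (\<Phi> l b)))) \<longlongrightarrow> 0) at_top"
        using \<Phi> by (simp add: asymptotic_homomorphism_def)
      fix x assume x: "x \<in> param_space"
      then have l: "fst x \<ge> 1" "snd x \<in> {0..1}" by (auto simp: param_space_def)
      have "infdist (G (scaleC \<mu> a + scaleC \<nu> b) (fst x, snd x) - (scaleC \<mu> (G a (fst x, snd x)) + scaleC \<nu> (G b (fst x, snd x)))) I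
          \<le> distS (C01 ?Q) (\<Phi> (fst x) (scaleC \<mu> a + scaleC \<nu> b))
            (addS (C01 ?Q) (scaleS (C01 ?Q) \<mu> (\<Phi> (fst x) a)) (scaleS (C01 ?Q) \<nu> (\<Phi> (fst x) b)))"
        by (rule bound) (use l in \<open>auto intro!: Gslice continuous_on_add scaleC.continuous_on continuous_on_const
            simp: qG C01_simps quotient_scaleS[OF I] quotient_addS[OF I]\<close>)
      then show "0 \<le> infdist (G (scaleC \<mu> a + scaleC \<nu> b) x - (scaleC \<mu> (G a x) + scaleC \<nu> (G b x))) I \<and>
          infdist (G (scaleC \<mu> a + scaleC \<nu> b) x - (scaleC \<mu> (G a x) + scaleC \<nu> (G b x))) I
          \<le> distS (C01 ?Q) (\<Phi> (fst x) (scaleC \<mu> a + scaleC \<nu> b))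
            (addS (C01 ?Q) (scaleS (C01 ?Q) \<mu> (\<Phi> (fst x) a)) (scaleS (C01 ?Q) \<nu> (\<Phi> (fst x) b)))"
        by (simp add: infdist_nonneg)
    qed
    show "((\<lambda>x. infdist (G (a * b) x - G a x * G b x) I) \<longlongrightarrow> 0) param_limit"
    proof (rule tendsto_param_limitI)
      show "((\<lambda>l. distS (C01 ?Q) (\<Phi> l (a * b)) (multS (C01 ?Q) (\<Phi> l a) (\<Phi> l b))) \<longlongrightarrow> 0) at_top"
        using \<Phi> by (simp add: asymptotic_homomorphism_def)
      fix x assume x: "x \<in> param_space"
      then have l: "fst x \<ge> 1" "snd x \<in> {0..1}" by (auto simp: param_space_def)
      have "infdist (G (a * b) (fst x, snd x) - G a (fst x, snd x) * G b (fst x, snd x)) I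
          \<le> distS (C01 ?Q) (\<Phi> (fst x) (a * b)) (multS (C01 ?Q) (\<Phi> (fst x) a) (\<Phi> (fst x) b))"
        by (rule bound) (use l in \<open>auto intro!: Gslice continuous_on_mult simp: qG C01_simps quotient_multS[OF I]\<close>)
      then show "0 \<le> infdist (G (a * b) x - G a x * G b x) I \<and> infdist (G (a * b) x - G a x * G b x) I
          \<le> distS (C01 ?Q) (\<Phi> (fst x) (a * b)) (multS (C01 ?Q) (\<Phi> (fst x) a) (\<Phi> (fst x) b))"
        by (simp add: infdist_nonneg)
    qed
  qed
  have "\<forall>a l. G a (l, 0) = F l a" by (simp add: G_def)
  then show ?thesis using Gcont qG[symmetric] hom by blast
qed

lemma separable_dense_sequence:
  assumes "separable_space (euclidean :: 'b::metric_space topology)"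
  obtains \<alpha> :: "nat \<Rightarrow> 'b::metric_space" where "\<And>b \<epsilon>. \<epsilon> > 0 \<Longrightarrow> \<exists>j. dist b (\<alpha> j) < \<epsilon>"
proof -
  obtain C :: "'b set" where C: "countable C" "closure C = UNIV"
    using assms by (auto simp: separable_space_def)
  then have ne: "C \<noteq> {}" by auto
  show thesis
  proof (rule that[of "from_nat_into C"])
    fix b :: 'b and \<epsilon> :: real assume "\<epsilon> > 0"
    then obtain y where "y \<in> C" "dist y b < \<epsilon>" using C(2) closure_approachable[of b C] by auto
    moreover obtain j where "y = from_nat_into C j" using \<open>y \<in> C\<close> C(1) from_nat_into_surj by metis
    ultimately show "\<exists>j. dist b (from_nat_into C j) < \<epsilon>" by (auto simp: dist_commute)
  qed
qed

proposition homotopy_lift: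
  fixes I :: "'d::cstar_algebra set" and \<Phi> :: "real \<Rightarrow> 'b::cstar_algebra \<Rightarrow> real \<Rightarrow> 'd set"
  assumes sep: "separable_space (euclidean :: 'b topology)"
    and I: "closed_ideal I" and hom: "is_homotopy (quotient_alg I) \<Phi> \<phi> (\<lambda>_. \<psi>)" and lift: "lifts I (\<lambda>_. \<psi>)"
  shows "\<exists>\<Psi>. (\<forall>a. continuous_on param_space (\<Psi> a))
    \<and> (\<forall>l\<ge>1. \<forall>t\<in>{0..1}. \<forall>a. qmap I (\<Psi> a (l, t)) = \<Phi> l a t) \<and> asymptotic_mod {0} param_limit \<Psi>"
proof -
  obtain F where F: "asymptotic_homomorphism whole F" "\<And>l a. l \<ge> 1 \<Longrightarrow> qmap I (F l a) = \<psi> a"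
    using lift by (auto simp: lifts_def)
  have \<Phi>: "asymptotic_homomorphism (C01 (quotient_alg I)) \<Phi>" "\<And>l a. l \<ge> 1 \<Longrightarrow> \<Phi> l a 0 = \<psi> a"
    using hom by (auto simp: is_homotopy_def ev_def)
  have F0: "qmap I (F l a) = \<Phi> l a 0" if "l \<ge> 1" for l a using F(2) \<Phi>(2) that by simp
  obtain G where G: "\<And>a. continuous_on param_space (G a)"
    "\<And>l t a. l \<ge> 1 \<Longrightarrow> t \<in> {0..1} \<Longrightarrow> qmap I (G a (l, t)) = \<Phi> l a t" "asymptotic_mod I param_limit G"
    "\<And>a l. G a (l, 0) = F l a"
    using homotopy_continuous_lift[OF I \<Phi>(1) F(1) F0] by blast
  have bottom: "asymptotic_mod {0} param_limit (\<lambda>a x. G a (fst x, 0))"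
    unfolding asymptotic_mod_def G(4) infdist_singleton dist_norm diff_zero
    using F(1) unfolding asymptotic_homomorphism_def distS_whole whole_simps
    by (auto intro!: filterlim_compose[OF _ filterlim_fst_param_limit])
  obtain \<alpha> :: "nat \<Rightarrow> 'b" where "\<And>b \<epsilon>. \<epsilon> > 0 \<Longrightarrow> \<exists>j. dist b (\<alpha> j) < \<epsilon>"
    using separable_dense_sequence[OF sep] by blast
  then have dense: "\<exists>j. norm (b - \<alpha> j) < \<epsilon>" if "\<epsilon> > 0" for b \<epsilon> using that by (simp add: dist_norm)
  have "\<exists>\<Psi>. (\<forall>a. continuous_on param_space (\<Psi> a) \<and> (\<forall>x\<in>param_space. \<Psi> a x - G a x \<in> I))
      \<and> asymptotic_mod {0} param_limit \<Psi>"
    by (rule lift_homotopy[OF I G(1,3) bottom]) (rule dense)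
  then obtain \<Psi> where \<Psi>: "\<forall>a. continuous_on param_space (\<Psi> a) \<and> (\<forall>x\<in>param_space. \<Psi> a x - G a x \<in> I)"
      "asymptotic_mod {0} param_limit \<Psi>"
    by (elim exE conjE)
  have "qmap I (\<Psi> a (l, t)) = \<Phi> l a t" if "l \<ge> 1" "t \<in> {0..1}" for l t a
  proof -
    have "\<Psi> a (l, t) - G a (l, t) \<in> I" using \<Psi>(1) that by (auto simp: param_space_def)
    then show ?thesis using G(2)[OF that] qmap_eq_iff[OF I] by metis
  qed
  with \<Psi> show ?thesis by blast
qed

lemma asymptotic_homomorphism_whole_if_param:
  assumes cont: "\<And>a. continuous_on param_space (\<Psi> a)" and hom: "asymptotic_mod {0} param_limit \<Psi>"
  shows "asymptotic_homomorphism whole (\<lambda>l a. \<Psi> a (l, 1))"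
proof -
  have "continuous_on {1..} (\<lambda>l. \<Psi> a (l, 1))" for a
    by (rule continuous_on_compose2[OF cont]) (auto intro!: continuous_intros simp: param_space_def)
  moreover have "((\<lambda>l. h (l, 1)) \<longlongrightarrow> 0) at_top" if "(h \<longlongrightarrow> 0) param_limit" for h :: "real \<times> real \<Rightarrow> real"
    by (rule filterlim_compose[OF that filterlim_param_limit_at]) simp
  ultimately show ?thesis
    using hom unfolding asymptotic_homomorphism_def asymptotic_mod_def distS_whole whole_simps
      continuousS_on_whole infdist_singleton dist_norm diff_zero
    by blast
qed

lemma asymptotic_homomorphism_C01_if_param:
  assumes cont: "\<And>a. continuous_on param_space (\<Psi> a)" and hom: "asymptotic_mod {0} param_limit \<Psi>"
  shows "asymptotic_homomorphism (C01 whole) (\<lambda>l a. \<lambda>t\<in>{0..1}. \<Psi> a (l, t))"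
  unfolding asymptotic_homomorphism_def
proof (intro conjI allI impI)
  fix l :: real and a assume l: "l \<ge> 1"
  have "continuous_on {0..1} (\<lambda>t. \<Psi> a (l, t))"
    by (rule continuous_on_compose2[OF cont]) (use l in \<open>auto intro!: continuous_intros simp: param_space_def\<close>)
  then have "continuous_on {0..1} (\<lambda>t\<in>{0..1}. \<Psi> a (l, t))" by (rule continuous_on_eq) simp
  then show "(\<lambda>t\<in>{0..1}. \<Psi> a (l, t)) \<in> elems (C01 whole)"
    by (simp add: C01_elems continuousS_on_whole)
next
  fix a
  show "continuousS_on (C01 whole) {1..} (\<lambda>l. \<lambda>t\<in>{0..1}. \<Psi> a (l, t))"
    unfolding continuousS_on_def C01_dist distS_whole
  proof (intro ballI tendstoI)
    fix l e :: real assume l: "l \<in> {1..}" and e: "e > 0"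
    let ?K = "{1..l + 1} \<times> {0..1::real}"
    have "uniformly_continuous_on ?K (\<Psi> a)"
      by (intro compact_uniformly_continuous compact_Times compact_Icc continuous_on_subset[OF cont])
        (auto simp: param_space_def)
    then obtain d where d: "d > 0" "\<And>x x'. x \<in> ?K \<Longrightarrow> x' \<in> ?K \<Longrightarrow> dist x' x < d \<Longrightarrow> dist (\<Psi> a x') (\<Psi> a x) < e / 2"
      using e unfolding uniformly_continuous_on_def by (metis half_gt_zero)
    have "eventually (\<lambda>l'. dist l' l < min d 1 \<and> l' \<in> {1..}) (at l within {1..})"
      using d(1) by (auto simp: eventually_at intro!: exI[of _ "min d 1"])
    then show "eventually (\<lambda>l'. dist (SUP t\<in>{0..1}. norm ((\<lambda>t\<in>{0..1}. \<Psi> a (l', t)) t - (\<lambda>t\<in>{0..1}. \<Psi> a (l, t)) t)) 0 < e) (at l within {1..})"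
    proof eventually_elim
      case (elim l')
      have "\<bar>SUP t\<in>{0..1}. norm ((\<lambda>t\<in>{0..1}. \<Psi> a (l', t)) t - (\<lambda>t\<in>{0..1}. \<Psi> a (l, t)) t)\<bar> \<le> e / 2"
      proof (rule cSup_abs_le)
        fix y assume "y \<in> (\<lambda>t. norm ((\<lambda>t\<in>{0..1}. \<Psi> a (l', t)) t - (\<lambda>t\<in>{0..1}. \<Psi> a (l, t)) t)) ` {0..1}"
        then obtain t where t: "t \<in> {0..1}" "y = norm (\<Psi> a (l', t) - \<Psi> a (l, t))" by auto
        have "dist (\<Psi> a (l', t)) (\<Psi> a (l, t)) < e / 2"
          using elim l t(1) by (intro d(2)) (auto simp: dist_Pair_Pair dist_real_def)
        then show "\<bar>y\<bar> \<le> e / 2" by (simp add: t dist_norm)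
      qed simp
      then show ?case using e by simp
    qed
  qed
next
  fix a b and \<mu> \<nu> :: complex
  note lim = hom[unfolded asymptotic_mod_def infdist_singleton dist_norm diff_zero]
  show "((\<lambda>l. distS (C01 whole) (\<lambda>t\<in>{0..1}. \<Psi> (star a) (l, t)) (starS (C01 whole) (\<lambda>t\<in>{0..1}. \<Psi> a (l, t)))) \<longlongrightarrow> 0) at_top"
    unfolding C01_dist distS_whole
    by (rule Sup_tendsto_param_limit[of "\<lambda>x. norm (\<Psi> (star a) x - star (\<Psi> a x))"])
      (use lim in \<open>auto simp: C01_simps\<close>)
  show "((\<lambda>l. distS (C01 whole) (\<lambda>t\<in>{0..1}. \<Psi> (scaleC \<mu> a + scaleC \<nu> b) (l, t))
      (addS (C01 whole) (scaleS (C01 whole) \<mu> (\<lambda>t\<in>{0..1}. \<Psi> a (l, t))) (scaleS (C01 whole) \<nu> (\<lambda>t\<in>{0..1}. \<Psi> b (l, t))))) \<longlongrightarrow> 0) at_top"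
    unfolding C01_dist distS_whole
    by (rule Sup_tendsto_param_limit[of "\<lambda>x. norm (\<Psi> (scaleC \<mu> a + scaleC \<nu> b) x - (scaleC \<mu> (\<Psi> a x) + scaleC \<nu> (\<Psi> b x)))"])
      (use lim in \<open>auto simp: C01_simps\<close>)
  show "((\<lambda>l. distS (C01 whole) (\<lambda>t\<in>{0..1}. \<Psi> (a * b) (l, t))
      (multS (C01 whole) (\<lambda>t\<in>{0..1}. \<Psi> a (l, t)) (\<lambda>t\<in>{0..1}. \<Psi> b (l, t)))) \<longlongrightarrow> 0) at_top"
    unfolding C01_dist distS_whole
    by (rule Sup_tendsto_param_limit[of "\<lambda>x. norm (\<Psi> (a * b) x - \<Psi> a x * \<Psi> b x)"])
      (use lim in \<open>auto simp: C01_simps\<close>)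
qed

theorem theorem40:
  fixes I :: "'d::cstar_algebra set"
    and \<phi> :: "real \<Rightarrow> 'b::cstar_algebra \<Rightarrow> 'd set"
    and \<psi> :: "'b \<Rightarrow> 'd set"
  assumes "separable_space (euclidean :: 'b topology)"
    and "closed_ideal I"
    and "asymptotic_homomorphism (quotient_alg I) \<phi>"
    and "star_homomorphism (quotient_alg I) \<psi>"
    and "asymptotically_homotopic (quotient_alg I) \<phi> (\<lambda>_. \<psi>)"
    and "lifts I (\<lambda>_. \<psi>)"
  shows "lifts I \<phi> \<and>
    (\<forall>\<Phi>. is_homotopy (quotient_alg I) \<Phi> \<phi> (\<lambda>_. \<psi>) \<longrightarrow>
      (\<exists>\<Psi>. asymptotic_homomorphism (C01 whole) \<Psi> \<and>
        (\<forall>l\<ge>1. \<forall>a. tensor_id (qmap I) (\<Psi> l a) = \<Phi> l a)))"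
proof (intro conjI allI impI)
  obtain \<Phi> where \<Phi>: "is_homotopy (quotient_alg I) \<Phi> \<phi> (\<lambda>_. \<psi>)"
    using assms(5) by (auto simp: asymptotically_homotopic_def)
  obtain \<Psi> where \<Psi>: "\<forall>a. continuous_on param_space (\<Psi> a)"
      "\<forall>l\<ge>1. \<forall>t\<in>{0..1}. \<forall>a. qmap I (\<Psi> a (l, t)) = \<Phi> l a t" "asymptotic_mod {0} param_limit \<Psi>"
    using homotopy_lift[OF assms(1,2) \<Phi> assms(6)] by (elim exE conjE)
  have "asymptotic_homomorphism whole (\<lambda>l a. \<Psi> a (l, 1))"
    using \<Psi> by (intro asymptotic_homomorphism_whole_if_param) auto
  moreover have "qmap I (\<Psi> a (l, 1)) = \<phi> l a" if "l \<ge> 1" for l a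
    using \<Psi>(2) \<Phi> that by (auto simp: is_homotopy_def ev_def)
  ultimately show "lifts I \<phi>" unfolding lifts_def by blast
next
  fix \<Phi> assume \<Phi>: "is_homotopy (quotient_alg I) \<Phi> \<phi> (\<lambda>_. \<psi>)"
  obtain \<Psi> where \<Psi>: "\<forall>a. continuous_on param_space (\<Psi> a)"
      "\<forall>l\<ge>1. \<forall>t\<in>{0..1}. \<forall>a. qmap I (\<Psi> a (l, t)) = \<Phi> l a t" "asymptotic_mod {0} param_limit \<Psi>"
    using homotopy_lift[OF assms(1,2) \<Phi> assms(6)] by (elim exE conjE)
  have "asymptotic_homomorphism (C01 whole) (\<lambda>l a. \<lambda>t\<in>{0..1}. \<Psi> a (l, t))"
    using \<Psi> by (intro asymptotic_homomorphism_C01_if_param) auto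
  moreover have "tensor_id (qmap I) (\<lambda>t\<in>{0..1}. \<Psi> a (l, t)) = \<Phi> l a" if l: "l \<ge> 1" for l a
  proof (rule ext)
    fix t
    have "\<Phi> l a \<in> {0..1} \<rightarrow>\<^sub>E elems (quotient_alg I)"
      using \<Phi> l by (auto simp: is_homotopy_def asymptotic_homomorphism_def C01_elems)
    then show "tensor_id (qmap I) (\<lambda>t\<in>{0..1}. \<Psi> a (l, t)) t = \<Phi> l a t"
      using \<Psi>(2) l by (cases "t \<in> {0..1}") (auto simp: tensor_id_def dest: PiE_arb)
  qed
  ultimately show "\<exists>\<Psi>. asymptotic_homomorphism (C01 whole) \<Psi> \<and>
      (\<forall>l\<ge>1. \<forall>a. tensor_id (qmap I) (\<Psi> l a) = \<Phi> l a)"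
    by blast
qed

end
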